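(* Let $q\in \mathbf{Q}$. If $u\in H^2(B)$ is such that $(\Delta +q) u=0$ in $B$ and $u$ vanishes of infinite order at $0$, then $u=0$ in $B$.
   Context: Let $n\ge 3$ be an integer, $p:=\frac{2n}{n+2}$, $p':=\frac{2n}{n-2}$. $B_r\subset\mathbb{R}^n$ is the open ball centered at $0$ with radius $r>0$, $B:=B_1$, $\dot B:=B\setminus\{0\}$; $\mathbb{N}$ is the set of positive integers. Let $\mathbf{B}_r$ be the closed ball of $L^{n/2}(B)$ centered at $0$ with radius $r>0$. A function $w\in L^2(B)$ vanishes of infinite order at $0$ if there exists $0<\gamma<1$ such that for every integer $m>0$ there is a constant $c_m>0$ with $r^{-m}\int_{B_r}|w|^2dx\le c_m$ for all $0<r<\gamma$. $\Lambda:=\{\lambda>0:\ \mathrm{dist}(\lambda,\mathbb{N}+\frac{n-2}{2})=\frac12\}$. $r_\ast=r_\ast(n)>0$ is a constant (such a constant exists) with the property that for every $0<r_0<r_\ast$ there is $\kappa_0=\kappa_0(n,r_0)>0$ such that $\||x|^{-\lambda}u\|_{L^{p'}(B)}\le \kappa_0\||x|^{-\lambda}(\Delta+q)u\|_{L^p(B)}$ for all $u\in C_0^\infty(\dot B)$, $q\in\mathbf{B}_{r_0}$, $\lambda\in\Lambda$. $\sigma:=\sup\{\|w\|_{L^{p'}(B)}:\ w\in H_0^1(B),\ \|\nabla w\|_{L^2(B)}=1\}$. Fix $0<r_0<r_\ast$ and $\vartheta>0$ with $2\vartheta\sigma^2<1$; set $\varsigma:=\inf(r_0,\vartheta)$ and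 $\mathbf{Q}:=\{q\in L^{n}(B):\ \|q\|_{L^n(B)}\le |B|^{-1/n}\varsigma\}$, where $|B|$ is the Lebesgue measure of $B$. *)

theory Defs
  imports "HOL-Analysis.Analysis"
begin

section \<open>Lebesgue spaces\<close>

text \<open>
  Elements of function spaces are represented by functions on the whole space; only their values
  on \<open>U\<close>, up to null sets, matter. \<open>Lp_norm U s f\<close> is meaningful only for
  \<open>f \<in> Lp U s\<close>, as the integral of a non-integrable function is \<open>0\<close>.
\<close>

definition Lp :: "(real^'n) set \<Rightarrow> real \<Rightarrow> (real^'n \<Rightarrow> real) set" where
  "Lp U s = {f. f \<in> borel_measurable (lebesgue_on U) \<and>
                integrable (lebesgue_on U) (\<lambda>x. \<bar>f x\<bar> powr s)}"

definition Lp_norm :: "(real^'n) set \<Rightarrow> real \<Rightarrow> (real^'n \<Rightarrow> 'b::real_normed_vector) \<Rightarrow> real" where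
  "Lp_norm U s f = (LINT x|lebesgue_on U. norm (f x) powr s) powr (1 / s)"

definition L1_loc :: "(real^'n) set \<Rightarrow> (real^'n \<Rightarrow> real) set" where
  "L1_loc U = {f. \<forall>K. compact K \<and> K \<subseteq> U \<longrightarrow> integrable (lebesgue_on K) f}"


section \<open>Test functions\<close>

definition partial :: "'n \<Rightarrow> (real^'n \<Rightarrow> real) \<Rightarrow> real^'n \<Rightarrow> real" where
  "partial i f x = frechet_derivative f (at x) (axis i 1)"

fun partials :: "'n list \<Rightarrow> (real^'n \<Rightarrow> real) \<Rightarrow> real^'n \<Rightarrow> real" where
  "partials [] f = f"
| "partials (i # is) f = partial i (partials is f)"

text \<open>
  All iterated partial derivatives are Frechet differentiable, hence exist and are continuous
  to all orders.
\<close>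

definition smooth :: "(real^'n \<Rightarrow> real) \<Rightarrow> bool" where
  "smooth f \<longleftrightarrow> (\<forall>is x. partials is f differentiable (at x))"

text \<open>Test functions on \<open>U\<close> are extended by \<open>0\<close> to the whole space.\<close>

definition C0_infty :: "(real^'n) set \<Rightarrow> (real^'n \<Rightarrow> real) set" where
  "C0_infty U = {f. smooth f \<and> compact (closure {x. f x \<noteq> 0}) \<and> closure {x. f x \<noteq> 0} \<subseteq> U}"

definition laplacian :: "(real^'n \<Rightarrow> real) \<Rightarrow> real^'n \<Rightarrow> real" where
  "laplacian f x = (\<Sum>i\<in>UNIV. partials [i, i] f x)"


section \<open>Weak derivatives and Sobolev spaces\<close>

definition has_weak_deriv ::
    "(real^'n) set \<Rightarrow> 'n list \<Rightarrow> (real^'n \<Rightarrow> real) \<Rightarrow> (real^'n \<Rightarrow> real) \<Rightarrow> bool" where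
  "has_weak_deriv U is u v \<longleftrightarrow> u \<in> L1_loc U \<and> v \<in> L1_loc U \<and>
     (\<forall>\<phi>\<in>C0_infty U. (LINT x|lebesgue_on U. u x * partials is \<phi> x) =
        (-1) ^ length is * (LINT x|lebesgue_on U. v x * \<phi> x))"

text \<open>
  On an open set a weak derivative is unique up to null sets, so the choice below is
  immaterial as long as only almost-everywhere properties are used.
\<close>

definition weak_deriv ::
    "(real^'n) set \<Rightarrow> 'n list \<Rightarrow> (real^'n \<Rightarrow> real) \<Rightarrow> real^'n \<Rightarrow> real" where
  "weak_deriv U is u = (SOME v. has_weak_deriv U is u v)"

definition weak_grad :: "(real^'n) set \<Rightarrow> (real^'n \<Rightarrow> real) \<Rightarrow> real^'n \<Rightarrow> real^'n" where
  "weak_grad U u x = (\<chi> i. weak_deriv U [i] u x)"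

definition weak_laplacian :: "(real^'n) set \<Rightarrow> (real^'n \<Rightarrow> real) \<Rightarrow> real^'n \<Rightarrow> real" where
  "weak_laplacian U u x = (\<Sum>i\<in>UNIV. weak_deriv U [i, i] u x)"

definition sobolev_H :: "nat \<Rightarrow> (real^'n) set \<Rightarrow> (real^'n \<Rightarrow> real) set" where
  "sobolev_H k U = {u. u \<in> Lp U 2 \<and>
     (\<forall>is. length is \<le> k \<longrightarrow> (\<exists>v\<in>Lp U 2. has_weak_deriv U is u v))}"

definition H1_norm :: "(real^'n) set \<Rightarrow> (real^'n \<Rightarrow> real) \<Rightarrow> real" where
  "H1_norm U u = sqrt ((Lp_norm U 2 u)\<^sup>2 + (Lp_norm U 2 (weak_grad U u))\<^sup>2)"

definition H01 :: "(real^'n) set \<Rightarrow> (real^'n \<Rightarrow> real) set" where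
  "H01 U = {w \<in> sobolev_H 1 U. \<exists>\<phi>. (\<forall>k::nat. \<phi> k \<in> C0_infty U) \<and>
     (\<lambda>k. H1_norm U (\<lambda>x. w x - \<phi> k x)) \<longlonglongrightarrow> 0}"


section \<open>Vanishing of infinite order\<close>

definition vanishes_infinite_order :: "(real^'n \<Rightarrow> real) \<Rightarrow> bool" where
  "vanishes_infinite_order w \<longleftrightarrow> w \<in> Lp (ball 0 1) 2 \<and>
     (\<exists>\<gamma>. 0 < \<gamma> \<and> \<gamma> < 1 \<and>
       (\<forall>m::nat. m > 0 \<longrightarrow> (\<exists>c>0. \<forall>r. 0 < r \<and> r < \<gamma> \<longrightarrow>
          (1 / r ^ m) * (LINT x|lebesgue_on (ball 0 r). \<bar>w x\<bar>\<^sup>2) \<le> c)))"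


section \<open>The constants and the class of potentials\<close>

text \<open>The \<open>itself\<close> arguments carry the dimension \<open>n = CARD('n)\<close>.\<close>

definition exp_p :: "'n::finite itself \<Rightarrow> real" where
  "exp_p _ = 2 * real CARD('n) / (real CARD('n) + 2)"

definition exp_p' :: "'n::finite itself \<Rightarrow> real" where
  "exp_p' _ = 2 * real CARD('n) / (real CARD('n) - 2)"

definition Lambda :: "'n::finite itself \<Rightarrow> real set" where
  "Lambda _ = {l. l > 0 \<and>
     infdist l {real k + (real CARD('n) - 2) / 2 | k::nat. k > 0} = 1 / 2}"

definition closed_ball_Ln2 :: "real \<Rightarrow> (real^'n \<Rightarrow> real) set" where
  "closed_ball_Ln2 r = {q \<in> Lp (ball 0 1) (real CARD('n) / 2).
     Lp_norm (ball 0 1) (real CARD('n) / 2) q \<le> r}"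

definition carleman_radius :: "'n::finite itself \<Rightarrow> real \<Rightarrow> bool" where
  "carleman_radius T rs \<longleftrightarrow> rs > 0 \<and>
     (\<forall>r0. 0 < r0 \<and> r0 < rs \<longrightarrow>
       (\<exists>\<kappa>>0. \<forall>u \<in> C0_infty (ball (0::real^'n) 1 - {0}).
          \<forall>q \<in> closed_ball_Ln2 r0. \<forall>l \<in> Lambda T.
            Lp_norm (ball 0 1) (exp_p' T) (\<lambda>x. norm x powr (-l) * u x)
              \<le> \<kappa> * Lp_norm (ball 0 1) (exp_p T)
                       (\<lambda>x. norm x powr (-l) * (laplacian u x + q x * u x))))"

text \<open>
  For \<open>n \<ge> 3\<close> the set is nonempty and, by the Sobolev embedding, consists of norms of
  \<open>L\<^sup>p\<^sup>'\<close> functions and is bounded, so the real supremum is the intended one.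
\<close>

definition sobolev_const :: "'n::finite itself \<Rightarrow> real" where
  "sobolev_const T = Sup {Lp_norm (ball 0 1) (exp_p' T) w | w :: real^'n \<Rightarrow> real.
     w \<in> H01 (ball 0 1) \<and> Lp_norm (ball 0 1) 2 (weak_grad (ball 0 1) w) = 1}"

definition potentials :: "real \<Rightarrow> real \<Rightarrow> (real^'n \<Rightarrow> real) set" where
  "potentials r0 \<theta> = {q \<in> Lp (ball 0 1) (real CARD('n)).
     Lp_norm (ball 0 1) (real CARD('n)) q
       \<le> measure lebesgue (ball (0::real^'n) 1) powr (- 1 / real CARD('n)) * min r0 \<theta>}"

end

theory Submission
  imports Defs
begin

text \<open>
  For \<open>\<zeta>\<close> supported in the punctured ball, mollifying \<open>\<zeta> u\<close> makes it admissible in the Carleman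
  inequality. In the limit the right-hand side only sees \<open>2 \<nabla>\<zeta> \<cdot> \<nabla>u + u \<Delta>\<zeta>\<close>, since \<open>\<Delta>u + q u = 0\<close>;
  the limit is harmless because \<open>q \<in> L\<^sup>n\<close> maps \<open>L\<^sup>2\<close> into \<open>L\<^sup>p\<close>. Take \<open>\<zeta>\<close> equal to \<open>1\<close> on
  \<open>2\<epsilon> < |x| < \<rho>\<close>. The inner commutator carries a weight \<open>\<epsilon>\<^sup>-\<^sup>\<lambda>\<close>, but \<open>u\<close> vanishes of infinite order,
  and so does \<open>\<nabla>u\<close>, hence it disappears as \<open>\<epsilon> \<rightarrow> 0\<close> for fixed \<open>\<lambda>\<close>. What remains is
  \<open>\<parallel>(\<rho>/|x|)\<^sup>\<lambda> u\<parallel> \<le> C\<close> on the ball of radius \<open>\<rho>\<close> with \<open>C\<close> independent of \<open>\<lambda> \<in> \<Lambda>\<close>, and \<open>\<lambda> \<rightarrow> \<infinity>\<close>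
  forces \<open>u = 0\<close> there. As \<open>\<rho> < 1\<close> is arbitrary, \<open>u = 0\<close> in the whole ball.
\<close>

section \<open>Smooth functions and cutoffs\<close>

text \<open>The Carleman inequality speaks about smooth functions and keeps the rough potential.
  Mollification commutes with the Laplacian but not with multiplication by q, so q times the
  mollification error has to be small in \<open>L\<^sup>p\<close>. Only the \<open>L\<^sup>2\<close>
  norm of that error is under control, and 1/p = 1/n + 1/2 is the relation that makes q in
  \<open>L\<^sup>n\<close> the right class. The factor |B| to the power -1/n in
  \<open>potentials\<close> then places q in the ball of exponent n/2 for which the inequality
  holds.

  What matters is uniformity in \<lambda>, not sharpness. Hence Hoelder estimates are traded for
  Young's inequality and a splitting by height, a single mollification with error below 1 stands for
  the limit, and since p' \<ge> 2 the conclusion is read off in \<open>L\<^sup>2\<close>.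

  The assumption of infinite order concerns u alone, while the commutator contains the gradient of
  u. Integration by parts against a cutoff of scale \<epsilon> recovers the gradient at the cost of
  a fixed power of \<epsilon>.\<close>

lemma partial_eq:
  assumes "(f has_derivative f') (at x)"
  shows "partial i f x = f' (axis i 1)"
  using frechet_derivative_at[OF assms] by (simp add: partial_def)

lemma partials_append: "partials (is @ js) f = partials is (partials js f)"
  by (induction "is") auto

text \<open>Smoothness quantifies over all iterated partials, which are unpleasant to compute. A set
  of differentiable functions that is stable under each single \<open>partial i\<close> reduces it
  to first derivatives. The closure below, affine substitutions and convolutions are all treated
  this way.\<close>

lemma smooth_coinduct:
  assumes "f \<in> S" and "\<And>g x. g \<in> S \<Longrightarrow> g differentiable (at x)"
    and "\<And>g i. g \<in> S \<Longrightarrow> partial i g \<in> S"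
  shows "smooth f"
proof -
  have "partials is f \<in> S" for "is"
    by (induction "is") (auto intro: assms)
  then show ?thesis
    using assms(2) by (simp add: smooth_def)
qed

lemma smooth_differentiable: "smooth f \<Longrightarrow> f differentiable (at x)"
  unfolding smooth_def by (metis partials.simps(1))

lemma smooth_has_derivative:
  "smooth f \<Longrightarrow> (f has_derivative frechet_derivative f (at x)) (at x)"
  by (simp add: frechet_derivative_works[symmetric] smooth_differentiable)

lemma smooth_partials: "smooth f \<Longrightarrow> smooth (partials is f)"
  unfolding smooth_def by (metis partials_append)

lemma smooth_partial: "smooth f \<Longrightarrow> smooth (partial i f)"
  using smooth_partials[of f "[i]"] by simp

lemma smooth_continuous_on: "smooth f \<Longrightarrow> continuous_on S f"
  by (meson continuous_at_imp_continuous_on differentiable_imp_continuous_within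
      smooth_differentiable)

lemma smooth_borel: "smooth f \<Longrightarrow> f \<in> borel_measurable borel"
  by (intro borel_measurable_continuous_onI smooth_continuous_on)

lemma frechet_derivative_partial:
  assumes "f differentiable (at x)"
  shows "frechet_derivative f (at x) h = (\<Sum>i\<in>UNIV. h $ i * partial i f x)"
proof -
  have "linear (frechet_derivative f (at x))"
    using assms by (rule linear_frechet_derivative)
  then have "frechet_derivative f (at x) (\<Sum>i\<in>UNIV. h $ i *\<^sub>R axis i 1) =
      (\<Sum>i\<in>UNIV. h $ i *\<^sub>R partial i f x)"
    by (simp add: linear_sum linear_cmul partial_def)
  moreover have "(\<Sum>i\<in>UNIV. h $ i *\<^sub>R axis i 1) = h"
    using basis_expansion[of h] by (simp add: scalar_mult_eq_scaleR)
  ultimately show ?thesis by simp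
qed

text \<open>The functions \<open>flat_exp k\<close> span a space that is closed under differentiation.\<close>

definition flat_exp :: "nat \<Rightarrow> real \<Rightarrow> real" where
  "flat_exp k t = (if t > 0 then exp (- 1 / t) / t ^ k else 0)"

lemma flat_exp_nonneg: "0 \<le> flat_exp k t"
  by (simp add: flat_exp_def)

lemma flat_exp_0_pos: "t > 0 \<Longrightarrow> 0 < flat_exp 0 t"
  by (simp add: flat_exp_def)

lemma flat_exp_nonpos: "t \<le> 0 \<Longrightarrow> flat_exp k t = 0"
  by (simp add: flat_exp_def)

text \<open>One term of the exponential series gives exp(1/t) \<ge> (1/t)^(k+2) / (k+2)!. The spare
  square of t is what makes the derivative at 0 exist and vanish.\<close>

lemma flat_exp_le: "flat_exp k t \<le> fact (k + 2) * t\<^sup>2"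
proof (cases "t > 0")
  case True
  have "(1 / t) ^ (k + 2) / fact (k + 2) \<le> exp (1 / t)"
  proof -
    have "(\<Sum>n\<in>{k + 2}. (1 / t) ^ n /\<^sub>R fact n) \<le> exp (1 / t)"
      unfolding exp_def using True
      by (intro sum_le_suminf summable_exp_generic) auto
    then show ?thesis by (simp add: field_simps)
  qed
  then have "inverse (exp (1 / t)) \<le> inverse ((1 / t) ^ (k + 2) / fact (k + 2))"
    using True by (intro le_imp_inverse_le) auto
  also have "\<dots> = fact (k + 2) * t\<^sup>2 * t ^ k"
    by (simp only: inverse_divide power_one_over divide_divide_eq_right power_add)
      (simp add: mult_ac)
  finally have "exp (- 1 / t) \<le> fact (k + 2) * t\<^sup>2 * t ^ k"
    by (simp only: exp_minus[symmetric]) simp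
  then have "exp (- 1 / t) / t ^ k \<le> fact (k + 2) * t\<^sup>2"
    using True by (simp add: pos_divide_le_eq)
  then show ?thesis using True by (simp add: flat_exp_def)
qed (simp add: flat_exp_def)

lemma flat_exp_deriv:
  "(flat_exp k has_real_derivative flat_exp (k + 2) t - real k * flat_exp (k + 1) t) (at t)"
proof -
  consider "t < 0" | "t > 0" | "t = 0" by linarith
  then show ?thesis
  proof cases
    case 1
    have "((\<lambda>_. 0) has_real_derivative 0) (at t)" by simp
    then have "(flat_exp k has_real_derivative 0) (at t)"
      by (rule has_field_derivative_transform_within_open[where S = "{..<0}"])
        (use 1 in \<open>auto simp: flat_exp_def\<close>)
    then show ?thesis using 1 by (simp add: flat_exp_def)
  next
    case 2
    have "((\<lambda>t. exp (- 1 / t) / t ^ k) has_real_derivative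
        (exp (- 1 / t) * (1 / t\<^sup>2) * t ^ k - exp (- 1 / t) * (real k * t ^ (k - 1))) /
          (t ^ k * t ^ k)) (at t)"
      by (rule derivative_eq_intros refl | use 2 in \<open>simp add: power2_eq_square; fail\<close>)+
    moreover have "(exp (- 1 / t) * (1 / t\<^sup>2) * t ^ k - exp (- 1 / t) * (real k * t ^ (k - 1))) /
        (t ^ k * t ^ k) = exp (- 1 / t) / t ^ (k + 2) - real k * (exp (- 1 / t) / t ^ (k + 1))"
    \<comment> \<open>The power rule produced \<open>t ^ (k - 1)\<close> with truncated subtraction,
      so \<open>k = 0\<close> is split off.\<close>
    proof (cases k)
      case (Suc m)
      define E where "E = exp (- 1 / t)"
      show ?thesis
        unfolding E_def[symmetric] using 2 Suc
        by (simp add: power2_eq_square divide_simps) (simp add: algebra_simps)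
    qed (simp add: power2_eq_square)
    ultimately have "((\<lambda>t. exp (- 1 / t) / t ^ k) has_real_derivative
        flat_exp (k + 2) t - real k * flat_exp (k + 1) t) (at t)"
      using 2 by (simp add: flat_exp_def)
    then show ?thesis
      by (rule has_field_derivative_transform_within_open[where S = "{0<..}"])
        (use 2 in \<open>auto simp: flat_exp_def\<close>)
  next
    case 3
    \<comment> \<open>At 0 the claimed derivative is 0 and \<open>flat_exp k 0 = 0\<close>, so only
      this quotient remains, which \<open>flat_exp_le\<close> bounds by a multiple of |h|.\<close>
    have "((\<lambda>h. flat_exp k h / h) \<longlongrightarrow> 0) (at 0)"
    proof (rule Lim_null_comparison)
      show "\<forall>\<^sub>F h in at 0. norm (flat_exp k h / h) \<le> fact (k + 2) * \<bar>h\<bar>"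
      proof (rule always_eventually, rule allI)
        fix h :: real
        show "norm (flat_exp k h / h) \<le> fact (k + 2) * \<bar>h\<bar>"
        proof (cases "h = 0")
          case False
          have "flat_exp k h \<le> fact (k + 2) * \<bar>h\<bar> * \<bar>h\<bar>"
            using flat_exp_le[of k h] by (simp add: power2_eq_square mult.assoc)
          then show ?thesis
            using False flat_exp_nonneg[of k h] by (simp add: pos_divide_le_eq)
        qed simp
      qed
      show "((\<lambda>h. fact (k + 2) * \<bar>h\<bar>) \<longlongrightarrow> 0) (at (0::real))"
        by (auto intro!: tendsto_eq_intros)
    qed
    then show ?thesis
      using 3 by (simp add: has_field_derivative_iff flat_exp_def)
  qed
qed

text \<open>Stability of \<open>smooth\<close> under products, reciprocals and
  \<open>flat_exp\<close> would call for Leibniz formulas of all orders. The smallest set containing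
  the smooth functions and closed under these operations is stable under one partial derivative by a
  plain induction, so \<open>smooth_coinduct\<close> shows that it contains nothing new.\<close>

inductive_set smooth_closure :: "(real^'n \<Rightarrow> real) set" where
  base: "smooth f \<Longrightarrow> f \<in> smooth_closure"
| const: "(\<lambda>_. c) \<in> smooth_closure"
| coord: "(\<lambda>x. x $ j) \<in> smooth_closure"
| add: "f \<in> smooth_closure \<Longrightarrow> g \<in> smooth_closure \<Longrightarrow> (\<lambda>x. f x + g x) \<in> smooth_closure"
| mult: "f \<in> smooth_closure \<Longrightarrow> g \<in> smooth_closure \<Longrightarrow> (\<lambda>x. f x * g x) \<in> smooth_closure"
| inverse: "f \<in> smooth_closure \<Longrightarrow> \<forall>x. f x \<noteq> 0 \<Longrightarrow> (\<lambda>x. inverse (f x)) \<in> smooth_closure"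
| flat: "f \<in> smooth_closure \<Longrightarrow> (\<lambda>x. flat_exp k (f x)) \<in> smooth_closure"

lemma partial_const: "partial i (\<lambda>_. c) = (\<lambda>_. 0)"
  by (rule ext) (simp add: partial_eq[OF has_derivative_const])

lemma partial_coord: "partial i (\<lambda>x. x $ j) = (\<lambda>_. axis i 1 $ j)"
  by (rule ext, rule partial_eq)
    (auto intro: bounded_linear_imp_has_derivative bounded_linear_vec_nth)

lemma partial_add:
  assumes "\<And>x. f differentiable (at x)" "\<And>x. g differentiable (at x)"
  shows "partial i (\<lambda>x. f x + g x) = (\<lambda>x. partial i f x + partial i g x)"
proof
  fix x
  show "partial i (\<lambda>x. f x + g x) x = partial i f x + partial i g x"
    using partial_eq[OF has_derivative_add[OF assms[unfolded frechet_derivative_works, of x]]]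
    by (simp add: partial_def)
qed

lemma partial_mult:
  assumes "\<And>x. f differentiable (at x)" "\<And>x. g differentiable (at x)"
  shows "partial i (\<lambda>x. f x * g x) = (\<lambda>x. f x * partial i g x + partial i f x * g x)"
proof
  fix x
  show "partial i (\<lambda>x. f x * g x) x = f x * partial i g x + partial i f x * g x"
    using partial_eq[OF has_derivative_mult
        [OF assms[unfolded frechet_derivative_works, of x]]]
    by (simp add: partial_def)
qed

lemma partial_compose_real:
  assumes "\<And>x. f differentiable (at x)" "\<And>x. (h has_real_derivative h' (f x)) (at (f x))"
  shows "partial i (\<lambda>x. h (f x)) = (\<lambda>x. h' (f x) * partial i f x)"
proof
  fix x
  have "((\<lambda>x. h (f x)) has_derivative (\<lambda>y. h' (f x) * frechet_derivative f (at x) y)) (at x)"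
    using has_derivative_compose[OF assms(1)[unfolded frechet_derivative_works]
        assms(2)[unfolded has_field_derivative_def]] by simp
  then show "partial i (\<lambda>x. h (f x)) x = h' (f x) * partial i f x"
    by (simp add: partial_eq) (simp add: partial_def)
qed

lemma differentiable_compose_real:
  assumes "f differentiable (at x)" "(h has_real_derivative h') (at (f x))"
  shows "(\<lambda>x. h (f x)) differentiable (at x)"
  using has_derivative_compose[OF assms(1)[unfolded frechet_derivative_works]
        assms(2)[unfolded has_field_derivative_def]]
  by (auto simp: differentiable_def)

lemma smooth_closure_differentiable:
  "f \<in> smooth_closure \<Longrightarrow> f differentiable (at x)"
proof (induction rule: smooth_closure.induct)
  case (coord j)
  then show ?case
    by (auto simp: differentiable_def
        intro: bounded_linear_imp_has_derivative bounded_linear_vec_nth)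
next
  case (inverse f)
  then show ?case by (intro differentiable_inverse) auto
next
  case (flat f k)
  show ?case by (rule differentiable_compose_real[OF flat.IH flat_exp_deriv])
qed (auto intro: smooth_differentiable)

lemma partial_smooth_closure:
  "f \<in> smooth_closure \<Longrightarrow> partial i f \<in> smooth_closure"
proof (induction rule: smooth_closure.induct)
  case (base f)
  then show ?case by (auto intro: smooth_closure.base smooth_partial)
next
  case (add f g)
  then show ?case
    by (subst partial_add) (auto intro: smooth_closure_differentiable smooth_closure.add)
next
  case (mult f g)
  then show ?case
    by (subst partial_mult)
      (auto intro: smooth_closure_differentiable smooth_closure.add smooth_closure.mult)
next
  case (inverse f)
  \<comment> \<open>Derivatives are spelled with sums, products and constant factors, the shapes for
    which \<open>smooth_closure\<close> has rules.\<close>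
  have "partial i (\<lambda>x. inverse (f x)) =
      (\<lambda>x. ((- 1) * (inverse (f x) * inverse (f x))) * partial i f x)"
    using inverse
    by (subst partial_compose_real[where h' = "\<lambda>t. (- 1) * (inverse t * inverse t)"])
      (auto intro!: derivative_eq_intros smooth_closure_differentiable)
  also have "\<dots> \<in> smooth_closure"
    using inverse by (intro smooth_closure.mult smooth_closure.const smooth_closure.inverse)
  finally show ?case .
next
  case (flat f k)
  have "partial i (\<lambda>x. flat_exp k (f x)) =
      (\<lambda>x. (flat_exp (k + 2) (f x) + (- real k) * flat_exp (k + 1) (f x)) * partial i f x)"
    using flat flat_exp_deriv[of k]
    by (subst partial_compose_real
        [where h' = "\<lambda>t. flat_exp (k + 2) t + (- real k) * flat_exp (k + 1) t"])
      (auto intro!: smooth_closure_differentiable)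
  also have "\<dots> \<in> smooth_closure"
    using flat by (intro smooth_closure.intros(2-7))
  finally show ?case .
qed (auto simp: partial_const partial_coord intro: smooth_closure.const)

lemma smooth_closure_eq: "smooth_closure = Collect smooth"
proof -
  have "smooth f" if "f \<in> smooth_closure" for f :: "real^'n \<Rightarrow> real"
    using that smooth_closure_differentiable partial_smooth_closure by (rule smooth_coinduct)
  then show ?thesis
    by (auto intro: smooth_closure.base)
qed

lemmas smooth_intros = smooth_closure.intros(2-7)[unfolded smooth_closure_eq mem_Collect_eq]

lemma smooth_diff:
  assumes "smooth f" "smooth g"
  shows "smooth (\<lambda>x. f x - g x)"
proof -
  have "smooth (\<lambda>x. f x + (- 1) * g x)"
    using assms by (intro smooth_intros)
  then show ?thesis by simp
qed

lemma smooth_sum: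
  assumes "\<And>i. i \<in> I \<Longrightarrow> smooth (f i)"
  shows "smooth (\<lambda>x. \<Sum>i\<in>I. f i x)"
  using assms
proof (induction I rule: infinite_finite_induct)
  case (insert i I)
  then have "smooth (\<lambda>x. f i x + (\<Sum>i\<in>I. f i x))"
    by (intro smooth_intros(3)) auto
  then show ?case using insert by simp
qed (simp_all add: smooth_intros(1))

lemma smooth_norm_square: "smooth (\<lambda>x::real^'n. (norm x)\<^sup>2)"
proof -
  have "(\<lambda>x::real^'n. (norm x)\<^sup>2) = (\<lambda>x. \<Sum>i\<in>UNIV. x $ i * x $ i)"
    by (simp add: fun_eq_iff power2_norm_eq_inner inner_vec_def)
  moreover have "smooth (\<lambda>x::real^'n. \<Sum>i\<in>UNIV. x $ i * x $ i)"
    by (intro smooth_sum smooth_intros)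
  ultimately show ?thesis by simp
qed

section \<open>Affine changes of variables\<close>

lemma partial_affine:
  assumes "smooth f"
  shows "partial i (\<lambda>x. f (a + c *\<^sub>R x)) = (\<lambda>x. c * partial i f (a + c *\<^sub>R x))"
proof
  fix x
  have "((\<lambda>x. f (a + c *\<^sub>R x)) has_derivative
      (\<lambda>y. frechet_derivative f (at (a + c *\<^sub>R x)) (c *\<^sub>R y))) (at x)"
    by (rule has_derivative_compose[OF _ smooth_has_derivative[OF assms]])
      (auto intro!: derivative_eq_intros)
  from partial_eq[OF this] show "partial i (\<lambda>x. f (a + c *\<^sub>R x)) x = c * partial i f (a + c *\<^sub>R x)"
    using linear_cmul[OF linear_frechet_derivative[OF smooth_differentiable[OF assms]]]
    by (simp add: partial_def)
qed

text \<open>Each differentiation pulls out a factor \<open>c\<close>, hence the invariant set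
  carries a free scalar \<open>d\<close>.\<close>

lemma smooth_affine:
  assumes "smooth f"
  shows "smooth (\<lambda>x. f (a + c *\<^sub>R x))"
proof (rule smooth_coinduct[where S = "{\<lambda>x. d * g (a + c *\<^sub>R x) | d g. smooth g}"])
  show "(\<lambda>x. f (a + c *\<^sub>R x)) \<in> {\<lambda>x. d * g (a + c *\<^sub>R x) | d g. smooth g}"
    using assms by (intro CollectI exI[of _ 1] exI[of _ f]) simp
next
  have D: "(\<lambda>x. g (a + c *\<^sub>R x)) differentiable (at x)" if "smooth g" for g x
  proof -
    have "((\<lambda>x. a + c *\<^sub>R x) has_derivative (\<lambda>y. c *\<^sub>R y)) (at x)"
      by (auto intro!: derivative_eq_intros)
    from has_derivative_compose[OF this smooth_has_derivative[OF that]] show ?thesis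
      by (auto simp: differentiable_def)
  qed
  show "h differentiable (at x)" if h: "h \<in> {\<lambda>x. d * g (a + c *\<^sub>R x) | d g. smooth g}" for h x
  proof -
    obtain d g where "smooth g" "h = (\<lambda>x. d * g (a + c *\<^sub>R x))" using h by blast
    then show ?thesis
      using differentiable_mult[OF differentiable_const D[of g]] by simp
  qed
  show "partial i h \<in> {\<lambda>x. d * g (a + c *\<^sub>R x) | d g. smooth g}"
    if h: "h \<in> {\<lambda>x. d * g (a + c *\<^sub>R x) | d g. smooth g}" for h i
  proof -
    obtain d g where g: "smooth g" "h = (\<lambda>x. d * g (a + c *\<^sub>R x))" using h by auto
    have "partial i h = (\<lambda>x. (d * c) * partial i g (a + c *\<^sub>R x))"
      using g D[of g] by (simp add: partial_mult partial_const partial_affine mult.assoc)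
    then show ?thesis using smooth_partial[of g] g(1) by blast
  qed
qed

subsection \<open>Test functions\<close>

lemma C0_inftyI:
  assumes "smooth f" "compact K" "K \<subseteq> U" "\<And>x. x \<notin> K \<Longrightarrow> f x = 0"
  shows "f \<in> C0_infty U"
proof -
  have "closure {x. f x \<noteq> 0} \<subseteq> K"
    using assms by (intro closure_minimal) (auto simp: compact_imp_closed)
  then show ?thesis
    using assms compact_Int_closed[of K "closure {x. f x \<noteq> 0}"]
    by (auto simp: C0_infty_def Int_absorb1)
qed

lemma C0_inftyE:
  assumes "f \<in> C0_infty U"
  obtains K where "compact K" "K \<subseteq> U" "\<And>x. x \<notin> K \<Longrightarrow> f x = 0"
  using assms closure_subset[of "{x. f x \<noteq> 0}"]
  by (intro that[of "closure {x. f x \<noteq> 0}"]) (auto simp: C0_infty_def)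

lemma C0_infty_smooth: "f \<in> C0_infty U \<Longrightarrow> smooth f"
  by (simp add: C0_infty_def)

lemma C0_infty_mono: "U \<subseteq> V \<Longrightarrow> f \<in> C0_infty U \<Longrightarrow> f \<in> C0_infty V"
  by (auto simp: C0_infty_def)

lemma C0_infty_mult_smooth:
  assumes "f \<in> C0_infty U" "smooth g"
  shows "(\<lambda>x. f x * g x) \<in> C0_infty U"
proof -
  obtain K where "compact K" "K \<subseteq> U" "\<And>x. x \<notin> K \<Longrightarrow> f x = 0"
    using assms(1) by (rule C0_inftyE) blast
  then show ?thesis
    using assms by (intro C0_inftyI[of _ K] smooth_intros) (auto simp: C0_infty_smooth)
qed

lemma partial_locally_zero:
  assumes "open S" "x \<in> S" "\<And>y. y \<in> S \<Longrightarrow> f y = c"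
  shows "partial i f x = 0"
proof -
  have "(f has_derivative (\<lambda>_. 0)) (at x)"
    by (rule has_derivative_transform_within_open[OF has_derivative_const assms(1,2)])
      (simp add: assms(3))
  then show ?thesis by (rule partial_eq)
qed

lemma C0_infty_partial:
  assumes "f \<in> C0_infty U"
  shows "partial i f \<in> C0_infty U"
proof -
  obtain K where K: "compact K" "K \<subseteq> U" "\<And>x. x \<notin> K \<Longrightarrow> f x = 0"
    using assms by (rule C0_inftyE) blast
  have "partial i f x = 0" if "x \<notin> K" for x
    using K that by (intro partial_locally_zero[of "- K" x f 0]) (auto simp: compact_imp_closed)
  then show ?thesis
    using assms K by (intro C0_inftyI[of _ K] smooth_partial) (auto simp: C0_infty_smooth)
qed

lemma C0_infty_partials: "f \<in> C0_infty U \<Longrightarrow> partials is f \<in> C0_infty U"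
  by (induction "is") (auto intro: C0_infty_partial)

lemma C0_infty_bounded:
  assumes "f \<in> C0_infty U"
  obtains C where "C > 0" "\<And>x. \<bar>f x\<bar> \<le> C"
proof -
  obtain K where K: "compact K" "\<And>x. x \<notin> K \<Longrightarrow> f x = 0"
    using assms by (rule C0_inftyE) blast
  have "bounded (f ` K)"
    using assms K by (intro compact_imp_bounded compact_continuous_image smooth_continuous_on)
      (auto simp: C0_infty_smooth)
  then obtain B where B: "B > 0" "\<And>x. x \<in> K \<Longrightarrow> \<bar>f x\<bar> \<le> B"
    by (auto simp: bounded_pos)
  show thesis
    using B K by (intro that[of B]) (metis abs_zero less_imp_le)+
qed

text \<open>The quotient A / (A + B) of two flat exponentials in |x|^2; the square is smooth at the
  origin, unlike the norm itself. Since a < b, A and B never vanish together.\<close>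

lemma smooth_cutoff:
  assumes "0 < a" "a < b"
  obtains \<eta> :: "real^'n \<Rightarrow> real"
  where "smooth \<eta>" "\<And>x. 0 \<le> \<eta> x" "\<And>x. \<eta> x \<le> 1"
    "\<And>x. norm x \<le> a \<Longrightarrow> \<eta> x = 1" "\<And>x. norm x \<ge> b \<Longrightarrow> \<eta> x = 0"
proof -
  define A B where "A = (\<lambda>x::real^'n. flat_exp 0 (b\<^sup>2 + (- 1) * (norm x)\<^sup>2))"
    and "B = (\<lambda>x::real^'n. flat_exp 0 ((norm x)\<^sup>2 + (- a\<^sup>2)))"
  have ab: "a\<^sup>2 < b\<^sup>2"
    using assms by (intro power_strict_mono) auto
  have nn: "0 \<le> A x" "0 \<le> B x" for x
    by (auto simp: A_def B_def flat_exp_nonneg)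
  have pos: "0 < A x + B x" for x
  proof (cases "(norm x)\<^sup>2 < b\<^sup>2")
    case True
    then have "0 < A x" by (simp add: A_def flat_exp_0_pos)
    then show ?thesis using nn(2)[of x] by linarith
  next
    case False
    then have "0 < B x" using ab by (simp add: B_def flat_exp_0_pos)
    then show ?thesis using nn(1)[of x] by linarith
  qed
  have AB: "smooth A" "smooth B"
    unfolding A_def B_def by (intro smooth_intros smooth_norm_square)+
  show thesis
  proof (rule that[of "\<lambda>x. A x * inverse (A x + B x)"])
    show "smooth (\<lambda>x. A x * inverse (A x + B x))"
      using AB pos by (intro smooth_intros) (auto simp: less_imp_neq[symmetric])
    fix x :: "real^'n"
    show "0 \<le> A x * inverse (A x + B x)" "A x * inverse (A x + B x) \<le> 1"
      using nn[of x] pos[of x] by (auto simp: field_simps)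
    show "A x * inverse (A x + B x) = 1" if "norm x \<le> a"
    proof -
      have "B x = 0" using that by (simp add: B_def flat_exp_nonpos power_mono)
      then show ?thesis using pos[of x] by simp
    qed
    show "A x * inverse (A x + B x) = 0" if "norm x \<ge> b"
      using that assms by (simp add: A_def flat_exp_nonpos power_mono)
  qed
qed

lemma laplacian_eq: "laplacian f x = (\<Sum>i\<in>UNIV. partial i (partial i f) x)"
  by (simp add: laplacian_def)

section \<open>Mollification\<close>

lemma lborel_eq_distr_reflect:
  "(lborel :: 'a::euclidean_space measure) = distr lborel borel (\<lambda>y. x - y)"
  using lborel_affine[of "-1" x] by (simp add: density_1)

lemma nn_integral_lborel_reflect:
  fixes f :: "'a::euclidean_space \<Rightarrow> ennreal"
  assumes [measurable]: "f \<in> borel_measurable borel"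
  shows "(\<integral>\<^sup>+y. f (x - y) \<partial>lborel) = (\<integral>\<^sup>+y. f y \<partial>lborel)"
  by (subst (2) lborel_eq_distr_reflect[of x]) (simp add: nn_integral_distr)

lemma nn_integral_lborel_translate:
  fixes f :: "'a::euclidean_space \<Rightarrow> ennreal"
  assumes [measurable]: "f \<in> borel_measurable borel"
  shows "(\<integral>\<^sup>+y. f (y - x) \<partial>lborel) = (\<integral>\<^sup>+y. f y \<partial>lborel)"
  by (subst (2) lborel_distr_plus[of "- x", symmetric]) (simp add: nn_integral_distr)

lemma integral_lborel_reflect:
  fixes f :: "'a::euclidean_space \<Rightarrow> real"
  assumes [measurable]: "f \<in> borel_measurable borel"
  shows "(LINT y|lborel. f (x - y)) = (LINT y|lborel. f y)"
  by (subst (2) lborel_eq_distr_reflect[of x]) (simp add: integral_distr)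

lemma C0_infty_integrable:
  assumes "f \<in> C0_infty U"
  shows "integrable lborel f"
proof -
  have [measurable]: "f \<in> borel_measurable borel"
    using assms by (auto dest: C0_infty_smooth smooth_borel)
  obtain K where K: "compact K" "\<And>x. x \<notin> K \<Longrightarrow> f x = 0"
    using assms by (rule C0_inftyE) blast
  obtain C where C: "\<And>x. \<bar>f x\<bar> \<le> C"
    using assms by (rule C0_infty_bounded) blast
  show ?thesis
  proof (rule Bochner_Integration.integrable_bound)
    show "integrable lborel (\<lambda>x. C * indicator K x)"
      using K(1) emeasure_bounded_finite[of K]
      by (intro integrable_mult_right integrable_real_indicator)
        (auto simp: compact_imp_closed compact_imp_bounded)
    show "AE x in lborel. norm (f x) \<le> norm (C * indicator K x)"
      using K(2) order_trans[OF C abs_ge_self] by (intro AE_I2) (auto simp: indicator_def)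
  qed simp
qed

section \<open>Convolution with a test function\<close>

definition conv :: "(real^'n \<Rightarrow> real) \<Rightarrow> (real^'n \<Rightarrow> real) \<Rightarrow> real^'n \<Rightarrow> real" where
  "conv f \<psi> x = (LINT y|lborel. f y * \<psi> (x - y))"

lemma conv_integrable:
  assumes "integrable lborel f" "\<psi> \<in> C0_infty U"
  shows "integrable lborel (\<lambda>y. f y * \<psi> (x - y))"
proof -
  have [measurable]: "\<psi> \<in> borel_measurable borel"
    using assms by (auto dest: C0_infty_smooth smooth_borel)
  have [measurable]: "f \<in> borel_measurable borel"
    using assms(1) by auto
  obtain C where C: "\<And>x. \<bar>\<psi> x\<bar> \<le> C"
    using assms(2) by (rule C0_infty_bounded) blast
  show ?thesis
  proof (rule Bochner_Integration.integrable_bound)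
    show "integrable lborel (\<lambda>x. C * f x)"
      using assms by simp
    have "\<bar>f y\<bar> * \<bar>\<psi> (x - y)\<bar> \<le> \<bar>C\<bar> * \<bar>f y\<bar>" for y
      using mult_left_mono[OF order_trans[OF C abs_ge_self], of "\<bar>f y\<bar>" "x - y"]
      by (simp add: mult.commute)
    then show "AE y in lborel. norm (f y * \<psi> (x - y)) \<le> norm (C * f y)"
      by (intro AE_I2) (simp add: abs_mult)
  qed simp
qed

lemma conv_add:
  assumes "integrable lborel f" "integrable lborel g" "\<psi> \<in> C0_infty U"
  shows "conv (\<lambda>x. f x + g x) \<psi> x = conv f \<psi> x + conv g \<psi> x"
  using assms by (simp add: conv_def distrib_right conv_integrable)

lemma conv_diff:
  assumes "integrable lborel f" "integrable lborel g" "\<psi> \<in> C0_infty U"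
  shows "conv (\<lambda>x. f x - g x) \<psi> x = conv f \<psi> x - conv g \<psi> x"
  using assms by (simp add: conv_def left_diff_distrib conv_integrable)

lemma conv_cmult: "conv (\<lambda>x. c * f x) \<psi> x = c * conv f \<psi> x"
  by (simp add: conv_def mult.assoc)

lemma conv_sum:
  assumes "\<And>i. i \<in> I \<Longrightarrow> integrable lborel (f i)" "\<psi> \<in> C0_infty U"
  shows "conv (\<lambda>x. \<Sum>i\<in>I. f i x) \<psi> x = (\<Sum>i\<in>I. conv (f i) \<psi> x)"
  using assms by (simp add: conv_def sum_distrib_right conv_integrable)

lemma abs_frechet_derivative_le:
  fixes f :: "real^'n \<Rightarrow> real"
  assumes "f differentiable (at x)" "\<And>i. \<bar>partial i f x\<bar> \<le> C"
  shows "\<bar>frechet_derivative f (at x) h\<bar> \<le> real CARD('n) * C * norm h"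
proof -
  have "\<bar>frechet_derivative f (at x) h\<bar> \<le> (\<Sum>i\<in>UNIV. \<bar>h $ i * partial i f x\<bar>)"
    unfolding frechet_derivative_partial[OF assms(1)] by (rule sum_abs)
  also have "\<dots> \<le> (\<Sum>i\<in>(UNIV::'n set). norm h * C)"
    unfolding abs_mult using component_le_norm_cart assms(2)
    by (intro sum_mono mult_mono) auto
  finally show ?thesis by (simp add: mult_ac)
qed

text \<open>Gives the domination in \<open>conv_has_derivative\<close>: one constant bounds both the
  increments of f and its differential, hence the quotient of the Taylor remainder.\<close>

lemma C0_infty_lipschitz:
  fixes f :: "real^'n \<Rightarrow> real"
  assumes "f \<in> C0_infty U"
  obtains L where "L \<ge> 0" "\<And>x y. \<bar>f x - f y\<bar> \<le> L * norm (x - y)"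
    "\<And>x h. \<bar>frechet_derivative f (at x) h\<bar> \<le> L * norm h"
proof -
  have "\<exists>C. \<forall>x. \<bar>partial i f x\<bar> \<le> C" for i
    using C0_infty_bounded[OF C0_infty_partial[OF assms]] by metis
  then obtain C where C: "\<And>i x. \<bar>partial i f x\<bar> \<le> C i" by metis
  have C': "\<bar>partial i f x\<bar> \<le> (\<Sum>j\<in>UNIV. C j)" for i x
  proof -
    have "C i \<le> (\<Sum>j\<in>UNIV. C j)"
      using C[of _ x] by (intro member_le_sum) (auto intro: order_trans[OF abs_ge_zero])
    then show ?thesis using C[of i x] by linarith
  qed
  define L where "L = real CARD('n) * (\<Sum>j\<in>UNIV. C j)"
  have D: "\<bar>frechet_derivative f (at x) h\<bar> \<le> L * norm h" for x h
    unfolding L_def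
    using assms C' by (intro abs_frechet_derivative_le smooth_differentiable C0_infty_smooth) auto
  have "L \<ge> 0"
  proof -
    have "0 \<le> (\<Sum>j\<in>UNIV. C j)" using C'[of undefined undefined] by linarith
    then show ?thesis by (simp add: L_def)
  qed
  moreover have "\<bar>f x - f y\<bar> \<le> L * norm (x - y)" for x y
  proof -
    have "norm (f x - f y) \<le> L * norm (x - y)"
    proof (rule differentiable_bound[of UNIV])
      show "(f has_derivative frechet_derivative f (at z)) (at z within UNIV)" for z
        using assms by (simp add: smooth_has_derivative C0_infty_smooth)
      show "onorm (frechet_derivative f (at z)) \<le> L" for z
        using D by (intro onorm_le) (simp add: mult.commute)
    qed auto
    then show ?thesis by simp
  qed
  ultimately show thesis using D by (rule that)
qed

text \<open>Differentiation under the integral sign, with the derivative falling on \<psi>, so that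
  f may be merely integrable. The full Frechet derivative is treated at once because
  \<open>smooth\<close> asks for it.\<close>

lemma conv_has_derivative:
  fixes f \<psi> :: "real^'n \<Rightarrow> real"
  assumes f: "integrable lborel f" and \<psi>: "\<psi> \<in> C0_infty U"
  shows "(conv f \<psi> has_derivative (\<lambda>h. \<Sum>i\<in>UNIV. h $ i * conv f (partial i \<psi>) x)) (at x)"
    (is "(_ has_derivative ?D) _")
  unfolding has_derivative_at
proof (intro conjI)
  show "bounded_linear ?D"
    by (intro bounded_linear_sum bounded_linear_mult_left bounded_linear_compose
        [OF bounded_linear_mult_left bounded_linear_vec_nth])
  obtain L where L: "L \<ge> 0" "\<And>x y. \<bar>\<psi> x - \<psi> y\<bar> \<le> L * norm (x - y)"
    "\<And>x h. \<bar>frechet_derivative \<psi> (at x) h\<bar> \<le> L * norm h"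
    using C0_infty_lipschitz[OF \<psi>] by metis
  have sm: "smooth \<psi>" "\<And>z. \<psi> differentiable (at z)"
    using \<psi> by (auto intro: C0_infty_smooth smooth_differentiable)
  have [measurable]: "f \<in> borel_measurable borel" "\<psi> \<in> borel_measurable borel"
    "\<And>i. partial i \<psi> \<in> borel_measurable borel"
    using f sm by (auto intro: smooth_borel smooth_partial)
  \<comment> \<open>First-order Taylor remainder of \<psi> at x - y. Writing the differential
    through the partials is what gives measurability in y.\<close>
  define r where "r = (\<lambda>h y. \<psi> (x + h - y) - \<psi> (x - y) - frechet_derivative \<psi> (at (x - y)) h)"
  have [measurable]: "r h \<in> borel_measurable borel" for h
    unfolding r_def frechet_derivative_partial[OF sm(2)] by measurable
  have r_le: "\<bar>r h y\<bar> \<le> 2 * L * norm h" for h y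
    using L(2)[of "x + h - y" "x - y"] L(3)[of "x - y" h] by (simp add: r_def)
  have eq: "conv f \<psi> (x + h) - conv f \<psi> x - ?D h = (LINT y|lborel. f y * r h y)" for h
  proof -
    note [simp] = conv_integrable[OF f \<psi>] conv_integrable[OF f C0_infty_partial[OF \<psi>]]
    have "?D h = (\<Sum>i\<in>UNIV. (LINT y|lborel. h $ i * (f y * partial i \<psi> (x - y))))"
      by (simp add: conv_def)
    also have "\<dots> = (LINT y|lborel. (\<Sum>i\<in>UNIV. h $ i * (f y * partial i \<psi> (x - y))))"
      by (rule Bochner_Integration.integral_sum[symmetric]) simp
    finally have "conv f \<psi> (x + h) - conv f \<psi> x - ?D h = (LINT y|lborel. f y * \<psi> (x + h - y) -
        f y * \<psi> (x - y) - (\<Sum>i\<in>UNIV. h $ i * (f y * partial i \<psi> (x - y))))"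
      by (simp add: conv_def)
    also have "\<dots> = (LINT y|lborel. f y * r h y)"
      by (simp add: r_def frechet_derivative_partial[OF sm(2)] right_diff_distrib
        sum_distrib_left mult.left_commute)
    finally show ?thesis .
  qed
  \<comment> \<open>Dominated convergence works along sequences, so the limit h \<rightarrow> 0 is
    tested on sequences of nonzero increments.\<close>
  show "(\<lambda>h. norm (conv f \<psi> (x + h) - conv f \<psi> x - ?D h) / norm h) \<midarrow>0\<rightarrow> 0"
    unfolding tendsto_at_iff_sequentially comp_def
  proof (intro allI impI)
    fix X :: "nat \<Rightarrow> real^'n"
    assume X: "\<forall>i. X i \<in> UNIV - {0}" "X \<longlonglongrightarrow> 0"
    have "(\<lambda>k. LINT y|lborel. f y * (r (X k) y / norm (X k))) \<longlonglongrightarrow> (\<integral>y. 0 \<partial>(lborel :: (real^'n) measure))"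
    proof (rule integral_dominated_convergence[where w = "\<lambda>y. 2 * L * \<bar>f y\<bar>"])
      show "integrable lborel (\<lambda>y. 2 * L * \<bar>f y\<bar>)"
        using f by (intro integrable_mult_right integrable_abs)
      show "AE y in lborel. (\<lambda>k. f y * (r (X k) y / norm (X k))) \<longlonglongrightarrow> 0"
      proof (rule AE_I2)
        fix y
        have "(\<lambda>h. norm (r h y) / norm h) \<midarrow>0\<rightarrow> 0"
          using smooth_has_derivative[OF sm(1), of "x - y", unfolded has_derivative_at]
          by (simp add: r_def algebra_simps)
        then have "(\<lambda>k. norm (r (X k) y) / norm (X k)) \<longlonglongrightarrow> 0"
          using X unfolding tendsto_at_iff_sequentially comp_def by blast
        then have "(\<lambda>k. norm (r (X k) y / norm (X k))) \<longlonglongrightarrow> 0"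
          by simp
        then have "(\<lambda>k. r (X k) y / norm (X k)) \<longlonglongrightarrow> 0"
          using tendsto_norm_zero_iff by blast
        then show "(\<lambda>k. f y * (r (X k) y / norm (X k))) \<longlonglongrightarrow> 0"
          by (rule tendsto_mult_right_zero)
      qed
      show "AE y in lborel. norm (f y * (r (X k) y / norm (X k))) \<le> 2 * L * \<bar>f y\<bar>" for k
      proof (rule AE_I2)
        fix y
        have "\<bar>r (X k) y\<bar> / norm (X k) \<le> 2 * L"
          using r_le[of "X k" y] X(1) by (auto simp: divide_le_eq)
        then have "\<bar>f y\<bar> * (\<bar>r (X k) y\<bar> / norm (X k)) \<le> \<bar>f y\<bar> * (2 * L)"
          by (intro mult_left_mono) auto
        then show "norm (f y * (r (X k) y / norm (X k))) \<le> 2 * L * \<bar>f y\<bar>"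
          by (simp add: abs_mult mult_ac)
      qed
    qed simp_all
    then have "(\<lambda>k. (LINT y|lborel. f y * r (X k) y) / norm (X k)) \<longlonglongrightarrow> 0"
      by simp
    then show "(\<lambda>k. norm (conv f \<psi> (x + X k) - conv f \<psi> x - ?D (X k)) / norm (X k)) \<longlonglongrightarrow> 0"
      unfolding eq using tendsto_norm_zero by fastforce
  qed
qed

lemma partial_conv:
  assumes "integrable lborel f" "\<psi> \<in> C0_infty U"
  shows "partial i (conv f \<psi>) = conv f (partial i \<psi>)"
proof
  fix x
  have "partial i (conv f \<psi>) x = (\<Sum>j\<in>UNIV. axis i 1 $ j * conv f (partial j \<psi>) x)"
    by (rule partial_eq[OF conv_has_derivative[OF assms]])
  also have "\<dots> = (\<Sum>j\<in>UNIV. if j = i then conv f (partial j \<psi>) x else 0)"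
    by (intro sum.cong) (auto simp: axis_def)
  finally show "partial i (conv f \<psi>) x = conv f (partial i \<psi>) x" by simp
qed

lemma smooth_conv:
  assumes "integrable lborel f" "\<psi> \<in> C0_infty U"
  shows "smooth (conv f \<psi>)"
proof (rule smooth_coinduct[where S = "conv f ` C0_infty U"])
  show "g differentiable (at x)" if "g \<in> conv f ` C0_infty U" for g x
    using that conv_has_derivative[OF assms(1)] by (auto simp: differentiable_def)
  show "partial i g \<in> conv f ` C0_infty U" if "g \<in> conv f ` C0_infty U" for g i
    using that assms(1) by (auto simp: partial_conv intro: C0_infty_partial)
qed (use assms in auto)

lemma conv_eq_zero:
  assumes "\<And>y. y \<notin> K \<Longrightarrow> f y = 0" "\<And>x. norm x > d \<Longrightarrow> \<psi> x = 0" "\<And>y. y \<in> K \<Longrightarrow> dist y x > d"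
  shows "conv f \<psi> x = 0"
proof -
  have "f y * \<psi> (x - y) = 0" for y
    using assms(1)[of y] assms(2)[of "x - y"] assms(3)[of y]
    by (cases "y \<in> K") (auto simp: dist_norm norm_minus_commute)
  then show ?thesis unfolding conv_def by (simp only: Bochner_Integration.integral_zero)
qed

text \<open>The closed e-balls around K form a compact Minkowski sum. With it, mollification by
  kernels of radius at most e keeps supports inside U.\<close>

lemma compact_neighbourhood:
  fixes K :: "'a::euclidean_space set"
  assumes K: "compact K" and U: "open U" "K \<subseteq> U"
  shows "\<exists>e K'. e > 0 \<and> compact K' \<and> K' \<subseteq> U \<and> (\<forall>y\<in>K. \<forall>x. dist y x \<le> e \<longrightarrow> x \<in> K')"
proof -
  obtain e where e: "e > 0" "(\<Union>x\<in>K. cball x e) \<subseteq> U"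
    using compact_subset_open_imp_cball_epsilon_subset[OF K U] by metis
  have "(\<Union>y\<in>cball 0 e. {x + y}) = cball x e" for x :: 'a
  proof (intro set_eqI iffI)
    fix z assume "z \<in> cball x e"
    then show "z \<in> (\<Union>y\<in>cball 0 e. {x + y})"
      by (intro UN_I[of "z - x"]) (auto simp: dist_norm norm_minus_commute)
  qed (auto simp: dist_norm)
  then have eq: "(\<Union>x\<in>K. \<Union>y\<in>cball 0 e. {x + y}) = (\<Union>x\<in>K. cball x e)"
    by simp
  have "compact (\<Union>x\<in>K. cball x e)"
    unfolding eq[symmetric] using K by (intro compact_sums') auto
  then show ?thesis
    using e by (intro exI[of _ e] exI[of _ "\<Union>x\<in>K. cball x e"]) auto
qed

section \<open>Nonnegative kernels of mass one\<close>

definition kernel :: "(real^'n \<Rightarrow> real) \<Rightarrow> bool" where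
  "kernel \<phi> \<longleftrightarrow> \<phi> \<in> C0_infty UNIV \<and> (\<forall>x. 0 \<le> \<phi> x) \<and> (LINT x|lborel. \<phi> x) = 1"

lemma kernel_nn_integral:
  assumes "kernel \<phi>"
  shows "(\<integral>\<^sup>+x. ennreal (\<phi> x) \<partial>lborel) = 1"
  using assms nn_integral_eq_integral[of lborel \<phi>] C0_infty_integrable[of \<phi> UNIV]
  by (auto simp: kernel_def)

lemma kernel_borel: "kernel \<phi> \<Longrightarrow> \<phi> \<in> borel_measurable borel"
  by (auto simp: kernel_def intro: smooth_borel C0_infty_smooth)

lemma smooth_conv_kernel: "integrable lborel f \<Longrightarrow> kernel \<phi> \<Longrightarrow> smooth (conv f \<phi>)"
  by (auto simp: kernel_def intro: smooth_conv)

text \<open>Tonelli together with the unit mass of the kernel. Both contraction estimates, in L1 and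
  in L2, are a pointwise bound integrated by this identity.\<close>

lemma nn_integral_conv_kernel:
  fixes F :: "real^'n \<Rightarrow> ennreal"
  assumes \<phi>: "kernel \<phi>" and [measurable]: "F \<in> borel_measurable borel"
  shows "(\<integral>\<^sup>+x. (\<integral>\<^sup>+y. F y * ennreal (\<phi> (x - y)) \<partial>lborel) \<partial>lborel) = (\<integral>\<^sup>+y. F y \<partial>lborel)"
proof -
  have [measurable]: "\<phi> \<in> borel_measurable borel"
    using \<phi> by (rule kernel_borel)
  have "(\<integral>\<^sup>+x. (\<integral>\<^sup>+y. F y * ennreal (\<phi> (x - y)) \<partial>lborel) \<partial>lborel) =
      (\<integral>\<^sup>+y. (\<integral>\<^sup>+x. F y * ennreal (\<phi> (x - y)) \<partial>lborel) \<partial>lborel)"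
    by (rule lborel_pair.Fubini') simp
  also have "\<dots> = (\<integral>\<^sup>+y. F y * (\<integral>\<^sup>+x. ennreal (\<phi> (x - y)) \<partial>lborel) \<partial>lborel)"
    by (simp add: nn_integral_cmult)
  also have "\<dots> = (\<integral>\<^sup>+y. F y \<partial>lborel)"
    using nn_integral_lborel_translate[of "\<lambda>x. ennreal (\<phi> x)"] kernel_nn_integral[OF \<phi>] by simp
  finally show ?thesis .
qed

lemma abs_conv_le:
  assumes "kernel \<phi>" "integrable lborel f"
  shows "ennreal \<bar>conv f \<phi> x\<bar> \<le> (\<integral>\<^sup>+y. ennreal \<bar>f y\<bar> * ennreal (\<phi> (x - y)) \<partial>lborel)"
proof -
  have i: "integrable lborel (\<lambda>y. f y * \<phi> (x - y))"
    using assms by (auto simp: kernel_def intro: conv_integrable)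
  have "ennreal \<bar>conv f \<phi> x\<bar> \<le> (\<integral>\<^sup>+y. norm (f y * \<phi> (x - y)) \<partial>lborel)"
    using integral_norm_bound_ennreal[OF i] by (simp add: conv_def)
  also have "\<dots> = (\<integral>\<^sup>+y. ennreal \<bar>f y\<bar> * ennreal (\<phi> (x - y)) \<partial>lborel)"
    using assms by (intro nn_integral_cong) (auto simp: kernel_def abs_mult ennreal_mult)
  finally show ?thesis .
qed

lemma conv_L1:
  assumes \<phi>: "kernel \<phi>" and f: "integrable lborel f"
  shows "integrable lborel (conv f \<phi>)"
    and "(LINT x|lborel. \<bar>conv f \<phi> x\<bar>) \<le> (LINT x|lborel. \<bar>f x\<bar>)"
proof -
  have [measurable]: "f \<in> borel_measurable borel" "conv f \<phi> \<in> borel_measurable borel"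
    using f smooth_conv_kernel[OF f \<phi>] by (auto intro: smooth_borel)
  have le: "(\<integral>\<^sup>+x. ennreal \<bar>conv f \<phi> x\<bar> \<partial>lborel) \<le> (\<integral>\<^sup>+x. ennreal \<bar>f x\<bar> \<partial>lborel)"
    by (subst nn_integral_conv_kernel[OF \<phi>, symmetric])
      (auto intro!: nn_integral_mono abs_conv_le[OF \<phi> f])
  also have "\<dots> < \<infinity>"
    using f by (simp add: integrable_iff_bounded)
  finally show i: "integrable lborel (conv f \<phi>)"
    by (simp add: integrable_iff_bounded)
  show "(LINT x|lborel. \<bar>conv f \<phi> x\<bar>) \<le> (LINT x|lborel. \<bar>f x\<bar>)"
    using le f i by (simp add: nn_integral_eq_integral)
qed

text \<open>Jensen's inequality for the probability density \<phi>(x - y), obtained from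
  Cauchy-Schwarz by splitting the density into two square roots: one goes with |f|, the square of
  the other integrates to 1.\<close>

lemma conv_L2:
  assumes \<phi>: "kernel \<phi>" and f: "integrable lborel f" "integrable lborel (\<lambda>x. (f x)\<^sup>2)"
  shows "integrable lborel (\<lambda>x. (conv f \<phi> x)\<^sup>2)"
    and "(LINT x|lborel. (conv f \<phi> x)\<^sup>2) \<le> (LINT x|lborel. (f x)\<^sup>2)"
proof -
  have [measurable]: "f \<in> borel_measurable borel" "conv f \<phi> \<in> borel_measurable borel"
    "\<phi> \<in> borel_measurable borel"
    using f(1) smooth_conv_kernel[OF f(1) \<phi>] \<phi> by (auto intro: smooth_borel kernel_borel)
  have p: "0 \<le> \<phi> z" for z using \<phi> by (simp add: kernel_def)
  have pw: "ennreal ((conv f \<phi> x)\<^sup>2) \<le> (\<integral>\<^sup>+y. ennreal ((f y)\<^sup>2) * ennreal (\<phi> (x - y)) \<partial>lborel)" for x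
  proof -
    define F G where "F = (\<lambda>y. ennreal (\<bar>f y\<bar> * sqrt (\<phi> (x - y))))"
      and "G = (\<lambda>y. ennreal (sqrt (\<phi> (x - y))))"
    have [measurable]: "F \<in> borel_measurable lborel" "G \<in> borel_measurable lborel"
      by (auto simp: F_def G_def)
    have "ennreal ((conv f \<phi> x)\<^sup>2) = (ennreal \<bar>conv f \<phi> x\<bar>)\<^sup>2"
      by (simp add: ennreal_power)
    also have "\<dots> \<le> (\<integral>\<^sup>+y. ennreal \<bar>f y\<bar> * ennreal (\<phi> (x - y)) \<partial>lborel)\<^sup>2"
      by (intro power_mono abs_conv_le[OF \<phi> f(1)]) simp
    also have "(\<integral>\<^sup>+y. ennreal \<bar>f y\<bar> * ennreal (\<phi> (x - y)) \<partial>lborel) = (\<integral>\<^sup>+y. F y * G y \<partial>lborel)"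
      using p by (intro nn_integral_cong) (auto simp: F_def G_def mult.assoc simp flip: ennreal_mult)
    also have "(\<integral>\<^sup>+y. F y * G y \<partial>lborel)\<^sup>2 \<le> (\<integral>\<^sup>+y. (F y)\<^sup>2 \<partial>lborel) * (\<integral>\<^sup>+y. (G y)\<^sup>2 \<partial>lborel)"
      by (rule Cauchy_Schwarz_nn_integral) auto
    also have "(\<integral>\<^sup>+y. (G y)\<^sup>2 \<partial>lborel) = 1"
      using p kernel_nn_integral[OF \<phi>] nn_integral_lborel_reflect[of "\<lambda>x. ennreal (\<phi> x)" x]
      by (simp add: G_def ennreal_power)
    also have "(\<integral>\<^sup>+y. (F y)\<^sup>2 \<partial>lborel) = (\<integral>\<^sup>+y. ennreal ((f y)\<^sup>2) * ennreal (\<phi> (x - y)) \<partial>lborel)"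
      using p by (intro nn_integral_cong)
        (auto simp: F_def ennreal_power power_mult_distrib ennreal_mult)
    finally show ?thesis by simp
  qed
  have le: "(\<integral>\<^sup>+x. ennreal ((conv f \<phi> x)\<^sup>2) \<partial>lborel) \<le> (\<integral>\<^sup>+x. ennreal ((f x)\<^sup>2) \<partial>lborel)"
    by (subst nn_integral_conv_kernel[OF \<phi>, symmetric]) (auto intro!: nn_integral_mono pw)
  also have "\<dots> < \<infinity>"
    using f(2) by (simp add: integrable_iff_bounded)
  finally show i: "integrable lborel (\<lambda>x. (conv f \<phi> x)\<^sup>2)"
    by (simp add: integrable_iff_bounded)
  show "(LINT x|lborel. (conv f \<phi> x)\<^sup>2) \<le> (LINT x|lborel. (f x)\<^sup>2)"
    using le f i by (simp add: nn_integral_eq_integral)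
qed

definition mollifier :: "(nat \<Rightarrow> real^'n \<Rightarrow> real) \<Rightarrow> bool" where
  "mollifier \<phi> \<longleftrightarrow> (\<forall>k. kernel (\<phi> k) \<and> (\<forall>x. norm x > 1 / real (Suc k) \<longrightarrow> \<phi> k x = 0))"

lemma ex_kernel:
  fixes d :: real
  assumes "d > 0"
  shows "\<exists>\<phi> :: real^'n \<Rightarrow> real. kernel \<phi> \<and> (\<forall>x. norm x > d \<longrightarrow> \<phi> x = 0)"
proof -
  obtain \<eta> :: "real^'n \<Rightarrow> real" where \<eta>: "smooth \<eta>" "\<And>x. 0 \<le> \<eta> x"
    "\<And>x. norm x \<le> d / 2 \<Longrightarrow> \<eta> x = 1" "\<And>x. norm x \<ge> d \<Longrightarrow> \<eta> x = 0"
    using smooth_cutoff[of "d / 2" d] assms by (metis field_sum_of_halves half_gt_zero less_add_same_cancel1)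
  have C0: "\<eta> \<in> C0_infty UNIV"
    using \<eta> by (intro C0_inftyI[of _ "cball 0 d"]) auto
  have int: "integrable lborel \<eta>" using C0 by (rule C0_infty_integrable)
  define c where "c = (LINT x|lborel. \<eta> x)"
  \<comment> \<open>With zero mass \<eta> would vanish almost everywhere, yet it equals 1 on a
    ball.\<close>
  have "c \<noteq> 0"
  proof
    assume "c = 0"
    then have "AE x in lborel. \<eta> x = 0"
      using int \<eta>(2) integral_nonneg_eq_0_iff_AE[of lborel \<eta>] by (simp add: c_def)
    then have "AE x in lborel. x \<notin> ball (0::real^'n) (d / 2)"
      by (rule eventually_mono) (use \<eta>(3) in force)
    then have "ball (0::real^'n) (d / 2) \<in> null_sets lborel"
      by (subst AE_iff_null_sets) auto
    then have "negligible (ball (0::real^'n) (d / 2))"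
      by (simp add: negligible_iff_null_sets null_sets_completionI)
    then show False
      using assms open_not_negligible[of "ball (0::real^'n) (d / 2)"] by auto
  qed
  moreover have "c \<ge> 0" using \<eta>(2) by (simp add: c_def)
  ultimately have c: "c > 0" by simp
  define \<phi> where "\<phi> = (\<lambda>x. \<eta> x * inverse c)"
  have "\<phi> \<in> C0_infty UNIV"
    unfolding \<phi>_def using C0 by (intro C0_infty_mult_smooth smooth_intros(1))
  then have "kernel \<phi>"
    using \<eta>(2) c by (auto simp: kernel_def \<phi>_def c_def[symmetric])
  then show ?thesis using \<eta>(4) by (intro exI[of _ \<phi>]) (auto simp: \<phi>_def)
qed

lemma ex_mollifier: "\<exists>\<phi> :: nat \<Rightarrow> real^'n \<Rightarrow> real. mollifier \<phi>"
proof -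
  have "\<forall>k. \<exists>\<phi> :: real^'n \<Rightarrow> real. kernel \<phi> \<and> (\<forall>x. norm x > 1 / real (Suc k) \<longrightarrow> \<phi> x = 0)"
    by (intro allI ex_kernel) simp
  then show ?thesis unfolding mollifier_def by (rule choice)
qed

lemma mollifier_kernel: "mollifier \<phi> \<Longrightarrow> kernel (\<phi> k)"
  by (simp add: mollifier_def)


section \<open>Convergence of mollifications in L1\<close>

lemma real_tendsto_zero_le:
  fixes f g :: "nat \<Rightarrow> real"
  assumes "\<And>k. 0 \<le> f k" "g \<longlonglongrightarrow> 0" "\<And>k. f k \<le> g k"
  shows "f \<longlonglongrightarrow> 0"
  using assms by (intro tendsto_sandwich[OF _ _ tendsto_const assms(2)]) auto

text \<open>An argument with three errors: by \<open>conv_L1\<close> the convolution does not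
  enlarge f - g, so convergence for the approximant g passes to f.\<close>

lemma L1_mollify_approx:
  assumes \<phi>: "\<And>k. kernel (\<phi> k)" and f: "integrable lborel f"
    and approx: "\<And>e. e > 0 \<Longrightarrow> \<exists>g. integrable lborel g \<and> (LINT x|lborel. \<bar>f x - g x\<bar>) < e \<and>
      (\<lambda>k. LINT x|lborel. \<bar>conv g (\<phi> k) x - g x\<bar>) \<longlonglongrightarrow> 0"
  shows "(\<lambda>k. LINT x|lborel. \<bar>conv f (\<phi> k) x - f x\<bar>) \<longlonglongrightarrow> 0"
proof (rule LIMSEQ_I)
  fix e :: real assume "e > 0"
  then obtain g where g: "integrable lborel g" "(LINT x|lborel. \<bar>f x - g x\<bar>) < e / 3"
    "(\<lambda>k. LINT x|lborel. \<bar>conv g (\<phi> k) x - g x\<bar>) \<longlonglongrightarrow> 0"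
    using approx[of "e / 3"] by auto
  obtain N where N: "\<And>k. k \<ge> N \<Longrightarrow> (LINT x|lborel. \<bar>conv g (\<phi> k) x - g x\<bar>) < e / 3"
    using LIMSEQ_D[OF g(3), of "e / 3"] \<open>e > 0\<close> by fastforce
  have "(LINT x|lborel. \<bar>conv f (\<phi> k) x - f x\<bar>) < e" if "k \<ge> N" for k
  proof -
    have C: "\<phi> k \<in> C0_infty UNIV" using \<phi> by (simp add: kernel_def)
    note [simp] = f g(1) conv_L1(1)[OF \<phi> f] conv_L1(1)[OF \<phi> g(1)]
    have fg: "integrable lborel (\<lambda>x. f x - g x)" by simp
    note [simp] = conv_L1(1)[OF \<phi> fg]
    have "(LINT x|lborel. \<bar>conv f (\<phi> k) x - f x\<bar>) \<le> (LINT x|lborel. \<bar>conv (\<lambda>x. f x - g x) (\<phi> k) x\<bar> +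
        \<bar>conv g (\<phi> k) x - g x\<bar> + \<bar>f x - g x\<bar>)"
      by (intro integral_mono) (auto simp: conv_diff[OF f g(1) C])
    also have "\<dots> = (LINT x|lborel. \<bar>conv (\<lambda>x. f x - g x) (\<phi> k) x\<bar>) +
        (LINT x|lborel. \<bar>conv g (\<phi> k) x - g x\<bar>) + (LINT x|lborel. \<bar>f x - g x\<bar>)"
      by simp
    also have "\<dots> < e / 3 + e / 3 + e / 3"
      using conv_L1(2)[OF \<phi> fg, of k] g(2) N[OF that] by linarith
    finally show ?thesis by simp
  qed
  then show "\<exists>N. \<forall>k\<ge>N. norm ((LINT x|lborel. \<bar>conv f (\<phi> k) x - f x\<bar>) - 0) < e"
    by (intro exI[of _ N]) auto
qed

text \<open>Openness makes the mollification eventually equal to 1 at each point of U. At boundary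
  points nothing of this kind holds, so the mass outside U is controlled by the fact that
  convolution does not increase the total mass.\<close>

lemma L1_mollify_open:
  fixes U :: "(real^'n) set"
  assumes \<phi>: "mollifier \<phi>" and U: "open U" "emeasure lborel U < \<infinity>"
  shows "(\<lambda>k. LINT x|lborel. \<bar>conv (indicator U) (\<phi> k) x - indicator U x\<bar>) \<longlonglongrightarrow> 0"
proof -
  note ker = mollifier_kernel[OF \<phi>]
  define f :: "real^'n \<Rightarrow> real" where "f = indicator U"
  have f: "integrable lborel f"
    unfolding f_def using U by (intro integrable_real_indicator) auto
  define c where "c = (\<lambda>k. conv f (\<phi> k))"
  have c: "integrable lborel (c k)" for k
    unfolding c_def by (rule conv_L1(1)[OF ker f])
  have p: "0 \<le> \<phi> k z" and C0: "\<phi> k \<in> C0_infty UNIV" and one: "(LINT x|lborel. \<phi> k x) = 1" for k z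
    using ker[of k] by (auto simp: kernel_def)
  have one': "(LINT y|lborel. \<phi> k (x - y)) = 1" for k x
    using integral_lborel_reflect[of "\<phi> k" x] kernel_borel[OF ker[of k]] one by simp
  have int': "integrable lborel (\<lambda>y. \<phi> k (x - y))" for k x
    using one'[of k x] not_integrable_integral_eq by fastforce
  have c0: "0 \<le> c k x" for k x
    unfolding c_def conv_def f_def by (rule Bochner_Integration.integral_nonneg) (simp add: p)
  have c1: "c k x \<le> 1" for k x
  proof -
    have "c k x \<le> (LINT y|lborel. \<phi> k (x - y))"
      unfolding c_def conv_def
      by (intro integral_mono conv_integrable[OF f C0] int') (auto simp: f_def indicator_def p)
    then show ?thesis by (simp add: one')
  qed
  have ev: "\<forall>\<^sub>F k in sequentially. c k x = 1" if "x \<in> U" for x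
  proof -
    obtain e where e: "e > 0" "ball x e \<subseteq> U"
      using U(1) \<open>x \<in> U\<close> by (auto simp: open_contains_ball)
    have "\<forall>\<^sub>F k in sequentially. 1 / real (Suc k) < e"
      using LIMSEQ_inverse_real_of_nat e(1) by (auto simp: order_tendsto_iff inverse_eq_divide)
    then show ?thesis
    proof eventually_elim
      case (elim k)
      have "f y * \<phi> k (x - y) = \<phi> k (x - y)" for y
      proof (cases "y \<in> U")
        case False
        then have "\<not> dist x y < e" using e(2) by auto
        then have "norm (x - y) > 1 / real (Suc k)" using elim by (simp add: dist_norm)
        then show ?thesis using \<phi> by (simp add: mollifier_def)
      qed (simp add: f_def)
      then show ?case by (simp only: c_def conv_def one')
    qed
  qed
  have "(\<lambda>k. LINT x|lborel. f x * (1 - c k x)) \<longlonglongrightarrow> (\<integral>x. 0 \<partial>(lborel :: (real^'n) measure))"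
  proof (rule integral_dominated_convergence[where w = f])
    show "AE x in lborel. (\<lambda>k. f x * (1 - c k x)) \<longlonglongrightarrow> 0"
    proof (rule AE_I2)
      fix x show "(\<lambda>k. f x * (1 - c k x)) \<longlonglongrightarrow> 0"
      proof (cases "x \<in> U")
        case True
        from ev[OF this] show ?thesis
          by (intro tendsto_eventually) (auto elim: eventually_mono)
      qed (simp add: f_def)
    qed
    show "AE x in lborel. norm (f x * (1 - c k x)) \<le> f x" for k
      using c0 c1 by (intro AE_I2) (auto simp: f_def indicator_def)
    show "(\<lambda>x. f x * (1 - c k x)) \<in> borel_measurable lborel" for k
      using c[of k] f by (auto dest: borel_measurable_integrable)
  qed (use f in auto)
  then have lim: "(\<lambda>k. 2 * (LINT x|lborel. f x * (1 - c k x))) \<longlonglongrightarrow> 0"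
    using tendsto_mult_right_zero by fastforce
  have fc: "integrable lborel (\<lambda>x. f x * (1 - c k x))" for k
  proof (rule Bochner_Integration.integrable_bound[OF f])
    show "(\<lambda>x. f x * (1 - c k x)) \<in> borel_measurable lborel"
      using c[of k] f by (auto dest: borel_measurable_integrable)
    show "AE x in lborel. norm (f x * (1 - c k x)) \<le> norm (f x)"
      using c0 c1 by (intro AE_I2) (auto simp: f_def indicator_def)
  qed
  have le: "(LINT x|lborel. \<bar>c k x - f x\<bar>) \<le> 2 * (LINT x|lborel. f x * (1 - c k x))" for k
  proof -
    \<comment> \<open>By 0 \<le> c \<le> 1 both sides are c outside U and 1 - c inside. The identity
      moves the error into U, where pointwise convergence is known.\<close>
    have "\<bar>c k x - f x\<bar> = c k x - f x + 2 * (f x * (1 - c k x))" for x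
      using c0[of k x] c1[of k x] by (auto simp: f_def indicator_def)
    then have "(LINT x|lborel. \<bar>c k x - f x\<bar>) =
        (LINT x|lborel. c k x) - (LINT x|lborel. f x) + 2 * (LINT x|lborel. f x * (1 - c k x))"
      using c[of k] f fc[of k] by simp
    moreover have "(LINT x|lborel. c k x) \<le> (LINT x|lborel. f x)"
    proof -
      have "(\<lambda>x. \<bar>conv f (\<phi> k) x\<bar>) = c k" "(\<lambda>x. \<bar>f x\<bar>) = f"
        using c0 by (auto simp: fun_eq_iff c_def f_def)
      then show ?thesis using conv_L1(2)[OF ker f, of k] by simp
    qed
    ultimately show ?thesis by simp
  qed
  have "(\<lambda>k. LINT x|lborel. \<bar>c k x - f x\<bar>) \<longlonglongrightarrow> 0"
    using le by (intro tendsto_sandwich[OF _ _ tendsto_const lim]) auto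
  then show ?thesis by (simp add: c_def f_def)
qed

text \<open>Induction from indicators upwards. Borel sets of finite measure are approximated from
  outside by open ones through outer regularity, which leads back to
  \<open>L1_mollify_open\<close>.\<close>

lemma L1_mollify:
  fixes f :: "real^'n \<Rightarrow> real"
  assumes \<phi>: "mollifier \<phi>" and f: "integrable lborel f"
  shows "(\<lambda>k. LINT x|lborel. \<bar>conv f (\<phi> k) x - f x\<bar>) \<longlonglongrightarrow> 0"
  using f
proof (induction f rule: integrable_induct)
  note ker = mollifier_kernel[OF \<phi>]
  case (base A c)
  have A: "A \<in> sets borel" "emeasure lborel A < \<infinity>" using base by auto
  show ?case
  proof (rule L1_mollify_approx[OF ker])
    show "integrable lborel (\<lambda>x. indicator A x *\<^sub>R c)"
      using A by auto
    fix e :: real assume "e > 0"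
    \<comment> \<open>The summand 1 covers c = 0.\<close>
    define d where "d = e / (\<bar>c\<bar> + 1)"
    have "d > 0" using \<open>e > 0\<close> by (simp add: d_def)
    then obtain U where U: "open U" "A \<subseteq> U" "emeasure lborel (U - A) < d"
      using outer_regular_lborel[OF A(1)] by metis
    have "emeasure lborel U \<le> emeasure lborel A + emeasure lborel (U - A)"
      using emeasure_subadditive[of A lborel "U - A"] U A by (simp add: Un_absorb1)
    also have "\<dots> < \<infinity>"
      using A(2) U(3) by (auto simp: less_top[symmetric])
    finally have U_fin: "emeasure lborel U < \<infinity>" .
    have int: "integrable lborel (indicator U :: real^'n \<Rightarrow> real)"
      using U U_fin by (intro integrable_real_indicator) auto
    define g where "g = (\<lambda>x. c * indicator U x :: real)"
    have "(LINT x|lborel. \<bar>indicator A x *\<^sub>R c - g x\<bar>) = (LINT x|lborel. \<bar>c\<bar> * indicator (U - A) x)"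
      using U(2) by (intro Bochner_Integration.integral_cong) (auto simp: g_def indicator_def)
    also have "\<dots> = \<bar>c\<bar> * measure lborel (U - A)"
      by simp
    also have "\<dots> \<le> \<bar>c\<bar> * d"
      using U(3) \<open>d > 0\<close> by (intro mult_left_mono) (auto simp: measure_def enn2real_leI less_imp_le)
    also have "\<dots> < e"
      using \<open>e > 0\<close> by (simp add: d_def field_simps)
    finally have 1: "(LINT x|lborel. \<bar>indicator A x *\<^sub>R c - g x\<bar>) < e" .
    have "conv g (\<phi> k) x - g x = c * (conv (indicator U) (\<phi> k) x - indicator U x)" for k x
      by (simp add: g_def conv_cmult right_diff_distrib)
    then have "(\<lambda>k. LINT x|lborel. \<bar>conv g (\<phi> k) x - g x\<bar>) =
        (\<lambda>k. \<bar>c\<bar> * (LINT x|lborel. \<bar>conv (indicator U) (\<phi> k) x - indicator U x\<bar>))"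
      by (simp add: abs_mult)
    then have "(\<lambda>k. LINT x|lborel. \<bar>conv g (\<phi> k) x - g x\<bar>) \<longlonglongrightarrow> 0"
      using tendsto_mult_right_zero[OF L1_mollify_open[OF \<phi> U(1) U_fin]] by simp
    with 1 int show "\<exists>g. integrable lborel g \<and> (LINT x|lborel. \<bar>indicator A x *\<^sub>R c - g x\<bar>) < e \<and>
      (\<lambda>k. LINT x|lborel. \<bar>conv g (\<phi> k) x - g x\<bar>) \<longlonglongrightarrow> 0"
      by (intro exI[of _ g]) (auto simp: g_def)
  qed
next
  case (add f g)
  note ker = mollifier_kernel[OF \<phi>]
  have C: "\<phi> k \<in> C0_infty UNIV" for k using ker by (simp add: kernel_def)
  note [simp] = add.hyps conv_L1(1)[OF ker add.hyps(1)] conv_L1(1)[OF ker add.hyps(2)]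
  have "(\<lambda>k. (LINT x|lborel. \<bar>conv f (\<phi> k) x - f x\<bar>) + (LINT x|lborel. \<bar>conv g (\<phi> k) x - g x\<bar>)) \<longlonglongrightarrow> 0"
    using tendsto_add[OF add.IH] by simp
  moreover have "(LINT x|lborel. \<bar>conv (\<lambda>x. f x + g x) (\<phi> k) x - (f x + g x)\<bar>) \<le>
      (LINT x|lborel. \<bar>conv f (\<phi> k) x - f x\<bar>) + (LINT x|lborel. \<bar>conv g (\<phi> k) x - g x\<bar>)" for k
  proof -
    have "(LINT x|lborel. \<bar>conv (\<lambda>x. f x + g x) (\<phi> k) x - (f x + g x)\<bar>) \<le>
        (LINT x|lborel. \<bar>conv f (\<phi> k) x - f x\<bar> + \<bar>conv g (\<phi> k) x - g x\<bar>)"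
    proof (rule integral_mono)
      show "integrable lborel (\<lambda>x. \<bar>conv (\<lambda>x. f x + g x) (\<phi> k) x - (f x + g x)\<bar>)"
        unfolding conv_add[OF add.hyps C] by simp
      show "integrable lborel (\<lambda>x. \<bar>conv f (\<phi> k) x - f x\<bar> + \<bar>conv g (\<phi> k) x - g x\<bar>)"
        by simp
      fix x
      show "\<bar>conv (\<lambda>x. f x + g x) (\<phi> k) x - (f x + g x)\<bar> \<le>
          \<bar>conv f (\<phi> k) x - f x\<bar> + \<bar>conv g (\<phi> k) x - g x\<bar>"
        using abs_triangle_ineq[of "conv f (\<phi> k) x - f x" "conv g (\<phi> k) x - g x"]
        unfolding conv_add[OF add.hyps C] by (simp add: algebra_simps)
    qed
    also have "\<dots> = (LINT x|lborel. \<bar>conv f (\<phi> k) x - f x\<bar>) + (LINT x|lborel. \<bar>conv g (\<phi> k) x - g x\<bar>)"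
      by simp
    finally show ?thesis by simp
  qed
  ultimately show ?case
    by (rule real_tendsto_zero_le[rotated]) (rule Bochner_Integration.integral_nonneg, simp)
next
  case (lim f s)
  note ker = mollifier_kernel[OF \<phi>]
  show ?case
  proof (rule L1_mollify_approx[OF ker \<open>integrable lborel f\<close>])
    fix e :: real assume "e > 0"
    have "(\<lambda>i. LINT x|lborel. \<bar>f x - s i x\<bar>) \<longlonglongrightarrow> (\<integral>x. 0 \<partial>(lborel :: (real^'n) measure))"
    \<comment> \<open>The approximants of the induction rule satisfy |s| \<le> 2 |f|, hence the
      factor 3.\<close>
    proof (rule integral_dominated_convergence[where w = "\<lambda>x. 3 * \<bar>f x\<bar>"])
      show "AE x in lborel. (\<lambda>i. \<bar>f x - s i x\<bar>) \<longlonglongrightarrow> 0"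
      proof (rule AE_I2)
        fix x
        have "(\<lambda>i. s i x) \<longlonglongrightarrow> f x" using lim(2)[of x] by simp
        then have "(\<lambda>i. \<bar>f x - s i x\<bar>) \<longlonglongrightarrow> \<bar>f x - f x\<bar>" by (intro tendsto_intros)
        then show "(\<lambda>i. \<bar>f x - s i x\<bar>) \<longlonglongrightarrow> 0" by simp
      qed
      show "AE x in lborel. norm \<bar>f x - s i x\<bar> \<le> 3 * \<bar>f x\<bar>" for i
      proof (rule AE_I2)
        fix x
        show "norm \<bar>f x - s i x\<bar> \<le> 3 * \<bar>f x\<bar>"
          using lim(3)[of x i] by (simp split: abs_split)
      qed
    qed (use lim(1,4) in auto)
    then have "\<forall>\<^sub>F i in sequentially. (LINT x|lborel. \<bar>f x - s i x\<bar>) < e"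
      using \<open>e > 0\<close> by (simp add: order_tendsto_iff)
    then obtain i where "(LINT x|lborel. \<bar>f x - s i x\<bar>) < e"
      by (meson eventually_sequentially order_refl)
    then show "\<exists>g. integrable lborel g \<and> (LINT x|lborel. \<bar>f x - g x\<bar>) < e \<and>
      (\<lambda>k. LINT x|lborel. \<bar>conv g (\<phi> k) x - g x\<bar>) \<longlonglongrightarrow> 0"
      using lim by blast
  qed
qed

section \<open>Square integrable functions and uniqueness of weak derivatives\<close>

text \<open>Borel rather than Lebesgue measurability, which suits convolution and Tonelli; members
  of \<open>Lp\<close> are brought into this class by Borel representatives.\<close>

definition square_integrable :: "(real^'n \<Rightarrow> real) \<Rightarrow> bool" where
  "square_integrable f \<longleftrightarrow> f \<in> borel_measurable borel \<and> integrable lborel (\<lambda>x. (f x)\<^sup>2)"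

lemma square_integrable_borel [measurable_dest]:
  "square_integrable f \<Longrightarrow> f \<in> borel_measurable borel"
  by (simp add: square_integrable_def)

lemma square_integrable_le:
  assumes "square_integrable f" "g \<in> borel_measurable borel" "\<And>x. \<bar>g x\<bar> \<le> C * \<bar>f x\<bar>"
  shows "square_integrable g"
proof -
  have "integrable lborel (\<lambda>x. (g x)\<^sup>2)"
  proof (rule Bochner_Integration.integrable_bound)
    show "integrable lborel (\<lambda>x. C\<^sup>2 * (f x)\<^sup>2)"
      using assms(1) by (simp add: square_integrable_def)
    show "(\<lambda>x. (g x)\<^sup>2) \<in> borel_measurable lborel"
      using assms(2) by simp
    have "(g x)\<^sup>2 \<le> C\<^sup>2 * (f x)\<^sup>2" for x
      using power_mono[OF assms(3) abs_ge_zero, of x 2] by (simp add: power_mult_distrib)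
    then show "AE x in lborel. norm ((g x)\<^sup>2) \<le> norm (C\<^sup>2 * (f x)\<^sup>2)"
      by (intro AE_I2) simp
  qed
  then show ?thesis using assms(2) by (simp add: square_integrable_def)
qed

lemma square_integrable_cmult: "square_integrable f \<Longrightarrow> square_integrable (\<lambda>x. c * f x)"
  by (rule square_integrable_le[where C = "\<bar>c\<bar>"]) (auto simp: abs_mult)

lemma square_integrable_mult_bounded:
  assumes "square_integrable f" "g \<in> borel_measurable borel" "\<And>x. \<bar>g x\<bar> \<le> C"
  shows "square_integrable (\<lambda>x. g x * f x)"
  using assms by (intro square_integrable_le[OF assms(1), where C = C])
    (auto simp: abs_mult intro: mult_right_mono)

lemma square_integrable_add:
  assumes "square_integrable f" "square_integrable g"
  shows "square_integrable (\<lambda>x. f x + g x)"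
proof -
  have [measurable]: "f \<in> borel_measurable borel" "g \<in> borel_measurable borel"
    using assms by (auto simp: square_integrable_def)
  have "integrable lborel (\<lambda>x. (f x + g x)\<^sup>2)"
  proof (rule Bochner_Integration.integrable_bound)
    show "integrable lborel (\<lambda>x. 2 * (f x)\<^sup>2 + 2 * (g x)\<^sup>2)"
      using assms by (simp add: square_integrable_def)
    have "(f x + g x)\<^sup>2 \<le> 2 * (f x)\<^sup>2 + 2 * (g x)\<^sup>2" for x
      using zero_le_power2[of "f x - g x"] by (simp add: power2_eq_square algebra_simps)
    then show "AE x in lborel. norm ((f x + g x)\<^sup>2) \<le> norm (2 * (f x)\<^sup>2 + 2 * (g x)\<^sup>2)"
      by (intro AE_I2) simp
  qed simp
  then show ?thesis by (simp add: square_integrable_def)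
qed

lemma square_integrable_diff:
  "square_integrable f \<Longrightarrow> square_integrable g \<Longrightarrow> square_integrable (\<lambda>x. f x - g x)"
  using square_integrable_add[of f "\<lambda>x. (- 1) * g x"] square_integrable_cmult[of g "- 1"] by simp

lemma square_integrable_sum:
  "finite I \<Longrightarrow> (\<And>i. i \<in> I \<Longrightarrow> square_integrable (f i)) \<Longrightarrow> square_integrable (\<lambda>x. \<Sum>i\<in>I. f i x)"
proof (induction I rule: finite_induct)
  case empty
  then show ?case by (simp add: square_integrable_def)
next
  case (insert i I)
  then show ?case using square_integrable_add[of "f i" "\<lambda>x. \<Sum>i\<in>I. f i x"] by simp
qed

lemma square_integrable_conv:
  assumes "kernel \<phi>" "integrable lborel f" "square_integrable f"
  shows "square_integrable (conv f \<phi>)"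
  using assms conv_L2(1)[of \<phi> f] smooth_borel[OF smooth_conv_kernel]
  by (auto simp: square_integrable_def)

lemma Cauchy_Schwarz_integral:
  assumes "square_integrable f" "square_integrable g"
  shows "integrable lborel (\<lambda>x. f x * g x)"
    and "(LINT x|lborel. f x * g x)\<^sup>2 \<le> (LINT x|lborel. (f x)\<^sup>2) * (LINT x|lborel. (g x)\<^sup>2)"
proof -
  have [measurable]: "f \<in> borel_measurable borel" "g \<in> borel_measurable borel"
    and int: "integrable lborel (\<lambda>x. (f x)\<^sup>2)" "integrable lborel (\<lambda>x. (g x)\<^sup>2)"
    using assms by (auto simp: square_integrable_def)
  show fg: "integrable lborel (\<lambda>x. f x * g x)"
  proof (rule Bochner_Integration.integrable_bound)
    show "integrable lborel (\<lambda>x. (f x)\<^sup>2 + (g x)\<^sup>2)"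
      using int by simp
    have "\<bar>f x * g x\<bar> \<le> (f x)\<^sup>2 + (g x)\<^sup>2" for x
      using sum_squares_bound[of "\<bar>f x\<bar>" "\<bar>g x\<bar>"] abs_ge_zero[of "f x * g x"]
      unfolding abs_mult power2_abs by linarith
    then show "AE x in lborel. norm (f x * g x) \<le> norm ((f x)\<^sup>2 + (g x)\<^sup>2)"
      by (intro AE_I2) simp
  qed simp
  have "ennreal ((LINT x|lborel. f x * g x)\<^sup>2) = (ennreal \<bar>LINT x|lborel. f x * g x\<bar>)\<^sup>2"
    by (simp add: ennreal_power)
  also have "\<dots> \<le> (\<integral>\<^sup>+x. norm (f x * g x) \<partial>lborel)\<^sup>2"
    using integral_norm_bound_ennreal[OF fg] by (intro power_mono) auto
  also have "(\<integral>\<^sup>+x. norm (f x * g x) \<partial>lborel) = (\<integral>\<^sup>+x. ennreal \<bar>f x\<bar> * ennreal \<bar>g x\<bar> \<partial>lborel)"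
    by (simp add: abs_mult ennreal_mult)
  also have "\<dots>\<^sup>2 \<le> (\<integral>\<^sup>+x. (ennreal \<bar>f x\<bar>)\<^sup>2 \<partial>lborel) * (\<integral>\<^sup>+x. (ennreal \<bar>g x\<bar>)\<^sup>2 \<partial>lborel)"
    by (rule Cauchy_Schwarz_nn_integral) auto
  also have "\<dots> = ennreal ((LINT x|lborel. (f x)\<^sup>2) * (LINT x|lborel. (g x)\<^sup>2))"
    using int by (simp add: ennreal_power nn_integral_eq_integral ennreal_mult)
  finally show "(LINT x|lborel. f x * g x)\<^sup>2 \<le> (LINT x|lborel. (f x)\<^sup>2) * (LINT x|lborel. (g x)\<^sup>2)"
    by (simp add: ennreal_le_iff mult_nonneg_nonneg)
qed

lemma L2_tendsto_integral_mult:
  assumes a: "\<And>k. square_integrable (a k)" "square_integrable a'"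
    and lim: "(\<lambda>k::nat. LINT x|lborel. (a k x - a' x)\<^sup>2) \<longlonglongrightarrow> 0" and b: "square_integrable b"
  shows "(\<lambda>k. LINT x|lborel. b x * a k x) \<longlonglongrightarrow> (LINT x|lborel. b x * a' x)"
proof -
  have "(\<lambda>k. ((LINT x|lborel. b x * a k x) - (LINT x|lborel. b x * a' x))\<^sup>2) \<longlonglongrightarrow> 0"
  proof (rule real_tendsto_zero_le)
    show "(\<lambda>k. (LINT x|lborel. (b x)\<^sup>2) * (LINT x|lborel. (a k x - a' x)\<^sup>2)) \<longlonglongrightarrow> 0"
      using lim by (rule tendsto_mult_right_zero)
    show "((LINT x|lborel. b x * a k x) - (LINT x|lborel. b x * a' x))\<^sup>2 \<le>
        (LINT x|lborel. (b x)\<^sup>2) * (LINT x|lborel. (a k x - a' x)\<^sup>2)" for k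
      using Cauchy_Schwarz_integral(2)[OF b square_integrable_diff[OF a]]
        Cauchy_Schwarz_integral(1)[OF b a(1)] Cauchy_Schwarz_integral(1)[OF b a(2)]
      by (simp add: right_diff_distrib)
  qed simp
  from tendsto_real_sqrt[OF this]
  have "(\<lambda>k. \<bar>(LINT x|lborel. b x * a k x) - (LINT x|lborel. b x * a' x)\<bar>) \<longlonglongrightarrow> 0"
    by simp
  then show ?thesis
    using tendsto_rabs_zero_iff by (subst Lim_null) blast
qed

section \<open>Convergence of mollifications in L2\<close>

lemma abs_conv_bounded:
  assumes \<phi>: "kernel \<phi>" and f: "integrable lborel f" "\<And>x. \<bar>f x\<bar> \<le> N"
  shows "\<bar>conv f \<phi> x\<bar> \<le> N"
proof -
  have N: "0 \<le> N" using f(2)[of x] by linarith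
  have "ennreal \<bar>conv f \<phi> x\<bar> \<le> (\<integral>\<^sup>+y. ennreal \<bar>f y\<bar> * ennreal (\<phi> (x - y)) \<partial>lborel)"
    using \<phi> f(1) by (rule abs_conv_le)
  also have "\<dots> \<le> (\<integral>\<^sup>+y. ennreal N * ennreal (\<phi> (x - y)) \<partial>lborel)"
    using f(2) by (intro nn_integral_mono mult_right_mono ennreal_leI) auto
  also have "\<dots> = ennreal N"
    using nn_integral_lborel_reflect[of "\<lambda>x. ennreal (\<phi> x)" x] kernel_nn_integral[OF \<phi>]
      kernel_borel[OF \<phi>]
    by (subst nn_integral_cmult) auto
  finally show ?thesis using N by simp
qed

text \<open>Both functions are bounded by N, so the squared difference is at most 2 N times the
  absolute difference, and L1 convergence suffices.\<close>

lemma L2_mollify_bounded: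
  assumes \<phi>: "mollifier \<phi>" and f: "integrable lborel f" "\<And>x. \<bar>f x\<bar> \<le> N"
  shows "(\<lambda>k. LINT x|lborel. (conv f (\<phi> k) x - f x)\<^sup>2) \<longlonglongrightarrow> 0"
proof (rule real_tendsto_zero_le)
  note ker = mollifier_kernel[OF \<phi>]
  show "(\<lambda>k. 2 * N * (LINT x|lborel. \<bar>conv f (\<phi> k) x - f x\<bar>)) \<longlonglongrightarrow> 0"
    using L1_mollify[OF \<phi> f(1)] by (rule tendsto_mult_right_zero)
  fix k
  have int: "integrable lborel (\<lambda>x. 2 * N * \<bar>conv f (\<phi> k) x - f x\<bar>)"
    using f(1) conv_L1(1)[OF ker f(1)] by (intro integrable_mult_right) simp
  have le: "(conv f (\<phi> k) x - f x)\<^sup>2 \<le> 2 * N * \<bar>conv f (\<phi> k) x - f x\<bar>" for x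
  proof -
    have "\<bar>conv f (\<phi> k) x - f x\<bar> \<le> 2 * N"
      using abs_conv_bounded[OF ker f, of k x] f(2)[of x] by linarith
    then have "\<bar>conv f (\<phi> k) x - f x\<bar> * \<bar>conv f (\<phi> k) x - f x\<bar> \<le> 2 * N * \<bar>conv f (\<phi> k) x - f x\<bar>"
      by (intro mult_right_mono) auto
    then show ?thesis by (simp add: power2_eq_square)
  qed
  have "(LINT x|lborel. (conv f (\<phi> k) x - f x)\<^sup>2) \<le> (LINT x|lborel. 2 * N * \<bar>conv f (\<phi> k) x - f x\<bar>)"
    using le order_trans[OF abs_ge_zero f(2)] by (intro integral_mono' int) auto
  then show "(LINT x|lborel. (conv f (\<phi> k) x - f x)\<^sup>2) \<le> 2 * N * (LINT x|lborel. \<bar>conv f (\<phi> k) x - f x\<bar>)"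
    by simp
qed simp

lemma square_add3_le: "(a + b + c)\<^sup>2 \<le> 3 * (a\<^sup>2 + b\<^sup>2 + c\<^sup>2)" for a b c :: real
  using zero_le_power2[of "a - b"] zero_le_power2[of "b - c"] zero_le_power2[of "a - c"]
  by (simp add: power2_eq_square algebra_simps)

text \<open>Truncation at height N reduces to the bounded case, and \<open>conv_L2\<close> keeps the
  tail f - t N small after convolution.\<close>

lemma L2_mollify:
  fixes f :: "real^'n \<Rightarrow> real"
  assumes \<phi>: "mollifier \<phi>" and f: "integrable lborel f" "square_integrable f"
  shows "(\<lambda>k. LINT x|lborel. (conv f (\<phi> k) x - f x)\<^sup>2) \<longlonglongrightarrow> 0"
proof (rule LIMSEQ_I)
  note ker = mollifier_kernel[OF \<phi>]
  have [measurable]: "f \<in> borel_measurable borel"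
    using f(2) by (simp add: square_integrable_def)
  define t where "t = (\<lambda>N x. max (- real N) (min (real N) (f x)))"
  have [measurable]: "t N \<in> borel_measurable borel" for N
    by (simp add: t_def)
  have t: "\<bar>t N x\<bar> \<le> \<bar>f x\<bar>" "\<bar>t N x\<bar> \<le> real N" "\<bar>f x - t N x\<bar> \<le> \<bar>f x\<bar>" for N x
    by (auto simp: t_def max_def min_def abs_if)
  have "(\<lambda>N. LINT x|lborel. (f x - t N x)\<^sup>2) \<longlonglongrightarrow> (\<integral>x. 0 \<partial>(lborel :: (real^'n) measure))"
  proof (rule integral_dominated_convergence[where w = "\<lambda>x. (f x)\<^sup>2"])
    show "AE x in lborel. (\<lambda>N. (f x - t N x)\<^sup>2) \<longlonglongrightarrow> 0"
    proof (rule AE_I2)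
      fix x
      obtain M where "\<bar>f x\<bar> \<le> real M" using real_arch_simple by blast
      then have "(f x - t N x)\<^sup>2 = 0" if "N \<ge> M" for N
        using that by (auto simp: t_def max_def min_def abs_if split: if_splits)
      then show "(\<lambda>N. (f x - t N x)\<^sup>2) \<longlonglongrightarrow> 0"
        by (intro tendsto_eventually) (auto simp: eventually_sequentially)
    qed
    show "AE x in lborel. norm ((f x - t N x)\<^sup>2) \<le> (f x)\<^sup>2" for N
      using t(3) by (intro AE_I2) (simp add: abs_le_square_iff)
    show "integrable lborel (\<lambda>x. (f x)\<^sup>2)"
      using f(2) by (simp add: square_integrable_def)
  qed auto
  then have tlim: "(\<lambda>N. LINT x|lborel. (f x - t N x)\<^sup>2) \<longlonglongrightarrow> 0" by simp
  fix e :: real assume "e > 0"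
  \<comment> \<open>Three errors of size e / 9, each multiplied by the 3 of
    \<open>square_add3_le\<close>, add up to e.\<close>
  then have "\<forall>\<^sub>F N in sequentially. (LINT x|lborel. (f x - t N x)\<^sup>2) < e / 9"
    using tlim by (intro order_tendstoD) auto
  then obtain N where N: "(LINT x|lborel. (f x - t N x)\<^sup>2) < e / 9"
    by (meson eventually_sequentially order_refl)
  define g where "g = t N"
  have g: "integrable lborel g" "square_integrable g"
  proof -
    show "integrable lborel g"
      by (rule Bochner_Integration.integrable_bound[OF f(1)]) (auto simp: g_def t)
    show "square_integrable g"
      using t(1) by (intro square_integrable_le[OF f(2), where C = 1]) (auto simp: g_def)
  qed
  have "(\<lambda>k. LINT x|lborel. (conv g (\<phi> k) x - g x)\<^sup>2) \<longlonglongrightarrow> 0"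
    using g(1) t(2) by (intro L2_mollify_bounded[OF \<phi>, where N = "real N"]) (auto simp: g_def)
  then obtain K where K: "\<And>k. k \<ge> K \<Longrightarrow> (LINT x|lborel. (conv g (\<phi> k) x - g x)\<^sup>2) < e / 9"
    using LIMSEQ_D[of _ 0 "e / 9"] \<open>e > 0\<close> by fastforce
  have "(LINT x|lborel. (conv f (\<phi> k) x - f x)\<^sup>2) < e" if "k \<ge> K" for k
  proof -
    have C: "\<phi> k \<in> C0_infty UNIV" using ker by (simp add: kernel_def)
    have fg: "integrable lborel (\<lambda>x. f x - g x)" "square_integrable (\<lambda>x. f x - g x)"
      using f g by (auto intro: square_integrable_diff)
    define A where "A = conv (\<lambda>x. f x - g x) (\<phi> k)"
    have A: "A x = conv f (\<phi> k) x - conv g (\<phi> k) x" for x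
      unfolding A_def by (rule conv_diff[OF f(1) g(1) C])
    have sq: "square_integrable A" "square_integrable (\<lambda>x. conv g (\<phi> k) x - g x)"
      "square_integrable (\<lambda>x. conv f (\<phi> k) x - f x)"
      unfolding A_def using f g fg ker by (auto intro!: square_integrable_conv square_integrable_diff)
    have int: "integrable lborel (\<lambda>x. (A x)\<^sup>2)" "integrable lborel (\<lambda>x. (conv g (\<phi> k) x - g x)\<^sup>2)"
      "integrable lborel (\<lambda>x. (f x - g x)\<^sup>2)" "integrable lborel (\<lambda>x. (conv f (\<phi> k) x - f x)\<^sup>2)"
      using sq fg(2) by (auto simp: square_integrable_def)
    have "(LINT x|lborel. (conv f (\<phi> k) x - f x)\<^sup>2) \<le>
        (LINT x|lborel. 3 * ((A x)\<^sup>2 + (conv g (\<phi> k) x - g x)\<^sup>2 + (f x - g x)\<^sup>2))"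
    proof (rule integral_mono)
      fix x
      show "(conv f (\<phi> k) x - f x)\<^sup>2 \<le> 3 * ((A x)\<^sup>2 + (conv g (\<phi> k) x - g x)\<^sup>2 + (f x - g x)\<^sup>2)"
        using square_add3_le[of "A x" "conv g (\<phi> k) x - g x" "g x - f x"]
        by (simp add: A power2_commute[of "g x" "f x"])
    qed (use int in auto)
    also have "\<dots> = 3 * ((LINT x|lborel. (A x)\<^sup>2) + (LINT x|lborel. (conv g (\<phi> k) x - g x)\<^sup>2) +
        (LINT x|lborel. (f x - g x)\<^sup>2))"
      using int by simp
    also have "(LINT x|lborel. (A x)\<^sup>2) \<le> (LINT x|lborel. (f x - g x)\<^sup>2)"
      unfolding A_def using fg by (intro conv_L2(2)[OF ker]) (auto simp: square_integrable_def)
    finally show ?thesis using N K[OF that] by (simp add: g_def)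
  qed
  then show "\<exists>N. \<forall>k\<ge>N. norm ((LINT x|lborel. (conv f (\<phi> k) x - f x)\<^sup>2) - 0) < e"
    by (intro exI[of _ K]) auto
qed

text \<open>On a bounded set |f| \<le> f^2 + 1, and the right-hand side is integrable there.\<close>

lemma square_integrable_imp_integrable:
  assumes f: "square_integrable f" and K: "bounded K" "\<And>x. x \<notin> K \<Longrightarrow> f x = 0"
  shows "integrable lborel f"
proof -
  obtain r where "\<forall>x\<in>K. norm x \<le> r"
    using K(1) by (auto simp: bounded_iff)
  then have r: "K \<subseteq> cball 0 r" by auto
  have "integrable lborel (\<lambda>x. (f x)\<^sup>2 + indicator (cball 0 r) x :: real)"
    using f emeasure_bounded_finite[of "cball 0 r"]
    by (intro Bochner_Integration.integrable_add integrable_real_indicator)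
      (auto simp: square_integrable_def)
  moreover have "\<bar>f x\<bar> \<le> (f x)\<^sup>2 + indicator (cball 0 r) x" for x
  proof (cases "x \<in> K")
    case True
    have "\<bar>f x\<bar> \<le> (f x)\<^sup>2 + 1"
      using sum_squares_bound[of "\<bar>f x\<bar>" 1] abs_ge_zero[of "f x"] unfolding power2_abs by simp
    then show ?thesis using True r by (auto simp: indicator_def)
  qed (simp add: K(2))
  then have "AE x in lborel. norm (f x) \<le> norm ((f x)\<^sup>2 + indicator (cball 0 r) x :: real)"
    by (intro AE_I2) (auto intro: order_trans[OF _ abs_ge_self])
  ultimately show ?thesis
    using f by (auto simp: square_integrable_def intro: Bochner_Integration.integrable_bound)
qed


section \<open>From Lebesgue measure on a subset to Borel functions on the whole space\<close>

lemma borel_representative: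
  fixes f :: "real^'n \<Rightarrow> real"
  assumes U: "U \<in> sets borel" and f: "f \<in> borel_measurable (lebesgue_on U)"
  obtains g where "g \<in> borel_measurable borel" "\<And>x. x \<notin> U \<Longrightarrow> g x = 0"
    "AE x in lebesgue_on U. f x = g x"
proof -
  have "(\<lambda>x. indicator U x * f x) \<in> borel_measurable lebesgue"
    using f U by (subst (asm) borel_measurable_restrict_space_iff) (auto simp: mult.commute)
  then obtain g where g: "g \<in> borel_measurable lborel" "AE x in lborel. indicator U x * f x = g x"
    using completion_ex_borel_measurable_real by blast
  show thesis
  proof (rule that[of "\<lambda>x. indicator U x * g x"])
    show "(\<lambda>x. indicator U x * g x) \<in> borel_measurable borel"
      using U g(1) by simp
    have "AE x in lebesgue. indicator U x * f x = g x"
      using g(2) by (rule AE_completion)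
    then show "AE x in lebesgue_on U. f x = indicator U x * g x"
      using U by (subst AE_restrict_space_iff) (auto elim!: eventually_mono)
  qed simp
qed

lemma integral_lebesgue_on_borel:
  fixes g :: "real^'n \<Rightarrow> real"
  assumes U: "U \<in> sets borel" and g: "g \<in> borel_measurable borel" "\<And>x. x \<notin> U \<Longrightarrow> g x = 0"
  shows "integral\<^sup>L (lebesgue_on U) g = integral\<^sup>L lborel g"
    and "integrable (lebesgue_on U) g \<longleftrightarrow> integrable lborel g"
proof -
  have eq: "(\<lambda>x. indicat_real U x * g x) = g"
    using g(2) by (auto simp: fun_eq_iff indicator_def)
  show "integral\<^sup>L (lebesgue_on U) g = integral\<^sup>L lborel g"
    using U g(1) by (subst integral_restrict_space) (auto simp: eq integral_completion)
  show "integrable (lebesgue_on U) g \<longleftrightarrow> integrable lborel g"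
    using U g(1) by (subst integrable_restrict_space) (auto simp: eq integrable_completion)
qed

lemma integral_lebesgue_on_mono:
  fixes f :: "real^'n \<Rightarrow> real"
  assumes "U \<in> sets borel" "K \<in> sets borel" "K \<subseteq> U" "\<And>x. x \<notin> K \<Longrightarrow> f x = 0"
  shows "integral\<^sup>L (lebesgue_on U) f = integral\<^sup>L (lebesgue_on K) f"
proof -
  have "(\<lambda>x. indicat_real U x *\<^sub>R f x) = (\<lambda>x. indicat_real K x *\<^sub>R f x)"
    using assms(3,4) by (force simp: fun_eq_iff indicator_def)
  then show ?thesis
    using assms(1,2) by (simp add: integral_restrict_space)
qed

lemma AE_lebesgue_on_iff_lborel:
  assumes "U \<in> sets borel"
  shows "(AE x in lebesgue_on U. P x) \<longleftrightarrow> (AE x in lborel. x \<in> U \<longrightarrow> P x)"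
  using assms by (subst AE_restrict_space_iff) (auto simp: AE_completion_iff)

text \<open>Testing with the mollifications of \<open>sgn d\<close> gives \<open>\<integral> |d| = 0\<close>.\<close>

lemma AE_zero_if_orthogonal_to_test_functions:
  fixes d :: "real^'n \<Rightarrow> real"
  assumes K: "compact K" and d: "integrable lborel d" and e0: "e0 > 0"
    and orth: "\<And>\<psi>. \<psi> \<in> C0_infty UNIV \<Longrightarrow> (\<And>x. \<psi> x \<noteq> 0 \<Longrightarrow> \<exists>y\<in>K. dist y x \<le> e0) \<Longrightarrow>
      (LINT x|lborel. d x * \<psi> x) = 0"
  shows "AE x in lborel. x \<in> K \<longrightarrow> d x = 0"
proof -
  obtain \<phi> :: "nat \<Rightarrow> real^'n \<Rightarrow> real" where \<phi>: "mollifier \<phi>" using ex_mollifier by blast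
  note ker = mollifier_kernel[OF \<phi>]
  have [measurable]: "d \<in> borel_measurable borel" "K \<in> sets borel"
    using d K by (auto simp: compact_imp_closed)
  define s where "s = (\<lambda>x. sgn (d x) * indicator K x)"
  have s_le: "\<bar>s x\<bar> \<le> 1" for x by (auto simp: s_def indicator_def sgn_if)
  have K_fin: "emeasure lborel K < \<infinity>"
    using K by (rule emeasure_compact_finite)
  have s: "integrable lborel s"
  proof (rule Bochner_Integration.integrable_bound)
    show "integrable lborel (indicator K :: real^'n \<Rightarrow> real)"
      using K_fin by (intro integrable_real_indicator) auto
    show "AE x in lborel. norm (s x) \<le> norm (indicator K x :: real)"
      by (intro AE_I2) (auto simp: s_def indicator_def sgn_if)
  qed (simp add: s_def)
  have int: "integrable lborel (\<lambda>x. conv s (\<phi> k) x - s x)" for k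
    using s conv_L1(1)[OF ker s] by simp
  \<comment> \<open>As d is only integrable, L1 convergence of the test functions is not enough. An
    almost everywhere convergent subsequence, bounded by 1, admits |d| as a dominating
    function.\<close>
  have "(\<lambda>k. LINT x|lborel. norm (conv s (\<phi> k) x - s x)) \<longlonglongrightarrow> 0"
    using L1_mollify[OF \<phi> s] by simp
  from tendsto_L1_AE_subseq[OF int this]
  obtain r where r: "strict_mono r" "AE x in lborel. (\<lambda>k. conv s (\<phi> (r k)) x - s x) \<longlonglongrightarrow> 0"
    by blast
  have lim: "(\<lambda>k. LINT x|lborel. d x * conv s (\<phi> (r k)) x) \<longlonglongrightarrow> (LINT x|lborel. d x * s x)"
  proof (rule integral_dominated_convergence[where w = "\<lambda>x. \<bar>d x\<bar>"])
    show "AE x in lborel. (\<lambda>k. d x * conv s (\<phi> (r k)) x) \<longlonglongrightarrow> d x * s x"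
      using r(2)
    proof eventually_elim
      case (elim x)
      then have "(\<lambda>k. conv s (\<phi> (r k)) x) \<longlonglongrightarrow> s x" by (simp add: LIM_zero_iff)
      then show ?case by (intro tendsto_intros)
    qed
    show "AE x in lborel. norm (d x * conv s (\<phi> (r k)) x) \<le> \<bar>d x\<bar>" for k
      using abs_conv_bounded[OF ker s s_le] by (intro AE_I2) (simp add: abs_mult mult_left_le)
    show "(\<lambda>x. d x * conv s (\<phi> (r k)) x) \<in> borel_measurable lborel" for k
      using smooth_borel[OF smooth_conv_kernel[OF s ker]] by simp
  qed (use d in \<open>auto simp: s_def\<close>)
  have "\<forall>\<^sub>F k in sequentially. 1 / real (Suc k) < e0"
    using LIMSEQ_inverse_real_of_nat e0 by (auto simp: order_tendsto_iff inverse_eq_divide)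
  then obtain M where M: "\<And>k. k \<ge> M \<Longrightarrow> 1 / real (Suc k) < e0"
    by (auto simp: eventually_sequentially)
  have zero: "(LINT x|lborel. d x * conv s (\<phi> (r k)) x) = 0" if "k \<ge> M" for k
  proof (rule orth)
    have ge: "r k \<ge> M" using that seq_suble[OF r(1), of k] by simp
    have \<phi>k: "\<phi> (r k) \<in> C0_infty UNIV" "\<And>x. norm x > e0 \<Longrightarrow> \<phi> (r k) x = 0"
      using \<phi> M[OF ge] by (auto simp: mollifier_def kernel_def)
    have z: "conv s (\<phi> (r k)) x = 0" if "\<not> (\<exists>y\<in>K. dist y x \<le> e0)" for x
      using that \<phi>k(2) by (intro conv_eq_zero[of K s e0]) (auto simp: s_def)
    then show "\<exists>y\<in>K. dist y x \<le> e0" if "conv s (\<phi> (r k)) x \<noteq> 0" for x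
      using that by blast
    obtain K' where K': "compact K'" "\<forall>y\<in>K. \<forall>x. dist y x \<le> e0 \<longrightarrow> x \<in> K'"
    proof -
      obtain R where "\<forall>y\<in>K. dist 0 y \<le> R"
        using compact_imp_bounded[OF K] bounded_any_center[of K 0] by auto
      then have "\<forall>y\<in>K. \<forall>x. dist y x \<le> e0 \<longrightarrow> x \<in> cball 0 (R + e0)"
        by (metis add_mono dist_triangle mem_cball order_trans)
      then show thesis using that[of "cball 0 (R + e0)"] by auto
    qed
    then have "conv s (\<phi> (r k)) x = 0" if "x \<notin> K'" for x
      using z that by blast
    then show "conv s (\<phi> (r k)) \<in> C0_infty UNIV"
      using K'(1) smooth_conv_kernel[OF s ker] by (intro C0_inftyI[of _ K']) auto
  qed
  have "(\<lambda>k. LINT x|lborel. d x * conv s (\<phi> (r k)) x) \<longlonglongrightarrow> 0"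
    using zero by (intro tendsto_eventually) (auto simp: eventually_sequentially)
  then have "(LINT x|lborel. d x * s x) = 0"
    using lim LIMSEQ_unique by blast
  moreover have "d x * s x = \<bar>d x\<bar> * indicator K x" for x
    by (auto simp: s_def sgn_if)
  ultimately have "(LINT x|lborel. \<bar>d x\<bar> * indicator K x) = 0" by simp
  moreover have "integrable lborel (\<lambda>x. \<bar>d x\<bar> * indicator K x)"
    using integrable_mult_indicator[of K lborel "\<lambda>x. \<bar>d x\<bar>"] d by (simp add: mult.commute)
  ultimately have "AE x in lborel. \<bar>d x\<bar> * indicator K x = 0"
    using integral_nonneg_eq_0_iff_AE[of lborel "\<lambda>x. \<bar>d x\<bar> * indicator K x"] by simp
  then show ?thesis
    by (rule eventually_mono) (auto simp: indicator_def)
qed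

section \<open>Uniqueness of weak derivatives\<close>

lemma L1_loc_diff: "f \<in> L1_loc U \<Longrightarrow> g \<in> L1_loc U \<Longrightarrow> (\<lambda>x. f x - g x) \<in> L1_loc U"
  by (auto simp: L1_loc_def)

lemma L1_loc_integrable_mult_test:
  fixes f :: "real^'n \<Rightarrow> real"
  assumes U: "open U" and f: "f \<in> L1_loc U" and \<psi>: "\<psi> \<in> C0_infty U"
  shows "integrable (lebesgue_on U) (\<lambda>x. f x * \<psi> x)"
proof -
  obtain K where K: "compact K" "K \<subseteq> U" "\<And>x. x \<notin> K \<Longrightarrow> \<psi> x = 0"
    using \<psi> by (rule C0_inftyE) blast
  have fK: "integrable (lebesgue_on K) f"
    using f K by (simp add: L1_loc_def)
  obtain C where C: "\<And>x. \<bar>\<psi> x\<bar> \<le> C"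
    using C0_infty_bounded[OF \<psi>] by metis
  have [measurable]: "\<psi> \<in> borel_measurable borel"
    using \<psi> by (auto intro: smooth_borel C0_infty_smooth)
  have "integrable (lebesgue_on K) (\<lambda>x. f x * \<psi> x)"
  proof (rule Bochner_Integration.integrable_bound)
    show "integrable (lebesgue_on K) (\<lambda>x. C * f x)"
      using fK by simp
    show "(\<lambda>x. f x * \<psi> x) \<in> borel_measurable (lebesgue_on K)"
      using fK
      by (intro borel_measurable_times borel_measurable_integrable[of "lebesgue_on K" f]
          measurable_restrict_space1 measurable_completion) auto
    have "\<bar>f y\<bar> * \<bar>\<psi> y\<bar> \<le> \<bar>C\<bar> * \<bar>f y\<bar>" for y
      using mult_left_mono[OF order_trans[OF C abs_ge_self], of "\<bar>f y\<bar>" y]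
      by (simp add: mult.commute)
    then show "AE x in lebesgue_on K. norm (f x * \<psi> x) \<le> norm (C * f x)"
      by (intro AE_I2) (simp add: abs_mult)
  qed
  moreover have "(\<lambda>x. indicat_real U x *\<^sub>R (f x * \<psi> x)) = (\<lambda>x. indicat_real K x *\<^sub>R (f x * \<psi> x))"
    using K(2,3) by (force simp: fun_eq_iff indicator_def)
  ultimately show ?thesis
    using U K(1) by (simp add: integrable_restrict_space compact_imp_closed)
qed

text \<open>Local integrability forces localisation: on a compact neighbourhood K' of K, f is
  replaced by a globally integrable Borel function, and test functions supported close to K do not
  leave K'. Countably many compact sets then exhaust U.\<close>

lemma L1_loc_AE_zero:
  fixes f :: "real^'n \<Rightarrow> real"
  assumes U: "open U" and f: "f \<in> L1_loc U"
    and orth: "\<And>\<psi>. \<psi> \<in> C0_infty U \<Longrightarrow> (LINT x|lebesgue_on U. f x * \<psi> x) = 0"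
  shows "AE x in lebesgue_on U. f x = 0"
proof -
  have K_zero: "AE x in lborel. x \<in> K \<longrightarrow> f x = 0" if K: "compact K" "K \<subseteq> U" for K
  proof -
    obtain e K' where e: "e > 0" and K': "compact K'" and sub: "K' \<subseteq> U"
      and K'_mem: "\<forall>y\<in>K. \<forall>x. dist y x \<le> e \<longrightarrow> x \<in> K'"
      using compact_neighbourhood[OF K(1) U K(2)] by blast
    have bK': "K' \<in> sets borel" "U \<in> sets borel"
      using K' U by (auto simp: compact_imp_closed)
    have fK': "integrable (lebesgue_on K') f"
      using f K' sub by (simp add: L1_loc_def)
    obtain g where g: "g \<in> borel_measurable borel" "\<And>x. x \<notin> K' \<Longrightarrow> g x = 0"
      "AE x in lebesgue_on K'. f x = g x"
      using borel_representative[OF bK'(1) borel_measurable_integrable[OF fK']] by blast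
    have gmeas: "g \<in> borel_measurable (lebesgue_on K')"
      using g(1) by (intro measurable_restrict_space1 measurable_completion) auto
    have "integrable (lebesgue_on K') g"
      using g(3) fK' gmeas by (subst integrable_cong_AE[of g _ f]) (auto elim: eventually_mono)
    then have gi: "integrable lborel g"
      using integral_lebesgue_on_borel(2)[OF bK'(1) g(1,2)] by simp
    have "AE x in lborel. x \<in> K \<longrightarrow> g x = 0"
    proof (rule AE_zero_if_orthogonal_to_test_functions[OF K(1) gi e])
      fix \<psi> :: "real^'n \<Rightarrow> real"
      assume \<psi>: "\<psi> \<in> C0_infty UNIV" "\<And>x. \<psi> x \<noteq> 0 \<Longrightarrow> \<exists>y\<in>K. dist y x \<le> e"
      have \<psi>0: "\<psi> x = 0" if "x \<notin> K'" for x
        using that \<psi>(2) K'_mem by blast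
      have [measurable]: "\<psi> \<in> borel_measurable borel"
        using \<psi>(1) by (auto intro: smooth_borel C0_infty_smooth)
      have "\<psi> \<in> C0_infty U"
        using \<psi>(1) K' sub \<psi>0 by (intro C0_inftyI[of _ K']) (auto intro: C0_infty_smooth)
      then have "0 = (LINT x|lebesgue_on U. f x * \<psi> x)"
        by (simp add: orth)
      also have "\<dots> = (LINT x|lebesgue_on K'. f x * \<psi> x)"
        using bK' sub \<psi>0 by (intro integral_lebesgue_on_mono) auto
      also have "\<dots> = (LINT x|lebesgue_on K'. g x * \<psi> x)"
      proof (rule integral_cong_AE)
        have "\<psi> \<in> borel_measurable (lebesgue_on K')"
          by (intro measurable_restrict_space1 measurable_completion) auto
        then show "(\<lambda>x. f x * \<psi> x) \<in> borel_measurable (lebesgue_on K')"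
          "(\<lambda>x. g x * \<psi> x) \<in> borel_measurable (lebesgue_on K')"
          using fK' gmeas by auto
        show "AE x in lebesgue_on K'. f x * \<psi> x = g x * \<psi> x"
          using g(3) by (rule eventually_mono) simp
      qed
      also have "\<dots> = (LINT x|lborel. g x * \<psi> x)"
        using bK'(1) g by (intro integral_lebesgue_on_borel(1)) auto
      finally show "(LINT x|lborel. g x * \<psi> x) = 0" by simp
    qed
    moreover have "AE x in lborel. x \<in> K' \<longrightarrow> f x = g x"
      using g(3) by (simp add: AE_lebesgue_on_iff_lborel[OF bK'(1)])
    ultimately show ?thesis
    proof eventually_elim
      case (elim x)
      then show ?case using K'_mem e by auto
    qed
  qed
  obtain C :: "nat \<Rightarrow> (real^'n) set" where C: "\<And>n. compact (C n)" "\<And>n. C n \<subseteq> U" "(\<Union>n. C n) = U"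
    using open_Union_compact_subsets[OF U] by metis
  have "AE x in lborel. \<forall>n. x \<in> C n \<longrightarrow> f x = 0"
    using K_zero C(1,2) by (subst AE_all_countable) blast
  then have "AE x in lborel. x \<in> U \<longrightarrow> f x = 0"
    by (rule eventually_mono) (use C(3) in blast)
  then show ?thesis
    using U by (simp add: AE_lebesgue_on_iff_lborel)
qed

lemma weak_deriv_unique:
  assumes U: "open U" and "has_weak_deriv U is u v" "has_weak_deriv U is u v'"
  shows "AE x in lebesgue_on U. v x = v' x"
proof -
  have v: "v \<in> L1_loc U" "v' \<in> L1_loc U"
    and eq: "\<And>\<psi>. \<psi> \<in> C0_infty U \<Longrightarrow> (LINT x|lebesgue_on U. v x * \<psi> x) = (LINT x|lebesgue_on U. v' x * \<psi> x)"
    using assms(2,3) unfolding has_weak_deriv_def by auto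
  have "AE x in lebesgue_on U. v x - v' x = 0"
  proof (rule L1_loc_AE_zero[OF U L1_loc_diff[OF v]])
    fix \<psi> assume \<psi>: "\<psi> \<in> C0_infty U"
    show "(LINT x|lebesgue_on U. (v x - v' x) * \<psi> x) = 0"
      using L1_loc_integrable_mult_test[OF U v(1) \<psi>] L1_loc_integrable_mult_test[OF U v(2) \<psi>] eq[OF \<psi>]
      by (simp add: left_diff_distrib)
  qed
  then show ?thesis by simp
qed

text \<open>\<open>weak_deriv\<close> picks an arbitrary candidate; uniqueness ties it to the square
  integrable one supplied by \<open>sobolev_H\<close>.\<close>

lemma weak_deriv_AE:
  assumes "open U" "has_weak_deriv U is u v"
  shows "AE x in lebesgue_on U. weak_deriv U is u x = v x"
  using weak_deriv_unique[OF assms(1) someI[of "has_weak_deriv U is u", OF assms(2)] assms(2)]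
  by (simp add: weak_deriv_def)

section \<open>Second-order Sobolev functions on the ball\<close>

lemma abs_powr_2: "\<bar>y\<bar> powr 2 = y\<^sup>2" for y :: real
  by (cases "y = 0") (simp_all add: powr_numeral)

lemma Lp_2_representative:
  fixes f :: "real^'n \<Rightarrow> real"
  assumes U: "U \<in> sets borel" and f: "f \<in> Lp U 2"
  shows "\<exists>f0. square_integrable f0 \<and> (AE x in lebesgue_on U. f x = f0 x) \<and>
    (\<forall>\<psi>\<in>borel_measurable borel. (LINT x|lebesgue_on U. f x * \<psi> x) = (LINT x|lborel. f0 x * \<psi> x))"
proof -
  have fm: "f \<in> borel_measurable (lebesgue_on U)" and fi: "integrable (lebesgue_on U) (\<lambda>x. (f x)\<^sup>2)"
    using f by (auto simp: Lp_def abs_powr_2)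
  obtain f0 where f0: "f0 \<in> borel_measurable borel" "\<And>x. x \<notin> U \<Longrightarrow> f0 x = 0"
    "AE x in lebesgue_on U. f x = f0 x"
    using borel_representative[OF U fm] by blast
  have m: "g \<in> borel_measurable (lebesgue_on U)" if "g \<in> borel_measurable borel" for g :: "real^'n \<Rightarrow> real"
    using that by (intro measurable_restrict_space1 measurable_completion) auto
  have "integrable (lebesgue_on U) (\<lambda>x. (f0 x)\<^sup>2)"
    using fi f0(1,3) fm by (subst integrable_cong_AE[of _ _ "\<lambda>x. (f x)\<^sup>2"])
      (auto elim: eventually_mono intro: m)
  then have "integrable lborel (\<lambda>x. (f0 x)\<^sup>2)"
    using f0 by (subst (asm) integral_lebesgue_on_borel(2)[OF U]) auto
  then have "square_integrable f0"
    using f0(1) by (simp add: square_integrable_def)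
  moreover have "(LINT x|lebesgue_on U. f x * \<psi> x) = (LINT x|lborel. f0 x * \<psi> x)"
    if \<psi>: "\<psi> \<in> borel_measurable borel" for \<psi>
  proof -
    have "(LINT x|lebesgue_on U. f x * \<psi> x) = (LINT x|lebesgue_on U. f0 x * \<psi> x)"
      using fm m[OF f0(1)] m[OF \<psi>] f0(3) by (intro integral_cong_AE) (auto elim: eventually_mono)
    also have "\<dots> = (LINT x|lborel. f0 x * \<psi> x)"
      using f0(1,2) \<psi> by (intro integral_lebesgue_on_borel(1)[OF U]) auto
    finally show ?thesis .
  qed
  ultimately show ?thesis
    using f0(3) by blast
qed

lemma C0_infty_borel: "\<psi> \<in> C0_infty U \<Longrightarrow> \<psi> \<in> borel_measurable borel"
  by (auto intro: smooth_borel C0_infty_smooth)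

lemma C0_infty_square_integrable:
  assumes "f \<in> C0_infty U"
  shows "square_integrable f"
  using C0_infty_integrable[OF C0_infty_mult_smooth[OF assms C0_infty_smooth[OF assms]]]
    C0_infty_borel[OF assms]
  by (simp add: square_integrable_def power2_eq_square)

lemma square_integrable_mult_test:
  assumes "square_integrable f" "\<psi> \<in> C0_infty U"
  shows "square_integrable (\<lambda>x. f x * \<psi> x)"
proof -
  obtain C where C: "\<And>x. \<bar>\<psi> x\<bar> \<le> C" using C0_infty_bounded[OF assms(2)] by metis
  from square_integrable_mult_bounded[OF assms(1) C0_infty_borel[OF assms(2)] C]
  show ?thesis by (simp add: mult.commute)
qed

text \<open>
  \<open>g i\<close> and \<open>h i\<close> are the weak first and pure second derivatives of \<open>u\<close> on the unit ball. The
  values of the three functions outside the ball play no role.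
\<close>

locale H2_ball =
  fixes u :: "real^'n \<Rightarrow> real" and g h :: "'n \<Rightarrow> real^'n \<Rightarrow> real"
  assumes sq: "square_integrable u" "square_integrable (g i)" "square_integrable (h i)"
    and first: "\<phi> \<in> C0_infty (ball 0 1) \<Longrightarrow>
      (LINT x|lborel. u x * partial i \<phi> x) = - (LINT x|lborel. g i x * \<phi> x)"
    and second: "\<phi> \<in> C0_infty (ball 0 1) \<Longrightarrow>
      (LINT x|lborel. u x * partial i (partial i \<phi>) x) = (LINT x|lborel. h i x * \<phi> x)"
begin

text \<open>The product \<zeta> u; \<open>D1\<close> and \<open>D2\<close> are what the product rule
  predicts for its derivatives, and \<open>D1_weak\<close> and \<open>D2_weak\<close> confirm it.
  For a compactly supported \<zeta> all three vanish outside a compact set and can be convolved on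
  the whole space.\<close>

definition D0 :: "(real^'n \<Rightarrow> real) \<Rightarrow> real^'n \<Rightarrow> real" where
  "D0 \<zeta> x = u x * \<zeta> x"

definition D1 :: "(real^'n \<Rightarrow> real) \<Rightarrow> 'n \<Rightarrow> real^'n \<Rightarrow> real" where
  "D1 \<zeta> i x = g i x * \<zeta> x + u x * partial i \<zeta> x"

definition D2 :: "(real^'n \<Rightarrow> real) \<Rightarrow> 'n \<Rightarrow> real^'n \<Rightarrow> real" where
  "D2 \<zeta> i x = h i x * \<zeta> x + 2 * (g i x * partial i \<zeta> x) + u x * partial i (partial i \<zeta>) x"

lemma D_square_integrable:
  assumes "\<zeta> \<in> C0_infty U"
  shows "square_integrable (D0 \<zeta>)" "square_integrable (D1 \<zeta> i)" "square_integrable (D2 \<zeta> i)"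
proof -
  note C = assms C0_infty_partial[OF assms] C0_infty_partial[OF C0_infty_partial[OF assms]]
  show "square_integrable (D0 \<zeta>)"
    unfolding D0_def[abs_def] by (rule square_integrable_mult_test[OF sq(1) C(1)])
  show "square_integrable (D1 \<zeta> i)"
    unfolding D1_def[abs_def]
    by (intro square_integrable_add square_integrable_mult_test[OF sq(2) C(1)]
        square_integrable_mult_test[OF sq(1) C(2)])
  show "square_integrable (D2 \<zeta> i)"
    unfolding D2_def[abs_def]
    by (intro square_integrable_add square_integrable_cmult square_integrable_mult_test[OF sq(3) C(1)]
        square_integrable_mult_test[OF sq(2) C(2)] square_integrable_mult_test[OF sq(1) C(3)])
qed

lemma D_zero:
  assumes "compact K" "\<And>x. x \<notin> K \<Longrightarrow> \<zeta> x = 0" "x \<notin> K"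
  shows "D0 \<zeta> x = 0" "D1 \<zeta> i x = 0" "D2 \<zeta> i x = 0"
proof -
  have 1: "partial i \<zeta> y = 0" if "y \<notin> K" for y
    using assms that by (intro partial_locally_zero[of "- K" y \<zeta> 0]) (auto simp: compact_imp_closed)
  have 2: "partial i (partial i \<zeta>) x = 0"
    using assms 1 by (intro partial_locally_zero[of "- K" x "partial i \<zeta>" 0]) (auto simp: compact_imp_closed)
  show "D0 \<zeta> x = 0" "D1 \<zeta> i x = 0" "D2 \<zeta> i x = 0"
    using assms 1 2 by (auto simp: D0_def D1_def D2_def)
qed

lemma D_integrable:
  assumes "\<zeta> \<in> C0_infty U"
  shows "integrable lborel (D0 \<zeta>)" "integrable lborel (D1 \<zeta> i)" "integrable lborel (D2 \<zeta> i)"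
proof -
  obtain K where K: "compact K" "\<And>x. x \<notin> K \<Longrightarrow> \<zeta> x = 0"
    using assms by (rule C0_inftyE) blast
  show "integrable lborel (D0 \<zeta>)" "integrable lborel (D1 \<zeta> i)" "integrable lborel (D2 \<zeta> i)"
    using D_zero[OF K] D_square_integrable[OF assms] K(1)
    by (auto intro: square_integrable_imp_integrable[of _ K] compact_imp_bounded)
qed

lemma integrable_test:
  assumes "\<psi> \<in> C0_infty U"
  shows "integrable lborel (\<lambda>x. u x * \<psi> x)" "integrable lborel (\<lambda>x. g i x * \<psi> x)"
    "integrable lborel (\<lambda>x. h i x * \<psi> x)"
  using Cauchy_Schwarz_integral(1)[OF sq(1) C0_infty_square_integrable[OF assms]]
    Cauchy_Schwarz_integral(1)[OF sq(2) C0_infty_square_integrable[OF assms]]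
    Cauchy_Schwarz_integral(1)[OF sq(3) C0_infty_square_integrable[OF assms]] by auto

text \<open>The cutoff supplies the compact support, so \<phi> may be any smooth function. This
  freedom is used with reflected kernels centred anywhere and with derivatives of mollified
  functions.\<close>

lemma D1_weak:
  assumes \<zeta>: "\<zeta> \<in> C0_infty (ball 0 1)" and \<phi>: "smooth \<phi>"
  shows "(LINT x|lborel. D0 \<zeta> x * partial i \<phi> x) = - (LINT x|lborel. D1 \<zeta> i x * \<phi> x)"
proof -
  have d: "\<And>x. \<zeta> differentiable (at x)" "\<And>x. \<phi> differentiable (at x)"
    using \<zeta> \<phi> by (auto intro: smooth_differentiable C0_infty_smooth)
  note C = C0_infty_mult_smooth[OF \<zeta> \<phi>] C0_infty_mult_smooth[OF \<zeta> smooth_partial[OF \<phi>]]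
    C0_infty_mult_smooth[OF C0_infty_partial[OF \<zeta>] \<phi>]
  note [simp] = integrable_test[OF C(1)] integrable_test[OF C(2)] integrable_test[OF C(3)]
  have "(LINT x|lborel. u x * partial i (\<lambda>x. \<zeta> x * \<phi> x) x) =
      (LINT x|lborel. u x * (\<zeta> x * partial i \<phi> x) + u x * (partial i \<zeta> x * \<phi> x))"
    by (simp add: partial_mult[OF d] distrib_left)
  then have "(LINT x|lborel. u x * (\<zeta> x * partial i \<phi> x)) + (LINT x|lborel. u x * (partial i \<zeta> x * \<phi> x)) =
      - (LINT x|lborel. g i x * (\<zeta> x * \<phi> x))"
    using first[OF C(1), of i] by simp
  moreover have "(LINT x|lborel. D1 \<zeta> i x * \<phi> x) =
      (LINT x|lborel. g i x * (\<zeta> x * \<phi> x) + u x * (partial i \<zeta> x * \<phi> x))"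
    by (simp add: D1_def distrib_right mult.assoc)
  ultimately show ?thesis by (simp add: D0_def mult.assoc)
qed

text \<open>The locale relates h to u, not to g. Testing with \<zeta> \<phi> at second order leaves
  the cross term 2 u \<partial>\<zeta> \<partial>\<phi>, and the first-order identity tested with
  (\<partial>\<zeta>) \<phi> converts it.\<close>

lemma D2_weak:
  assumes \<zeta>: "\<zeta> \<in> C0_infty (ball 0 1)" and \<phi>: "smooth \<phi>"
  shows "(LINT x|lborel. D0 \<zeta> x * partial i (partial i \<phi>) x) = (LINT x|lborel. D2 \<zeta> i x * \<phi> x)"
proof -
  note sm = C0_infty_smooth[OF \<zeta>] smooth_partial[OF C0_infty_smooth[OF \<zeta>]] \<phi> smooth_partial[OF \<phi>]
  note d = sm[THEN smooth_differentiable]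
  note dz = C0_infty_partial[OF \<zeta>]
  note C = C0_infty_mult_smooth[OF \<zeta> \<phi>] C0_infty_mult_smooth[OF \<zeta> smooth_partial[OF sm(4)]]
    C0_infty_mult_smooth[OF dz sm(4)] C0_infty_mult_smooth[OF C0_infty_partial[OF dz] \<phi>]
    C0_infty_mult_smooth[OF dz \<phi>]
  note [simp] = integrable_test[OF C(1)] integrable_test[OF C(2)] integrable_test[OF C(3)]
    integrable_test[OF C(4)] integrable_test[OF C(5)]
  have p: "partial i (\<lambda>x. \<zeta> x * \<phi> x) = (\<lambda>x. \<zeta> x * partial i \<phi> x + partial i \<zeta> x * \<phi> x)"
    by (rule partial_mult[OF d(1,3)])
  have "partial i (partial i (\<lambda>x. \<zeta> x * \<phi> x)) = (\<lambda>x. (\<zeta> x * partial i (partial i \<phi>) x +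
      partial i \<zeta> x * partial i \<phi> x) + (partial i \<zeta> x * partial i \<phi> x + partial i (partial i \<zeta>) x * \<phi> x))"
    unfolding p by (subst partial_add)
      (auto intro!: differentiable_mult d simp: partial_mult[OF d(1,4)] partial_mult[OF d(2,3)])
  then have "(LINT x|lborel. u x * partial i (partial i (\<lambda>x. \<zeta> x * \<phi> x)) x) =
      (LINT x|lborel. u x * (\<zeta> x * partial i (partial i \<phi>) x) + 2 * (u x * (partial i \<zeta> x * partial i \<phi> x)) +
        u x * (partial i (partial i \<zeta>) x * \<phi> x))"
    by (simp add: algebra_simps)
  then have 1: "(LINT x|lborel. u x * (\<zeta> x * partial i (partial i \<phi>) x)) +
      2 * (LINT x|lborel. u x * (partial i \<zeta> x * partial i \<phi> x)) +
      (LINT x|lborel. u x * (partial i (partial i \<zeta>) x * \<phi> x)) = (LINT x|lborel. h i x * (\<zeta> x * \<phi> x))"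
    using second[OF C(1), of i] by simp
  have "(LINT x|lborel. u x * partial i (\<lambda>x. partial i \<zeta> x * \<phi> x) x) =
      (LINT x|lborel. u x * (partial i \<zeta> x * partial i \<phi> x) + u x * (partial i (partial i \<zeta>) x * \<phi> x))"
    by (simp add: partial_mult[OF d(2,3)] distrib_left)
  then have 2: "(LINT x|lborel. u x * (partial i \<zeta> x * partial i \<phi> x)) +
      (LINT x|lborel. u x * (partial i (partial i \<zeta>) x * \<phi> x)) =
      - (LINT x|lborel. g i x * (partial i \<zeta> x * \<phi> x))"
    using first[OF C(5), of i] by simp
  have "(LINT x|lborel. D2 \<zeta> i x * \<phi> x) = (LINT x|lborel. h i x * (\<zeta> x * \<phi> x) +
      2 * (g i x * (partial i \<zeta> x * \<phi> x)) + u x * (partial i (partial i \<zeta>) x * \<phi> x))"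
    by (simp add: D2_def distrib_right mult.assoc)
  then show ?thesis using 1 2 by (simp add: D0_def mult.assoc)
qed

text \<open>Each derivative of \<open>\<psi> (x - y)\<close> in y brings a factor -1. At first order
  it cancels the sign of the integration by parts, at second order the two factors cancel each
  other.\<close>

lemma partial_conv_D0:
  assumes \<zeta>: "\<zeta> \<in> C0_infty (ball 0 1)" and \<psi>: "\<psi> \<in> C0_infty UNIV"
  shows "partial i (conv (D0 \<zeta>) \<psi>) = conv (D1 \<zeta> i) \<psi>"
    and "partial i (partial i (conv (D0 \<zeta>) \<psi>)) = conv (D2 \<zeta> i) \<psi>"
proof -
  note int = D_integrable(1)[OF \<zeta>]
  have sm: "smooth \<psi>" "smooth (partial i \<psi>)"
    using \<psi> by (auto intro: C0_infty_smooth smooth_partial)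
  have p1: "partial i (\<lambda>y. \<psi> (x - y)) = (\<lambda>y. (- 1) * partial i \<psi> (x - y))" for x
    using partial_affine[OF sm(1), of i x "- 1"] by simp
  have sm': "smooth (\<lambda>y. \<psi> (x - y))" "smooth (\<lambda>y. partial i \<psi> (x - y))" for x
    using smooth_affine[OF sm(1), of x "- 1"] smooth_affine[OF sm(2), of x "- 1"] by simp_all
  have p2: "partial i (partial i (\<lambda>y. \<psi> (x - y))) = (\<lambda>y. partial i (partial i \<psi>) (x - y))" for x
    unfolding p1 using partial_affine[OF sm(2), of i x "- 1"]
    by (subst partial_mult) (auto intro: smooth_differentiable[OF sm'(2)] simp: partial_const)
  have "partial i (conv (D0 \<zeta>) \<psi>) = conv (D0 \<zeta>) (partial i \<psi>)"
    by (rule partial_conv[OF int \<psi>])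
  also have "\<dots> = conv (D1 \<zeta> i) \<psi>"
    using D1_weak[OF \<zeta> sm'(1), of i] by (auto simp: fun_eq_iff conv_def p1)
  finally show "partial i (conv (D0 \<zeta>) \<psi>) = conv (D1 \<zeta> i) \<psi>" .
  have "partial i (partial i (conv (D0 \<zeta>) \<psi>)) = conv (D0 \<zeta>) (partial i (partial i \<psi>))"
    by (simp add: partial_conv[OF int \<psi>] partial_conv[OF int C0_infty_partial[OF \<psi>]])
  also have "\<dots> = conv (D2 \<zeta> i) \<psi>"
    using D2_weak[OF \<zeta> sm'(1), of i] by (auto simp: fun_eq_iff conv_def p2)
  finally show "partial i (partial i (conv (D0 \<zeta>) \<psi>)) = conv (D2 \<zeta> i) \<psi>" .
qed

text \<open>Formally this is integration by parts with \<phi> = \<partial>w for w = \<zeta> u. As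
  \<open>D1_weak\<close> asks for a smooth \<phi>, w is mollified in that place only, and
  \<open>L2_mollify\<close> removes the mollification on both sides.\<close>

lemma integral_D1_square:
  assumes \<zeta>: "\<zeta> \<in> C0_infty (ball 0 1)"
  shows "(LINT x|lborel. (D1 \<zeta> i x)\<^sup>2) = - (LINT x|lborel. D0 \<zeta> x * D2 \<zeta> i x)"
proof -
  obtain \<phi> :: "nat \<Rightarrow> real^'n \<Rightarrow> real" where \<phi>: "mollifier \<phi>" using ex_mollifier by blast
  note ker = mollifier_kernel[OF \<phi>]
  have C: "\<phi> k \<in> C0_infty UNIV" for k using ker by (simp add: kernel_def)
  note S = D_square_integrable[OF \<zeta>] and I = D_integrable[OF \<zeta>]
  have eq: "(LINT x|lborel. D0 \<zeta> x * conv (D2 \<zeta> i) (\<phi> k) x) =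
      - (LINT x|lborel. D1 \<zeta> i x * conv (D1 \<zeta> i) (\<phi> k) x)" for k
  proof -
    have "smooth (partial i (conv (D0 \<zeta>) (\<phi> k)))"
      by (intro smooth_partial smooth_conv[OF I(1) C])
    from D1_weak[OF \<zeta> this, of i, unfolded partial_conv_D0(2)[OF \<zeta> C]] show ?thesis
      by (simp only: partial_conv_D0(1)[OF \<zeta> C])
  qed
  have "(\<lambda>k. LINT x|lborel. D0 \<zeta> x * conv (D2 \<zeta> i) (\<phi> k) x) \<longlonglongrightarrow> (LINT x|lborel. D0 \<zeta> x * D2 \<zeta> i x)"
    by (intro L2_tendsto_integral_mult L2_mollify[OF \<phi>] square_integrable_conv ker S I)
  moreover have "(\<lambda>k. - (LINT x|lborel. D1 \<zeta> i x * conv (D1 \<zeta> i) (\<phi> k) x)) \<longlonglongrightarrow>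
      - (LINT x|lborel. D1 \<zeta> i x * D1 \<zeta> i x)"
    by (intro tendsto_minus L2_tendsto_integral_mult L2_mollify[OF \<phi>] square_integrable_conv ker S I)
  ultimately have "(LINT x|lborel. D0 \<zeta> x * D2 \<zeta> i x) = - (LINT x|lborel. D1 \<zeta> i x * D1 \<zeta> i x)"
    unfolding eq by (rule LIMSEQ_unique)
  then show ?thesis by (simp add: power2_eq_square)
qed

end

text \<open>The weak Laplacian is assembled from arbitrary choices of weak derivatives; here they
  are traded for one family of Borel functions on the whole space, so that \<open>H2_ball\<close>
  applies.\<close>

lemma sobolev_H_2_representatives:
  fixes u :: "real^'n \<Rightarrow> real"
  assumes u: "u \<in> sobolev_H 2 (ball 0 1)"
  obtains u0 g h where "H2_ball u0 g h"
    "AE x in lborel. x \<in> ball 0 1 \<longrightarrow> u x = u0 x"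
    "AE x in lborel. x \<in> ball 0 1 \<longrightarrow> weak_laplacian (ball 0 1) u x = (\<Sum>i\<in>UNIV. h i x)"
proof -
  have B: "ball (0::real^'n) 1 \<in> sets borel" "open (ball (0::real^'n) 1)" by auto
  have u2: "u \<in> Lp (ball 0 1) 2" using u by (simp add: sobolev_H_def)
  obtain u0 where u0: "square_integrable u0" "AE x in lebesgue_on (ball 0 1). u x = u0 x"
    "\<forall>\<psi>\<in>borel_measurable borel.
      (LINT x|lebesgue_on (ball 0 1). u x * \<psi> x) = (LINT x|lborel. u0 x * \<psi> x)"
    using Lp_2_representative[OF B(1) u2] by blast
  have rep: "\<exists>f0. square_integrable f0 \<and>
      (AE x in lebesgue_on (ball 0 1). weak_deriv (ball 0 1) is u x = f0 x) \<and>
      (\<forall>\<phi>\<in>C0_infty (ball 0 1). (LINT x|lborel. u0 x * partials is \<phi> x) =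
        (- 1) ^ length is * (LINT x|lborel. f0 x * \<phi> x))" if len: "length is \<le> 2" for "is"
  proof -
    obtain v where v: "v \<in> Lp (ball 0 1) 2" "has_weak_deriv (ball 0 1) is u v"
      using u len by (auto simp: sobolev_H_def)
    obtain f0 where f0: "square_integrable f0" "AE x in lebesgue_on (ball 0 1). v x = f0 x"
      "\<forall>\<psi>\<in>borel_measurable borel.
        (LINT x|lebesgue_on (ball 0 1). v x * \<psi> x) = (LINT x|lborel. f0 x * \<psi> x)"
      using Lp_2_representative[OF B(1) v(1)] by blast
    have "AE x in lebesgue_on (ball 0 1). weak_deriv (ball 0 1) is u x = f0 x"
      using weak_deriv_AE[OF B(2) v(2)] f0(2) by eventually_elim simp
    moreover have "(LINT x|lborel. u0 x * partials is \<phi> x) =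
        (- 1) ^ length is * (LINT x|lborel. f0 x * \<phi> x)"
      if \<phi>: "\<phi> \<in> C0_infty (ball 0 1)" for \<phi>
      using v(2) \<phi> u0(3)[rule_format, OF C0_infty_borel[OF C0_infty_partials[OF \<phi>]], of "is"]
        f0(3)[rule_format, OF C0_infty_borel[OF \<phi>]]
      by (auto simp: has_weak_deriv_def)
    ultimately show ?thesis using f0(1) by blast
  qed
  have "\<forall>i. \<exists>f0. square_integrable f0 \<and>
      (\<forall>\<phi>\<in>C0_infty (ball 0 1). (LINT x|lborel. u0 x * partial i \<phi> x) = - (LINT x|lborel. f0 x * \<phi> x))"
  proof
    fix i
    show "\<exists>f0. square_integrable f0 \<and> (\<forall>\<phi>\<in>C0_infty (ball 0 1).
        (LINT x|lborel. u0 x * partial i \<phi> x) = - (LINT x|lborel. f0 x * \<phi> x))"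
      using rep[of "[i]"] by auto
  qed
  then obtain g where g: "\<And>i. square_integrable (g i)"
    "\<And>i \<phi>. \<phi> \<in> C0_infty (ball 0 1) \<Longrightarrow> (LINT x|lborel. u0 x * partial i \<phi> x) = - (LINT x|lborel. g i x * \<phi> x)"
    by metis
  have "\<forall>i. \<exists>f0. square_integrable f0 \<and>
      (AE x in lebesgue_on (ball 0 1). weak_deriv (ball 0 1) [i, i] u x = f0 x) \<and>
      (\<forall>\<phi>\<in>C0_infty (ball 0 1). (LINT x|lborel. u0 x * partial i (partial i \<phi>) x) =
        (LINT x|lborel. f0 x * \<phi> x))"
  proof
    fix i
    show "\<exists>f0. square_integrable f0 \<and>
      (AE x in lebesgue_on (ball 0 1). weak_deriv (ball 0 1) [i, i] u x = f0 x) \<and>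
      (\<forall>\<phi>\<in>C0_infty (ball 0 1). (LINT x|lborel. u0 x * partial i (partial i \<phi>) x) =
        (LINT x|lborel. f0 x * \<phi> x))"
      using rep[of "[i, i]"] by simp
  qed
  from choice[OF this] obtain h where hh: "\<forall>i. square_integrable (h i) \<and>
      (AE x in lebesgue_on (ball 0 1). weak_deriv (ball 0 1) [i, i] u x = h i x) \<and>
      (\<forall>\<phi>\<in>C0_infty (ball 0 1). (LINT x|lborel. u0 x * partial i (partial i \<phi>) x) =
        (LINT x|lborel. h i x * \<phi> x))"
    by blast
  then have h: "\<And>i. square_integrable (h i)"
    "\<And>i. AE x in lebesgue_on (ball 0 1). weak_deriv (ball 0 1) [i, i] u x = h i x"
    "\<And>i \<phi>. \<phi> \<in> C0_infty (ball 0 1) \<Longrightarrow>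
      (LINT x|lborel. u0 x * partial i (partial i \<phi>) x) = (LINT x|lborel. h i x * \<phi> x)"
    by simp_all
  have "AE x in lebesgue_on (ball 0 1). \<forall>i. weak_deriv (ball 0 1) [i, i] u x = h i x"
    using h(2) by (simp add: eventually_all_finite)
  then have "AE x in lebesgue_on (ball 0 1). weak_laplacian (ball 0 1) u x = (\<Sum>i\<in>UNIV. h i x)"
    by (rule eventually_mono) (simp add: weak_laplacian_def)
  then have "AE x in lborel. x \<in> ball 0 1 \<longrightarrow> weak_laplacian (ball 0 1) u x = (\<Sum>i\<in>UNIV. h i x)"
    by (simp only: AE_lebesgue_on_iff_lborel[OF B(1)])
  moreover have "AE x in lborel. x \<in> ball 0 1 \<longrightarrow> u x = u0 x"
    using u0(2) by (simp only: AE_lebesgue_on_iff_lborel[OF B(1)])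
  moreover have "H2_ball u0 g h"
    using u0(1) g h(1,3) by (intro H2_ball.intro)
  ultimately show thesis using that by blast
qed

section \<open>The Carleman inequality for cut-off solutions\<close>

lemma Lp_norm_lborel:
  fixes f :: "real^'n \<Rightarrow> real"
  assumes "U \<in> sets borel" "f \<in> borel_measurable borel" "\<And>x. x \<notin> U \<Longrightarrow> f x = 0"
  shows "Lp_norm U t f = (LINT x|lborel. \<bar>f x\<bar> powr t) powr (1 / t)"
  using assms by (simp add: Lp_norm_def integral_lebesgue_on_borel(1))

lemma Lp_norm_cmult:
  fixes f :: "real^'n \<Rightarrow> real"
  assumes "c \<ge> 0" "t > 0"
  shows "Lp_norm U t (\<lambda>x. c * f x) = c * Lp_norm U t f"
proof -
  have "(LINT x|lebesgue_on U. norm (c * f x) powr t) = c powr t * (LINT x|lebesgue_on U. norm (f x) powr t)"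
    using assms by (simp add: abs_mult powr_mult)
  then show ?thesis
    using assms by (simp add: Lp_norm_def powr_mult powr_powr integral_nonneg_AE)
qed

text \<open>N / p = (N + 2) / 2 and 2 / p = (N + 2) / N are conjugate exponents, which is 1/p = 1/N
  + 1/2 in disguise. The prefactors in Young's inequality are below 1 and are dropped.\<close>

lemma Young_powr:
  fixes x y N p :: real
  assumes "0 \<le> x" "0 \<le> y" "N > 0" "p = 2 * N / (N + 2)"
  shows "(x * y) powr p \<le> x powr N + y\<^sup>2"
proof -
  have P: "(N + 2) / 2 > 1" "(N + 2) / N > 1" "1 / ((N + 2) / 2) + 1 / ((N + 2) / N) = 1"
    using assms(3) by (auto simp flip: add_divide_distrib)
  have "x powr p * y powr p \<le> (x powr p) powr ((N + 2) / 2) / ((N + 2) / 2) +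
      (y powr p) powr ((N + 2) / N) / ((N + 2) / N)"
    by (rule Youngs_inequality[OF P]) auto
  also have "(x powr p) powr ((N + 2) / 2) = x powr N"
    using assms by (simp add: powr_powr)
  also have "(y powr p) powr ((N + 2) / N) = y\<^sup>2"
  proof -
    have "p * ((N + 2) / N) = 2" using assms by simp
    then show ?thesis using abs_powr_2[of y] assms by (simp add: powr_powr)
  qed
  also have "x powr N / ((N + 2) / 2) \<le> x powr N"
    using divide_left_mono[of 1 "(N + 2) / 2" "x powr N"] P(1) by simp
  also have "y\<^sup>2 / ((N + 2) / N) \<le> y\<^sup>2"
    using divide_left_mono[of 1 "(N + 2) / N" "y\<^sup>2"] P(2) by simp
  finally show ?thesis using assms by (simp add: powr_mult)
qed

text \<open>The sum is at most three times its largest term, a comparison valid for every positive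
  p.\<close>

lemma powr_add3_le:
  fixes a b c p :: real
  assumes "p > 0"
  shows "\<bar>a + b + c\<bar> powr p \<le> 3 powr p * (\<bar>a\<bar> powr p + \<bar>b\<bar> powr p + \<bar>c\<bar> powr p)"
proof -
  define m where "m = max \<bar>a\<bar> (max \<bar>b\<bar> \<bar>c\<bar>)"
  have "\<bar>a + b + c\<bar> powr p \<le> (3 * m) powr p"
    using assms by (intro powr_mono2) (auto simp: m_def)
  also have "\<dots> = 3 powr p * m powr p"
    by (rule powr_mult)
  also have "m powr p \<le> \<bar>a\<bar> powr p + \<bar>b\<bar> powr p + \<bar>c\<bar> powr p"
    by (auto simp: m_def max_def)
  finally show ?thesis by simp
qed

text \<open>Splitting at height \<open>N\<close> replaces Hoelder's inequality here.\<close>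

lemma integral_square_le_powr:
  fixes f :: "real^'n \<Rightarrow> real"
  assumes r: "r \<ge> 2" and N: "N > 0" and f: "f \<in> borel_measurable borel" "\<And>x. \<bar>f x\<bar> \<le> C"
    and U: "U \<in> sets borel" "emeasure lborel U < \<infinity>" "\<And>x. x \<notin> U \<Longrightarrow> f x = 0"
    and le: "(LINT x|lborel. \<bar>f x\<bar> powr r) powr (1 / r) \<le> N"
  shows "(LINT x|lborel. (f x)\<^sup>2) \<le> N\<^sup>2 * (measure lborel U + 1)"
proof -
  have indU: "integrable lborel (indicator U :: real^'n \<Rightarrow> real)"
    using U by (intro integrable_real_indicator) auto
  have int: "integrable lborel (\<lambda>x. \<bar>f x\<bar> powr r)"
  proof (rule Bochner_Integration.integrable_bound)
    show "integrable lborel (\<lambda>x. C powr r * indicator U x)" using indU by simp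
    show "AE x in lborel. norm (\<bar>f x\<bar> powr r) \<le> norm (C powr r * indicator U x)"
      using f(2) U(3) r by (intro AE_I2) (auto simp: indicator_def intro: powr_mono2)
  qed (use f in simp)
  have "(LINT x|lborel. \<bar>f x\<bar> powr r) = ((LINT x|lborel. \<bar>f x\<bar> powr r) powr (1 / r)) powr r"
    using r by (simp add: powr_powr integral_nonneg_AE)
  also have "\<dots> \<le> N powr r"
    using le r by (intro powr_mono2) auto
  finally have le': "(LINT x|lborel. \<bar>f x\<bar> powr r) \<le> N powr r" .
  \<comment> \<open>The norm bound N doubles as the splitting height. Above it, 2 - r \<le> 0 allows
    |f|^(2-r) \<le> N^(2-r), and each part ends up as a multiple of N^2.\<close>
  have pw: "(f x)\<^sup>2 \<le> N\<^sup>2 * indicator U x + N powr (2 - r) * \<bar>f x\<bar> powr r" for x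
  proof -
    consider "x \<notin> U" | "x \<in> U" "\<bar>f x\<bar> \<le> N" | "\<bar>f x\<bar> > N" by linarith
    then show ?thesis
    proof cases
      case 2
      then have "(f x)\<^sup>2 \<le> N\<^sup>2" using N by (simp add: abs_le_square_iff[symmetric])
      moreover have "0 \<le> N powr (2 - r) * \<bar>f x\<bar> powr r" by simp
      ultimately have "(f x)\<^sup>2 \<le> N\<^sup>2 + N powr (2 - r) * \<bar>f x\<bar> powr r" by linarith
      then show ?thesis using 2 by simp
    next
      case 3
      have "(f x)\<^sup>2 = \<bar>f x\<bar> powr (2 - r) * \<bar>f x\<bar> powr r"
        using abs_powr_2[of "f x"] by (simp flip: powr_add)
      also have "\<dots> \<le> N powr (2 - r) * \<bar>f x\<bar> powr r"
        using 3 N r by (intro mult_right_mono powr_mono2') auto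
      also have "\<dots> \<le> N\<^sup>2 * indicator U x + N powr (2 - r) * \<bar>f x\<bar> powr r"
        by simp
      finally show ?thesis .
    qed (simp add: U(3))
  qed
  have "(LINT x|lborel. (f x)\<^sup>2) \<le> (LINT x|lborel. N\<^sup>2 * indicator U x + N powr (2 - r) * \<bar>f x\<bar> powr r)"
    using pw indU int by (intro integral_mono') auto
  also have "\<dots> = N\<^sup>2 * measure lborel U + N powr (2 - r) * (LINT x|lborel. \<bar>f x\<bar> powr r)"
    using indU int by simp
  also have "\<dots> \<le> N\<^sup>2 * measure lborel U + N powr (2 - r) * N powr r"
    using le' by (intro add_left_mono mult_left_mono) auto
  also have "N powr (2 - r) * N powr r = N\<^sup>2"
    using N abs_powr_2[of N] by (simp flip: powr_add)
  finally show ?thesis by (simp add: algebra_simps)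
qed

text \<open>Cauchy-Schwarz for |q|^(n/2) against the indicator of the ball bounds the norm of
  exponent n/2 by the one of exponent n times |B|^(1/n); the factor in \<open>potentials\<close> is
  made to cancel this volume.\<close>

lemma potential_in_closed_ball_Ln2:
  fixes q :: "real^'n \<Rightarrow> real"
  assumes q: "q \<in> potentials r0 \<theta>" "q \<in> borel_measurable borel" "\<And>x. x \<notin> ball 0 1 \<Longrightarrow> q x = 0"
  shows "q \<in> closed_ball_Ln2 r0" and "integrable lborel (\<lambda>x. \<bar>q x\<bar> powr CARD('n))"
proof -
  define N where "N = real CARD('n)"
  have N: "N > 0" by (simp add: N_def)
  define B where "B = ball (0::real^'n) 1"
  have B: "B \<in> sets borel" "emeasure lborel B < \<infinity>"
    using emeasure_bounded_finite[of B] by (auto simp: B_def)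
  have Bpos: "measure lborel B > 0"
    using content_ball_pos[of 1 "0::real^'n"] by (simp add: B_def)
  have qL: "q \<in> Lp B N" "Lp_norm B N q \<le> measure lebesgue B powr (- 1 / N) * min r0 \<theta>"
    using q(1) by (auto simp: potentials_def B_def N_def)
  have qz: "\<And>x. x \<notin> B \<Longrightarrow> q x = 0" using q(3) by (simp add: B_def)
  have qN: "integrable lborel (\<lambda>x. \<bar>q x\<bar> powr N)"
    using qL(1) q(2) qz by (subst (asm) Lp_def) (auto simp: integral_lebesgue_on_borel(2)[OF B(1)])
  then show "integrable lborel (\<lambda>x. \<bar>q x\<bar> powr CARD('n))"
    by (simp add: N_def)
  have sq: "(\<bar>q x\<bar> powr (N / 2))\<^sup>2 = \<bar>q x\<bar> powr N" for x
    using abs_powr_2[of "\<bar>q x\<bar> powr (N / 2)"] by (simp add: powr_powr)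
  have ind2: "(indicator B x :: real)\<^sup>2 = indicator B x" for x
    by (simp add: indicator_def)
  have S: "square_integrable (\<lambda>x. \<bar>q x\<bar> powr (N / 2))" "square_integrable (indicator B :: real^'n \<Rightarrow> real)"
    using qN q(2) B by (auto simp: square_integrable_def sq ind2)
  have ind: "\<bar>q x\<bar> powr (N / 2) * indicator B x = \<bar>q x\<bar> powr (N / 2)" for x
    using qz[of x] by (auto simp: indicator_def)
  have int2: "integrable lborel (\<lambda>x. \<bar>q x\<bar> powr (N / 2))"
    using Cauchy_Schwarz_integral(1)[OF S] by (simp add: ind)
  have CS: "(LINT x|lborel. \<bar>q x\<bar> powr (N / 2))\<^sup>2 \<le> (LINT x|lborel. \<bar>q x\<bar> powr N) * measure lborel B"
    using Cauchy_Schwarz_integral(2)[OF S] B by (simp add: ind ind2 sq)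
  have "Lp_norm B (N / 2) q = (LINT x|lborel. \<bar>q x\<bar> powr (N / 2)) powr (2 * (1 / N))"
    using Lp_norm_lborel[OF B(1) q(2) qz, of "N / 2"] by simp
  also have "\<dots> = ((LINT x|lborel. \<bar>q x\<bar> powr (N / 2))\<^sup>2) powr (1 / N)"
    unfolding powr_powr[symmetric]
    using abs_powr_2[of "LINT x|lborel. \<bar>q x\<bar> powr (N / 2)"] by (simp add: integral_nonneg_AE)
  also have "\<dots> \<le> ((LINT x|lborel. \<bar>q x\<bar> powr N) * measure lborel B) powr (1 / N)"
    using CS N by (intro powr_mono2) auto
  also have "\<dots> = Lp_norm B N q * measure lborel B powr (1 / N)"
    using Lp_norm_lborel[OF B(1) q(2) qz, of N] by (simp add: powr_mult integral_nonneg_AE)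
  also have "\<dots> \<le> (measure lborel B powr (- 1 / N) * min r0 \<theta>) * measure lborel B powr (1 / N)"
    using qL(2) B(1) by (intro mult_right_mono) auto
  also have "\<dots> = min r0 \<theta>"
    using Bpos by (simp add: powr_minus divide_simps flip: minus_divide_left)
  finally have "Lp_norm B (N / 2) q \<le> r0" by simp
  moreover have "q \<in> Lp B (N / 2)"
  proof -
    have "q \<in> borel_measurable (lebesgue_on B)"
      using q(2) by (intro measurable_restrict_space1 measurable_completion) auto
    moreover have "integrable (lebesgue_on B) (\<lambda>x. \<bar>q x\<bar> powr (N / 2))"
      using int2 q(2) qz by (subst integral_lebesgue_on_borel(2)[OF B(1)]) auto
    ultimately show ?thesis by (simp add: Lp_def)
  qed
  ultimately show "q \<in> closed_ball_Ln2 r0"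
    by (simp add: closed_ball_Ln2_def B_def N_def)
qed


text \<open>The expression \<open>\<Delta>(\<zeta> u) - \<zeta> \<Delta>u\<close>, free of second
  derivatives of u and zero wherever \<zeta> is locally constant.\<close>

definition (in H2_ball) commutator :: "(real^'n \<Rightarrow> real) \<Rightarrow> real^'n \<Rightarrow> real" where
  "commutator \<zeta> x = (\<Sum>i\<in>UNIV. 2 * (g i x * partial i \<zeta> x) + u x * partial i (partial i \<zeta>) x)"

lemma (in H2_ball) commutator_square_integrable:
  assumes "\<zeta> \<in> C0_infty U"
  shows "square_integrable (commutator \<zeta>)"
  unfolding commutator_def[abs_def]
  by (intro square_integrable_sum square_integrable_add square_integrable_cmult
      square_integrable_mult_test[OF sq(2) C0_infty_partial[OF assms]]
      square_integrable_mult_test[OF sq(1) C0_infty_partial[OF C0_infty_partial[OF assms]]]) simp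

lemma (in H2_ball) commutator_locally_constant:
  assumes "open S" "x \<in> S" "\<And>y. y \<in> S \<Longrightarrow> \<zeta> y = c"
  shows "commutator \<zeta> x = 0"
proof -
  have 1: "partial i \<zeta> y = 0" if "y \<in> S" for i y
    using assms(1) that assms(3) by (rule partial_locally_zero)
  then have "partial i (partial i \<zeta>) x = 0" for i
    using assms(1,2) by (intro partial_locally_zero[of S x "partial i \<zeta>" 0])
  then show ?thesis using 1[OF assms(2)] by (simp add: commutator_def)
qed

lemma (in H2_ball) commutator_diff:
  assumes "smooth \<zeta>" "smooth \<xi>"
  shows "commutator (\<lambda>x. \<zeta> x - \<xi> x) x = commutator \<zeta> x - commutator \<xi> x"
proof -
  have D: "partial i (\<lambda>x. f x - f' x) = (\<lambda>x. partial i f x - partial i f' x)"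
    if "smooth f" "smooth f'" for i and f f' :: "real^'n \<Rightarrow> real"
    using partial_eq[OF has_derivative_diff[OF smooth_has_derivative[OF that(1)]
          smooth_has_derivative[OF that(2)]]]
    by (auto simp: fun_eq_iff partial_def)
  show ?thesis
    using assms
    by (simp add: commutator_def D smooth_partial algebra_simps flip: sum_subtractf)
qed

text \<open>The bound depends on l, s and \<zeta> only through M, which later permits l to grow.
  Near the support of \<zeta> the singular weight is bounded, so the weighted mollification errors
  tend to 0 and one index k with errors below 1 suffices. In J, the power of 3 comes from splitting
  into three terms, the two volumes from y^p \<le> 1 + y^2, the 2 from the two errors and the
  integral of q from Young's inequality.\<close>

lemma (in H2_ball) carleman_commutator:
  fixes q :: "real^'n \<Rightarrow> real"
  assumes n: "CARD('n) \<ge> 3"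
    and q: "q \<in> borel_measurable borel" "\<And>x. x \<notin> ball 0 1 \<Longrightarrow> q x = 0"
      "integrable lborel (\<lambda>x. \<bar>q x\<bar> powr CARD('n))"
    and \<kappa>: "\<kappa> > 0" and carleman: "\<And>\<phi>. \<phi> \<in> C0_infty (ball (0::real^'n) 1 - {0}) \<Longrightarrow>
      Lp_norm (ball 0 1) (exp_p' TYPE('n)) (\<lambda>x. norm x powr (- l) * \<phi> x) \<le>
      \<kappa> * Lp_norm (ball 0 1) (exp_p TYPE('n)) (\<lambda>x. norm x powr (- l) * (laplacian \<phi> x + q x * \<phi> x))"
    and eqn: "AE x in lborel. x \<in> ball 0 1 \<longrightarrow> (\<Sum>i\<in>UNIV. h i x) + q x * u x = 0"
    and \<zeta>: "\<zeta> \<in> C0_infty (ball 0 1 - {0})" and s: "s > 0" and l: "l > 0"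
    and M: "(LINT x|lborel. (s * norm x powr (- l) * commutator \<zeta> x)\<^sup>2) \<le> M"
    and J: "J = 3 powr exp_p TYPE('n) * (2 * measure lborel (ball (0::real^'n) 1) + 2 +
      (LINT x|lborel. \<bar>q x\<bar> powr CARD('n)) + M)"
  shows "(LINT x|lborel. (s * norm x powr (- l) * (u x * \<zeta> x))\<^sup>2) \<le>
    2 * ((\<kappa> * J powr (1 / exp_p TYPE('n)))\<^sup>2 * (measure lborel (ball (0::real^'n) 1) + 1)) + 1"
proof -
  define B where "B = ball (0::real^'n) 1"
  define N p p' where "N = real CARD('n)" and "p = exp_p TYPE('n)" and "p' = exp_p' TYPE('n)"
  define W where "W = (\<lambda>x::real^'n. s * norm x powr (- l))"
  have N: "N \<ge> 3" using n by (simp add: N_def)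
  have p_eq: "p = 2 * N / (N + 2)" and p'_eq: "p' = 2 * N / (N - 2)"
    by (simp_all add: p_def p'_def N_def exp_p_def exp_p'_def)
  have p: "p > 0" and p': "p' \<ge> 2"
    using N by (auto simp: p_eq p'_eq field_simps)
  have B: "B \<in> sets borel" "emeasure lborel B < \<infinity>"
    using emeasure_bounded_finite[of B] by (auto simp: B_def)
  have indB: "integrable lborel (indicator B :: real^'n \<Rightarrow> real)"
    using B by (intro integrable_real_indicator) auto
  have qz: "\<And>x. x \<notin> B \<Longrightarrow> q x = 0" using q(2) by (simp add: B_def)
  have qN: "integrable lborel (\<lambda>x. \<bar>q x\<bar> powr N)" using q(3) by (simp add: N_def)
  have W0: "0 \<le> W x" for x using s by (simp add: W_def)
  have Wm [measurable]: "W \<in> borel_measurable borel" by (simp add: W_def)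
  note [measurable] = q(1)
  have \<zeta>B: "\<zeta> \<in> C0_infty (ball 0 1)" using \<zeta> by (rule C0_infty_mono[rotated]) auto
  obtain K where K: "compact K" "K \<subseteq> B - {0}" "\<And>x. x \<notin> K \<Longrightarrow> \<zeta> x = 0"
    using \<zeta> unfolding B_def by (rule C0_inftyE) blast
  have "open (B - {0})" by (auto simp: B_def)
  then obtain e Ke where e: "e > 0" and Ke: "compact Ke" and Ke_sub: "Ke \<subseteq> B - {0}"
    and Ke_mem: "\<forall>y\<in>K. \<forall>x. dist y x \<le> e \<longrightarrow> x \<in> Ke"
    using compact_neighbourhood[OF K(1) _ K(2)] by blast
  have K_Ke: "K \<subseteq> Ke" using Ke_mem e by auto
  obtain C where C: "\<And>x. x \<in> Ke \<Longrightarrow> W x \<le> C" "C > 0"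
  proof -
    have "continuous_on Ke W"
      unfolding W_def using Ke_sub by (intro continuous_intros) auto
    then have "bounded (W ` Ke)"
      using Ke compact_continuous_image compact_imp_bounded by blast
    then obtain C where "C > 0" "\<And>x. x \<in> Ke \<Longrightarrow> \<bar>W x\<bar> \<le> C"
      unfolding bounded_pos by auto
    then show thesis by (intro that[of C]) (auto intro: order_trans[OF abs_ge_self])
  qed
  have W_le: "(W x * f x)\<^sup>2 \<le> C\<^sup>2 * (f x)\<^sup>2" if "x \<notin> Ke \<Longrightarrow> f x = 0" for f :: "real^'n \<Rightarrow> real" and x
  proof (cases "x \<in> Ke")
    case True
    then have "(W x)\<^sup>2 \<le> C\<^sup>2" using C(1) W0 by (intro power_mono) auto
    then show ?thesis by (simp add: power_mult_distrib mult_right_mono)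
  qed (simp add: that)
  have W_sq: "square_integrable (\<lambda>x. W x * f x)"
      "(LINT x|lborel. (W x * f x)\<^sup>2) \<le> C\<^sup>2 * (LINT x|lborel. (f x)\<^sup>2)"
    if f: "square_integrable f" "\<And>x. x \<notin> Ke \<Longrightarrow> f x = 0" for f :: "real^'n \<Rightarrow> real"
  proof -
    have m [measurable]: "f \<in> borel_measurable borel" and i: "integrable lborel (\<lambda>x. C\<^sup>2 * (f x)\<^sup>2)"
      using f(1) by (auto simp: square_integrable_def)
    show "square_integrable (\<lambda>x. W x * f x)"
      unfolding square_integrable_def using W_le[of _ f] f(2)
      by (intro conjI Bochner_Integration.integrable_bound[OF i]) (auto intro!: AE_I2)
    have "(LINT x|lborel. (W x * f x)\<^sup>2) \<le> (LINT x|lborel. C\<^sup>2 * (f x)\<^sup>2)"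
      using W_le[of _ f] f(2) i by (intro integral_mono') auto
    then show "(LINT x|lborel. (W x * f x)\<^sup>2) \<le> C\<^sup>2 * (LINT x|lborel. (f x)\<^sup>2)" by simp
  qed
  define w S F where "w = D0 \<zeta>" and "S = (\<lambda>x. \<Sum>i\<in>UNIV. D2 \<zeta> i x)" and "F = commutator \<zeta>"
  have w: "square_integrable w" "integrable lborel w" and S: "square_integrable S" "integrable lborel S"
    unfolding w_def S_def using D_square_integrable[OF \<zeta>] D_integrable[OF \<zeta>]
    by (auto intro: square_integrable_sum)
  have [measurable]: "w \<in> borel_measurable borel" "S \<in> borel_measurable borel"
    using w S by (auto simp: square_integrable_def)
  have wz: "w x = 0" "S x = 0" if "x \<notin> K" for x
    unfolding w_def S_def using D_zero[OF K(1) K(3) that] by simp_all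
  have F: "square_integrable F"
    unfolding F_def by (rule commutator_square_integrable[OF \<zeta>])
  have [measurable]: "F \<in> borel_measurable borel"
    using F by (simp add: square_integrable_def)
  have Fz: "F x = 0" if "x \<notin> K" for x
    unfolding F_def using K that
    by (intro commutator_locally_constant[of "- K" x \<zeta> 0]) (auto simp: compact_imp_closed)
  have SF: "AE x in lborel. S x + q x * w x = F x"
    using eqn
  proof eventually_elim
    case (elim x)
    have S_eq: "S x = (\<Sum>i\<in>UNIV. h i x) * \<zeta> x + F x"
      by (simp add: S_def F_def D2_def commutator_def sum.distrib sum_distrib_right)
    show ?case
    proof (cases "x \<in> K")
      case True
      then have "(\<Sum>i\<in>UNIV. h i x) + q x * u x = 0" using elim K(2) by (auto simp: B_def)
      then have "((\<Sum>i\<in>UNIV. h i x) + q x * u x) * \<zeta> x = 0" by simp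
      then show ?thesis unfolding S_eq by (simp add: w_def D0_def algebra_simps)
    qed (simp add: wz Fz)
  qed
  obtain \<phi> :: "nat \<Rightarrow> real^'n \<Rightarrow> real" where \<phi>: "mollifier \<phi>" using ex_mollifier by blast
  note ker = mollifier_kernel[OF \<phi>]
  have C0: "\<phi> k \<in> C0_infty UNIV" for k using ker by (simp add: kernel_def)
  have wlim: "(\<lambda>k. C\<^sup>2 * (LINT x|lborel. (conv w (\<phi> k) x - w x)\<^sup>2)) \<longlonglongrightarrow> 0"
    and Slim: "(\<lambda>k. C\<^sup>2 * (LINT x|lborel. (conv S (\<phi> k) x - S x)\<^sup>2)) \<longlonglongrightarrow> 0"
    using L2_mollify[OF \<phi> w(2,1)] L2_mollify[OF \<phi> S(2,1)] by (auto intro: tendsto_mult_right_zero)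
  have "\<forall>\<^sub>F k in sequentially. 1 / real (Suc k) < e"
    using LIMSEQ_inverse_real_of_nat e by (auto simp: order_tendsto_iff inverse_eq_divide)
  \<comment> \<open>This error is doubled in the last estimate and becomes the final summand 1
    there.\<close>
  moreover have "\<forall>\<^sub>F k in sequentially. C\<^sup>2 * (LINT x|lborel. (conv w (\<phi> k) x - w x)\<^sup>2) < 1 / 2"
    using wlim by (intro order_tendstoD) auto
  moreover have "\<forall>\<^sub>F k in sequentially. C\<^sup>2 * (LINT x|lborel. (conv S (\<phi> k) x - S x)\<^sup>2) < 1"
    using Slim by (intro order_tendstoD) auto
  ultimately have "\<forall>\<^sub>F k in sequentially. 1 / real (Suc k) < e \<and>
      C\<^sup>2 * (LINT x|lborel. (conv w (\<phi> k) x - w x)\<^sup>2) < 1 / 2 \<and>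
      C\<^sup>2 * (LINT x|lborel. (conv S (\<phi> k) x - S x)\<^sup>2) < 1"
    by eventually_elim auto
  then obtain k where k: "1 / real (Suc k) < e"
    "C\<^sup>2 * (LINT x|lborel. (conv w (\<phi> k) x - w x)\<^sup>2) < 1 / 2"
    "C\<^sup>2 * (LINT x|lborel. (conv S (\<phi> k) x - S x)\<^sup>2) < 1"
    by (auto simp: eventually_sequentially)
  have cvz: "conv f (\<phi> k) x = 0" if "\<And>y. y \<notin> K \<Longrightarrow> f y = 0" "x \<notin> Ke" for f :: "real^'n \<Rightarrow> real" and x
    using that Ke_mem k(1) \<phi> by (intro conv_eq_zero[of K f e]) (force simp: mollifier_def)+
  define v where "v = conv w (\<phi> k)"
  have v: "v \<in> C0_infty (B - {0})"
    using smooth_conv[OF w(2) C0] Ke Ke_sub cvz[of w] wz(1)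
    by (intro C0_inftyI[of _ Ke]) (auto simp: v_def)
  have [measurable]: "v \<in> borel_measurable borel" using v by (rule C0_infty_borel)
  have lap: "laplacian v x = conv S (\<phi> k) x" for x
    unfolding laplacian_eq v_def w_def partial_conv_D0(2)[OF \<zeta>B C0] S_def
    by (rule conv_sum[symmetric, OF D_integrable(3)[OF \<zeta>] C0])
  have vz: "v x = 0" "conv S (\<phi> k) x = 0" if "x \<notin> Ke" for x
    using cvz[of w] cvz[of S] wz that by (auto simp: v_def)
  have wzKe: "w x = 0" "S x = 0" "F x = 0" if "x \<notin> Ke" for x
    using wz Fz that K_Ke by auto
  have [measurable]: "conv S (\<phi> k) \<in> borel_measurable borel"
    using smooth_conv[OF S(2) C0] by (rule smooth_borel)
  define a b where "a = (\<lambda>x. conv S (\<phi> k) x - S x)" and "b = (\<lambda>x. v x - w x)"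
  have ab: "square_integrable a" "square_integrable b"
    unfolding a_def b_def v_def using w S ker by (auto intro: square_integrable_diff square_integrable_conv)
  have abz: "a x = 0" "b x = 0" if "x \<notin> Ke" for x
    using that vz wzKe by (auto simp: a_def b_def)
  note Wa = W_sq[of a, OF ab(1) abz(1)] and Wb = W_sq[of b, OF ab(2) abz(2)]
    and WF = W_sq[of F, OF F wzKe(3)]
  have ints: "integrable lborel (\<lambda>x. (W x * a x)\<^sup>2)" "integrable lborel (\<lambda>x. (W x * b x)\<^sup>2)"
    "integrable lborel (\<lambda>x. (W x * F x)\<^sup>2)"
    using Wa(1) Wb(1) WF(1) by (auto simp: square_integrable_def)
  have MF: "(LINT x|lborel. (W x * F x)\<^sup>2) \<le> M"
    using M by (simp add: W_def F_def)
  define G where "G = (\<lambda>x. W x * (laplacian v x + q x * v x))"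
  have [measurable]: "G \<in> borel_measurable borel"
    by (simp add: G_def lap)
  \<comment> \<open>Pointwise majorant of \<open>\<bar>G x\<bar> powr p\<close>, with one bracket
    each for the mollification error of the Laplacian, for q times the error of w, and for the
    commutator.\<close>
  define R where "R = (\<lambda>x. 3 powr p * ((indicator B x + (W x * a x)\<^sup>2) + (\<bar>q x\<bar> powr N + (W x * b x)\<^sup>2) +
    (indicator B x + (W x * F x)\<^sup>2)))"
  have Rint: "integrable lborel R"
    unfolding R_def using ints indB qN by (intro integrable_mult_right Bochner_Integration.integrable_add)
  have small: "\<bar>y\<bar> powr p \<le> 1 + y\<^sup>2" for y
    using Young_powr[of 1 "\<bar>y\<bar>" N p] N p_eq by simp
  have GR: "AE x in lborel. \<bar>G x\<bar> powr p \<le> R x"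
    using SF
  proof eventually_elim
    case (elim x)
    show ?case
    proof (cases "x \<in> B")
      case True
      have qs: "\<bar>q x\<bar> * (sgn (q x) * y) = q x * y" for y
        by (simp add: mult.assoc[symmetric] abs_mult_sgn)
      \<comment> \<open>The equation turns S + q w into F, so q meets only the error b. The sign of
        q is shifted to the second factor, as \<open>Young_powr\<close> wants nonnegative
        arguments.\<close>
      have "G x = W x * a x + \<bar>q x\<bar> * (sgn (q x) * (W x * b x)) + W x * F x"
        unfolding elim[symmetric] qs by (simp add: G_def a_def b_def lap algebra_simps)
      then have "\<bar>G x\<bar> powr p \<le> 3 powr p * (\<bar>W x * a x\<bar> powr p +
          \<bar>\<bar>q x\<bar> * (sgn (q x) * (W x * b x))\<bar> powr p + \<bar>W x * F x\<bar> powr p)"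
        using powr_add3_le[OF p] by simp
      also have "\<bar>\<bar>q x\<bar> * (sgn (q x) * (W x * b x))\<bar> powr p \<le> \<bar>q x\<bar> powr N + (W x * b x)\<^sup>2"
      proof -
        have "(\<bar>q x\<bar> * \<bar>sgn (q x) * (W x * b x)\<bar>) powr p \<le> \<bar>q x\<bar> powr N + \<bar>sgn (q x) * (W x * b x)\<bar>\<^sup>2"
          using N p_eq by (intro Young_powr) auto
        also have "\<bar>sgn (q x) * (W x * b x)\<bar>\<^sup>2 \<le> (W x * b x)\<^sup>2"
          by (auto simp: sgn_if)
        finally show ?thesis by (simp add: abs_mult)
      qed
      also have "\<bar>W x * a x\<bar> powr p \<le> indicator B x + (W x * a x)\<^sup>2"
        using small True by simp
      also have "\<bar>W x * F x\<bar> powr p \<le> indicator B x + (W x * F x)\<^sup>2"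
        using small True by simp
      finally show ?thesis by (simp add: R_def mult_left_mono)
    next
      case False
      then have "x \<notin> Ke" using Ke_sub by auto
      then have "G x = 0" using vz by (simp add: G_def lap)
      then show ?thesis by (simp add: R_def)
    qed
  qed
  have GJ: "(LINT x|lborel. \<bar>G x\<bar> powr p) \<le> J"
  proof -
    have "(LINT x|lborel. \<bar>G x\<bar> powr p) \<le> (LINT x|lborel. R x)"
    proof (rule integral_mono_AE'[OF Rint GR])
      show "AE x in lborel. 0 \<le> R x" by (simp add: R_def)
    qed
    also have "\<dots> = 3 powr p * ((measure lborel B + (LINT x|lborel. (W x * a x)\<^sup>2)) +
        ((LINT x|lborel. \<bar>q x\<bar> powr N) + (LINT x|lborel. (W x * b x)\<^sup>2)) +
        (measure lborel B + (LINT x|lborel. (W x * F x)\<^sup>2)))"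
      unfolding R_def using ints indB qN by simp
    also have "\<dots> \<le> 3 powr p * ((measure lborel B + 1) + ((LINT x|lborel. \<bar>q x\<bar> powr N) + 1) +
        (measure lborel B + M))"
      using Wa(2) Wb(2) k(2,3) MF unfolding a_def b_def v_def
      by (intro mult_left_mono add_mono) auto
    also have "\<dots> = J"
      by (simp add: J p_def B_def N_def algebra_simps)
    finally show ?thesis .
  qed
  have Jpos: "J > 0"
  proof -
    have "0 \<le> M" using MF by (rule order_trans[rotated]) simp
    then have "0 < 2 * measure lborel B + 2 + (LINT x|lborel. \<bar>q x\<bar> powr N) + M"
      by (intro add_pos_nonneg add_nonneg_pos) (auto simp: integral_nonneg_AE)
    then show ?thesis by (simp add: J B_def N_def)
  qed
  have Gz: "G x = 0" if "x \<notin> B" for x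
  proof -
    have "x \<notin> Ke" using that Ke_sub by auto
    then show ?thesis using vz by (simp add: G_def lap)
  qed
  have Wvz: "W x * v x = 0" if "x \<notin> B" for x
  proof -
    have "x \<notin> Ke" using that Ke_sub by auto
    then show ?thesis using vz by simp
  qed
  have "Lp_norm B p' (\<lambda>x. norm x powr (- l) * v x) \<le>
      \<kappa> * Lp_norm B p (\<lambda>x. norm x powr (- l) * (laplacian v x + q x * v x))"
    using carleman[of v] v by (simp add: B_def p_def p'_def)
  then have "s * Lp_norm B p' (\<lambda>x. norm x powr (- l) * v x) \<le>
      s * (\<kappa> * Lp_norm B p (\<lambda>x. norm x powr (- l) * (laplacian v x + q x * v x)))"
    using s by (intro mult_left_mono) auto
  also have "\<dots> = \<kappa> * (s * Lp_norm B p (\<lambda>x. norm x powr (- l) * (laplacian v x + q x * v x)))"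
    by (simp add: mult.left_commute)
  also have "s * Lp_norm B p (\<lambda>x. norm x powr (- l) * (laplacian v x + q x * v x)) = Lp_norm B p G"
    using s p by (simp add: Lp_norm_cmult[symmetric] G_def W_def mult.assoc)
  also have "s * Lp_norm B p' (\<lambda>x. norm x powr (- l) * v x) = Lp_norm B p' (\<lambda>x. W x * v x)"
    using s p' by (simp add: Lp_norm_cmult[symmetric] W_def mult.assoc)
  also have "Lp_norm B p' (\<lambda>x. W x * v x) = (LINT x|lborel. \<bar>W x * v x\<bar> powr p') powr (1 / p')"
    using Wvz by (intro Lp_norm_lborel[OF B(1)]) auto
  also have "Lp_norm B p G = (LINT x|lborel. \<bar>G x\<bar> powr p) powr (1 / p)"
    using Gz by (intro Lp_norm_lborel[OF B(1)]) auto
  also have "\<kappa> * \<dots> \<le> \<kappa> * J powr (1 / p)"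
    using \<kappa> GJ p by (intro mult_left_mono powr_mono2) (auto simp: integral_nonneg_AE)
  finally have norm_le: "(LINT x|lborel. \<bar>W x * v x\<bar> powr p') powr (1 / p') \<le> \<kappa> * J powr (1 / p)" .
  obtain V where V: "\<And>x. \<bar>v x\<bar> \<le> V" using C0_infty_bounded[OF v] by metis
  have bd: "\<bar>W x * v x\<bar> \<le> C * V" for x
  proof (cases "x \<in> Ke")
    case True
    then show ?thesis using C V[of x] W0[of x] by (auto simp: abs_mult intro!: mult_mono)
  next
    case False
    have "0 \<le> V" using V[of x] by linarith
    then show ?thesis using vz(1)[OF False] C(2) by simp
  qed
  have Wv: "(LINT x|lborel. (W x * v x)\<^sup>2) \<le> (\<kappa> * J powr (1 / p))\<^sup>2 * (measure lborel B + 1)"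
    using \<kappa> Jpos Wvz bd by (intro integral_square_le_powr[OF p' _ _ bd B _ norm_le]) auto
  have "square_integrable v" using v by (rule C0_infty_square_integrable)
  then have Wvi: "integrable lborel (\<lambda>x. (W x * v x)\<^sup>2)"
    using W_sq(1)[of v] vz(1) by (auto simp: square_integrable_def)
  have "(LINT x|lborel. (W x * w x)\<^sup>2) \<le> (LINT x|lborel. 2 * (W x * v x)\<^sup>2 + 2 * (W x * b x)\<^sup>2)"
  proof (rule integral_mono')
    show "integrable lborel (\<lambda>x. 2 * (W x * v x)\<^sup>2 + 2 * (W x * b x)\<^sup>2)"
      using Wvi ints(2) by simp
    fix x
    have "(W x * w x)\<^sup>2 = (W x * v x - W x * b x)\<^sup>2"
      by (simp add: b_def algebra_simps)
    also have "\<dots> \<le> 2 * (W x * v x)\<^sup>2 + 2 * (W x * b x)\<^sup>2"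
      using zero_le_power2[of "W x * v x + W x * b x"] by (simp add: power2_diff power2_sum)
    finally show "(W x * w x)\<^sup>2 \<le> 2 * (W x * v x)\<^sup>2 + 2 * (W x * b x)\<^sup>2" .
  qed simp
  also have "\<dots> = 2 * (LINT x|lborel. (W x * v x)\<^sup>2) + 2 * (LINT x|lborel. (W x * b x)\<^sup>2)"
    using Wvi ints(2) by simp
  also have "\<dots> \<le> 2 * ((\<kappa> * J powr (1 / p))\<^sup>2 * (measure lborel B + 1)) + 1"
    using Wv Wb(2) k(2) by (simp add: b_def v_def)
  finally show ?thesis
    by (simp add: W_def w_def D0_def p_def B_def)
qed

section \<open>Decay of the gradient and conclusion\<close>

text \<open>These are the midpoints between consecutive points of the shifted integers. They form an
  unbounded sequence, along which l tends to infinity at the end.\<close>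

lemma Lambda_shifted:
  assumes "k > 0" "CARD('n::finite) \<ge> 2"
  shows "real k + (real CARD('n) - 2) / 2 + 1 / 2 \<in> Lambda TYPE('n)"
proof -
  define A where "A = {real k + (real CARD('n) - 2) / 2 | k :: nat. k > 0}"
  define l where "l = real k + (real CARD('n) - 2) / 2 + 1 / 2"
  have kA: "real k + (real CARD('n) - 2) / 2 \<in> A" using assms by (auto simp: A_def)
  have "infdist l A \<le> dist l (real k + (real CARD('n) - 2) / 2)"
    using kA by (rule infdist_le)
  then have "infdist l A \<le> 1 / 2" by (simp add: l_def dist_real_def)
  moreover have "1 / 2 \<le> infdist l A"
  proof -
    have "1 / 2 \<le> dist l a" if "a \<in> A" for a
    proof -
      obtain j :: nat where j: "a = real j + (real CARD('n) - 2) / 2" using \<open>a \<in> A\<close> by (auto simp: A_def)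
      have "dist l a = \<bar>real k - real j + 1 / 2\<bar>" by (simp add: l_def j dist_real_def)
      moreover have "1 / 2 \<le> \<bar>real k - real j + 1 / 2\<bar>"
      proof (cases "j \<le> k")
        case False
        then have "real j \<ge> real k + 1" by linarith
        then show ?thesis by linarith
      qed simp
      ultimately show ?thesis by simp
    qed
    then have "1 / 2 \<le> (INF a\<in>A. dist l a)"
      using kA by (intro cINF_greatest) auto
    then show ?thesis using kA by (auto simp: infdist_def)
  qed
  moreover have "l > 0"
  proof -
    have "0 \<le> (real CARD('n) - 2) / 2" using assms(2) by simp
    then show ?thesis using assms(1) unfolding l_def by linarith
  qed
  ultimately show ?thesis by (simp add: Lambda_def A_def l_def)
qed

section \<open>Energy in small balls and cutoffs at a given scale\<close>

definition energy :: "(real^'n \<Rightarrow> real) \<Rightarrow> real \<Rightarrow> real" where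
  "energy f r = (LINT x|lborel. indicator (ball 0 r) x * (f x)\<^sup>2)"

lemma energy_integrable:
  assumes "square_integrable f" "A \<in> sets borel"
  shows "integrable lborel (\<lambda>x. indicator A x * (f x)\<^sup>2)"
  using integrable_mult_indicator[of A lborel "\<lambda>x. (f x)\<^sup>2"] assms
  by (simp add: square_integrable_def)

lemma energy_nonneg: "0 \<le> energy f r"
  by (simp add: energy_def)

lemma square_sum_le:
  fixes f :: "'a \<Rightarrow> real"
  assumes "finite I"
  shows "(\<Sum>i\<in>I. f i)\<^sup>2 \<le> real (card I) * (\<Sum>i\<in>I. (f i)\<^sup>2)"
  using Cauchy_Schwarz_ineq_sum[of f "\<lambda>_. 1" I] assms by (simp add: mult.commute)

text \<open>Models one profile rescaled by e, with a single constant for all scales. The bound C /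
  e^2 is crude for first derivatives, but vanishing of infinite order absorbs any power of e, so a
  common bound for both orders is convenient.\<close>

definition cutoff_family :: "(real \<Rightarrow> real^'n \<Rightarrow> real) \<Rightarrow> real \<Rightarrow> bool" where
  "cutoff_family \<theta> C \<longleftrightarrow> C > 0 \<and> (\<forall>e>0. smooth (\<theta> e) \<and> (\<forall>x. \<bar>\<theta> e x\<bar> \<le> 1) \<and>
    (\<forall>x. norm x \<le> e \<longrightarrow> \<theta> e x = 1) \<and> (\<forall>x. norm x \<ge> 2 * e \<longrightarrow> \<theta> e x = 0) \<and>
    (e \<le> 1 \<longrightarrow> (\<forall>i x. \<bar>partial i (\<theta> e) x\<bar> \<le> C / e\<^sup>2 \<and>
      \<bar>partial i (partial i (\<theta> e)) x\<bar> \<le> C / e\<^sup>2)))"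

lemma cutoff_familyD:
  assumes "cutoff_family \<theta> C"
  shows "C > 0"
    and "e > 0 \<Longrightarrow> smooth (\<theta> e)"
    and "e > 0 \<Longrightarrow> \<bar>\<theta> e x\<bar> \<le> 1"
    and "e > 0 \<Longrightarrow> norm x \<le> e \<Longrightarrow> \<theta> e x = 1"
    and "e > 0 \<Longrightarrow> norm x \<ge> 2 * e \<Longrightarrow> \<theta> e x = 0"
    and "e > 0 \<Longrightarrow> e \<le> 1 \<Longrightarrow> \<bar>partial i (\<theta> e) x\<bar> \<le> C / e\<^sup>2"
    and "e > 0 \<Longrightarrow> e \<le> 1 \<Longrightarrow> \<bar>partial i (partial i (\<theta> e)) x\<bar> \<le> C / e\<^sup>2"
  using assms by (simp_all add: cutoff_family_def)

lemma ex_cutoff_family: "\<exists>(\<theta> :: real \<Rightarrow> real^'n \<Rightarrow> real) C. cutoff_family \<theta> C"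
proof -
  obtain v :: "real^'n \<Rightarrow> real" where v: "smooth v" "\<And>x. 0 \<le> v x" "\<And>x. v x \<le> 1"
    "\<And>x. norm x \<le> 1 \<Longrightarrow> v x = 1" "\<And>x. norm x \<ge> 2 \<Longrightarrow> v x = 0"
    using smooth_cutoff[of 1 2] by (metis one_less_numeral_iff semiring_norm(76) zero_less_one)
  have C0: "v \<in> C0_infty UNIV"
    using v by (intro C0_inftyI[of _ "cball 0 2"]) auto
  have "\<exists>C. \<forall>x. \<bar>partials is v x\<bar> \<le> C" for "is"
    using C0_infty_bounded[OF C0_infty_partials[OF C0]] by metis
  then obtain c where c: "\<And>is x. \<bar>partials is v x\<bar> \<le> c is" by metis
  define C where "C = (\<Sum>i\<in>UNIV. c [i] + c [i, i]) + 1"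
  have c0: "0 \<le> c is" for "is" using c[of "is" 0] by linarith
  have cC: "c [i] \<le> C" "c [i, i] \<le> C" for i
  proof -
    have "c [i] + c [i, i] \<le> (\<Sum>i\<in>UNIV. c [i] + c [i, i])"
      using c0 by (intro member_le_sum) auto
    then show "c [i] \<le> C" "c [i, i] \<le> C"
      using c0[of "[i]"] c0[of "[i, i]"] by (simp_all add: C_def)
  qed
  have C: "C > 0"
    using c0 by (simp add: C_def add_nonneg_pos sum_nonneg)
  \<comment> \<open>The summand 0 matches the pattern of \<open>partial_affine\<close> and
    \<open>smooth_affine\<close>.\<close>
  define \<theta> where "\<theta> = (\<lambda>e x. v (0 + (1 / e) *\<^sub>R x))"
  have p1: "partial i (\<theta> e) = (\<lambda>x. (1 / e) * partial i v (0 + (1 / e) *\<^sub>R x))" for e i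
    unfolding \<theta>_def by (rule partial_affine[OF v(1)])
  have sm: "smooth (\<lambda>x. partial i v (0 + (1 / e) *\<^sub>R x))" for i e
    by (rule smooth_affine[OF smooth_partial[OF v(1)]])
  have p2: "partial i (partial i (\<theta> e)) =
      (\<lambda>x. (1 / e\<^sup>2) * partial i (partial i v) (0 + (1 / e) *\<^sub>R x))" for e i
  proof -
    have "partial i (partial i (\<theta> e)) = (\<lambda>x. (1 / e) * partial i (\<lambda>x. partial i v (0 + (1 / e) *\<^sub>R x)) x +
        partial i (\<lambda>_. 1 / e) x * partial i v (0 + (1 / e) *\<^sub>R x))"
      unfolding p1 by (rule partial_mult) (rule smooth_differentiable[OF sm] differentiable_const)+
    then show ?thesis
      by (simp only: partial_affine[OF smooth_partial[OF v(1)]] partial_const)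
        (simp add: power2_eq_square)
  qed
  have b1: "\<bar>partial i (\<theta> e) x\<bar> \<le> C / e\<^sup>2" if e: "e > 0" "e \<le> 1" for e i x
  proof -
    have "e\<^sup>2 \<le> e" using e by (simp add: power2_eq_square mult_left_le)
    have "\<bar>partial i (\<theta> e) x\<bar> \<le> (1 / e) * C"
      using order_trans[OF c[of "[i]"] cC(1)[of i]] e unfolding p1 abs_mult by (intro mult_mono) auto
    also have "\<dots> \<le> (1 / e\<^sup>2) * C"
      using e C \<open>e\<^sup>2 \<le> e\<close> by (intro mult_right_mono divide_left_mono) auto
    finally show ?thesis by simp
  qed
  have b2: "\<bar>partial i (partial i (\<theta> e)) x\<bar> \<le> C / e\<^sup>2" if "e > 0" for e i x
  proof -
    have "\<bar>partial i (partial i (\<theta> e)) x\<bar> \<le> (1 / e\<^sup>2) * C"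
      using order_trans[OF c[of "[i, i]"] cC(2)[of i]] that unfolding p2 abs_mult by (intro mult_mono) auto
    then show ?thesis by simp
  qed
  have "smooth (\<theta> e)" for e
    unfolding \<theta>_def by (rule smooth_affine[OF v(1)])
  moreover have "\<theta> e x = 1" if "e > 0" "norm x \<le> e" for e x
    using that by (simp add: \<theta>_def v(4))
  moreover have "\<theta> e x = 0" if "e > 0" "norm x \<ge> 2 * e" for e x
    using that by (simp add: \<theta>_def v(5) field_simps)
  moreover have "\<bar>\<theta> e x\<bar> \<le> 1" for e x
    using v(2,3) by (simp add: \<theta>_def)
  ultimately have "cutoff_family \<theta> C"
    using C b1 b2 by (simp add: cutoff_family_def)
  then show ?thesis by blast
qed

text \<open>\<open>\<integral> D1\<^sup>2 = - \<integral> D0 D2\<close> with Cauchy--Schwarz transfers the decay of \<open>u\<close> to its gradient.\<close>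

lemma (in H2_ball) energy_gradient_le:
  "\<exists>A. \<forall>e i. 0 < e \<longrightarrow> e < 1 / 2 \<longrightarrow> (energy (g i) e)\<^sup>2 \<le> A / e ^ 4 * energy u (2 * e)"
proof -
  obtain \<theta> :: "real \<Rightarrow> real^'n \<Rightarrow> real" and C where cf: "cutoff_family \<theta> C"
    using ex_cutoff_family by blast
  note C = cutoff_familyD(1)[OF cf] and \<theta> = cutoff_familyD(2,4,5,3,6,7)[OF cf]
  define I where "I = (\<lambda>f :: real^'n \<Rightarrow> real. LINT x|lborel. (f x)\<^sup>2)"
  have I0: "0 \<le> I f" for f by (simp add: I_def)
  define S where "S = (\<Sum>i\<in>UNIV. I (h i) + I (g i) + I u)"
  have S: "I (h i) + I (g i) + I u \<le> S" for i
    unfolding S_def by (intro member_le_sum) (auto intro!: add_nonneg_nonneg I0)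
  \<comment> \<open>The 3 stems from \<open>square_add3_le\<close>, (1 + 2 C)^2 / e^4 is the square
    of the bound \<open>c\<close> below, and S collects norms that depend neither on e nor on
    i.\<close>
  define A where "A = 3 * (1 + 2 * C)\<^sup>2 * S"
  show ?thesis
  proof (intro exI[of _ A] allI impI)
    fix e :: real and i :: 'n
    assume e: "0 < e" "e < 1 / 2"
    have Z: "\<theta> e \<in> C0_infty (ball 0 1)"
      using \<theta>(1,3)[of e] e by (intro C0_inftyI[of _ "cball 0 (2 * e)"]) auto
    note SQ = D_square_integrable[OF Z]
    have e1: "1 \<le> 1 / e\<^sup>2" using e by (simp add: power_le_one)
    \<comment> \<open>One bound for |\<theta>|, for twice |\<partial>\<theta>| and for the second
      derivative; the first of these uses 1 \<le> 1 / e^2.\<close>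
    define c where "c = (1 + 2 * C) / e\<^sup>2"
    have c: "1 \<le> c" "2 * (C / e\<^sup>2) \<le> c" "C / e\<^sup>2 \<le> c"
    proof -
      have "c = 1 / e\<^sup>2 + 2 * (C / e\<^sup>2)" by (simp add: c_def add_divide_distrib)
      moreover have "0 \<le> C / e\<^sup>2" using C by simp
      ultimately show "1 \<le> c" "2 * (C / e\<^sup>2) \<le> c" "C / e\<^sup>2 \<le> c" using e1 by linarith+
    qed
    have sqb: "(f x * a)\<^sup>2 \<le> (f x)\<^sup>2 * c\<^sup>2" if "\<bar>a\<bar> \<le> c" for f :: "real^'n \<Rightarrow> real" and x a
      using that c(1) by (simp add: power_mult_distrib mult_left_mono abs_le_square_iff[symmetric])
    have pw: "(D2 (\<theta> e) i x)\<^sup>2 \<le> 3 * c\<^sup>2 * ((h i x)\<^sup>2 + (g i x)\<^sup>2 + (u x)\<^sup>2)" for x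
    proof -
      have "(D2 (\<theta> e) i x)\<^sup>2 \<le> 3 * ((h i x * \<theta> e x)\<^sup>2 + (g i x * (2 * partial i (\<theta> e) x))\<^sup>2 +
          (u x * partial i (partial i (\<theta> e)) x)\<^sup>2)"
        using square_add3_le[of "h i x * \<theta> e x" "g i x * (2 * partial i (\<theta> e) x)"]
        by (simp add: D2_def mult.left_commute)
      also have "\<dots> \<le> 3 * ((h i x)\<^sup>2 * c\<^sup>2 + (g i x)\<^sup>2 * c\<^sup>2 + (u x)\<^sup>2 * c\<^sup>2)"
        using c \<theta>(4)[of e x] \<theta>(5,6)[of e i x] e
        by (intro mult_left_mono add_mono sqb) (auto simp: abs_mult)
      finally show ?thesis by (simp add: algebra_simps)
    qed
    have "I (D2 (\<theta> e) i) \<le> (LINT x|lborel. 3 * c\<^sup>2 * ((h i x)\<^sup>2 + (g i x)\<^sup>2 + (u x)\<^sup>2))"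
      unfolding I_def using sq pw by (intro integral_mono') (auto simp: square_integrable_def)
    also have "\<dots> = 3 * c\<^sup>2 * (I (h i) + I (g i) + I u)"
      using sq by (simp add: I_def square_integrable_def)
    also have "\<dots> \<le> 3 * c\<^sup>2 * S"
      using S by (intro mult_left_mono) auto
    also have "\<dots> = A / e ^ 4"
      by (simp add: A_def c_def power_divide flip: power_mult)
    finally have D2: "I (D2 (\<theta> e) i) \<le> A / e ^ 4" .
    have D0: "I (D0 (\<theta> e)) \<le> energy u (2 * e)"
      unfolding I_def energy_def
    proof (intro integral_mono' energy_integrable sq(1))
      fix x
      have "(u x)\<^sup>2 * (\<theta> e x)\<^sup>2 \<le> (u x)\<^sup>2 * 1"
        using \<theta>(4)[OF e(1), of x] by (intro mult_left_mono) (auto simp: abs_square_le_1)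
      then show "(D0 (\<theta> e) x)\<^sup>2 \<le> indicator (ball 0 (2 * e)) x * (u x)\<^sup>2"
        using \<theta>(3)[of e x] e by (auto simp: D0_def indicator_def power_mult_distrib)
    qed auto
    have D1: "energy (g i) e \<le> I (D1 (\<theta> e) i)"
      unfolding I_def energy_def
    proof (rule integral_mono')
      show "integrable lborel (\<lambda>x. (D1 (\<theta> e) i x)\<^sup>2)"
        using SQ(2) by (simp add: square_integrable_def)
      fix x
      show "indicator (ball 0 e) x * (g i x)\<^sup>2 \<le> (D1 (\<theta> e) i x)\<^sup>2"
      proof (cases "x \<in> ball 0 e")
        case True
        then have "partial i (\<theta> e) x = 0"
          using \<theta>(2)[of e] e by (intro partial_locally_zero[of "ball 0 e" x _ 1]) auto
        then show ?thesis using True \<theta>(2)[of e x] e by (simp add: D1_def)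
      qed simp
    qed simp
    have "(energy (g i) e)\<^sup>2 \<le> (I (D1 (\<theta> e) i))\<^sup>2"
      using D1 energy_nonneg by (intro power_mono)
    also have "\<dots> \<le> I (D0 (\<theta> e)) * I (D2 (\<theta> e) i)"
      using Cauchy_Schwarz_integral(2)[OF SQ(1) SQ(3)] integral_D1_square[OF Z]
      by (simp add: I_def)
    also have "\<dots> \<le> energy u (2 * e) * (A / e ^ 4)"
      using D0 D2 by (intro mult_mono I0 energy_nonneg)
    finally show "(energy (g i) e)\<^sup>2 \<le> A / e ^ 4 * energy u (2 * e)"
      by (simp add: mult.commute)
  qed
qed

text \<open>Limits instead of bounds for all powers amount to the same, as one further power of r
  turns a bound into a limit; limits pass easily through sums and rescalings.\<close>

definition flat_at_0 :: "(real \<Rightarrow> real) \<Rightarrow> bool" where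
  "flat_at_0 E \<longleftrightarrow> (\<forall>m. ((\<lambda>r. E r / r ^ m) \<longlongrightarrow> 0) (at_right 0))"

lemma flat_at_0_scale:
  assumes "flat_at_0 E" "c > 0"
  shows "((\<lambda>r. E (c * r) / r ^ m) \<longlongrightarrow> 0) (at_right 0)"
proof -
  have "filterlim (\<lambda>r. c * r) (at_right 0) (at_right 0)"
    using assms(2) by (intro filterlim_times_pos[OF filterlim_ident]) auto
  then have "((\<lambda>r. E (c * r) / (c * r) ^ m) \<longlongrightarrow> 0) (at_right 0)"
    using assms(1) filterlim_compose[of "\<lambda>r. E r / r ^ m" "nhds 0" "at_right 0" "\<lambda>r. c * r" "at_right 0"]
    unfolding flat_at_0_def by simp
  then have "((\<lambda>r. c ^ m * (E (c * r) / (c * r) ^ m)) \<longlongrightarrow> 0) (at_right 0)"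
    by (rule tendsto_mult_right_zero)
  then show ?thesis using assms(2) by (simp add: power_mult_distrib)
qed

text \<open>Decay of the energy of u to order 4 + 2 m yields order m for the gradient: four powers
  are spent in \<open>energy_gradient_le\<close>, and the square root halves the rest.\<close>

lemma (in H2_ball) flat_gradient:
  assumes "flat_at_0 (energy u)"
  shows "flat_at_0 (energy (g i))"
  unfolding flat_at_0_def
proof
  fix m
  obtain A where A:
    "\<forall>e i. 0 < e \<longrightarrow> e < 1 / 2 \<longrightarrow> (energy (g i) e)\<^sup>2 \<le> A / e ^ 4 * energy u (2 * e)"
    using energy_gradient_le ..
  have "((\<lambda>r. A * (energy u (2 * r) / r ^ (4 + 2 * m))) \<longlongrightarrow> 0) (at_right 0)"
    by (intro tendsto_mult_right_zero flat_at_0_scale assms) simp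
  moreover have "\<forall>\<^sub>F r in at_right 0. (energy (g i) r / r ^ m)\<^sup>2 \<le> A * (energy u (2 * r) / r ^ (4 + 2 * m))"
    unfolding eventually_at_right_field
  proof (intro exI[of _ "1 / 2"] conjI allI impI)
    fix r :: real assume r: "0 < r" "r < 1 / 2"
    have "(energy (g i) r / r ^ m)\<^sup>2 = (energy (g i) r)\<^sup>2 / r ^ (2 * m)"
      by (simp add: power_divide mult.commute flip: power_mult)
    also have "\<dots> \<le> (A / r ^ 4 * energy u (2 * r)) / r ^ (2 * m)"
      using A[rule_format, OF r] r by (intro divide_right_mono) auto
    also have "\<dots> = A * (energy u (2 * r) / r ^ (4 + 2 * m))"
      by (simp add: power_add)
    finally show "(energy (g i) r / r ^ m)\<^sup>2 \<le> A * (energy u (2 * r) / r ^ (4 + 2 * m))" .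
  qed simp
  ultimately have "((\<lambda>r. (energy (g i) r / r ^ m)\<^sup>2) \<longlongrightarrow> 0) (at_right 0)"
    by (intro tendsto_sandwich[OF always_eventually[OF allI[OF zero_le_power2]] _ tendsto_const])
  from tendsto_real_sqrt[OF this]
  have "((\<lambda>r. \<bar>energy (g i) r / r ^ m\<bar>) \<longlongrightarrow> 0) (at_right 0)" by simp
  then show "((\<lambda>r. energy (g i) r / r ^ m) \<longlongrightarrow> 0) (at_right 0)"
    by (rule tendsto_rabs_zero_cancel)
qed


text \<open>Normalising the weight at radius \<rho> keeps the outer commutator bounded uniformly in
  l, while on the ball of radius r the weight is at least (\<rho> / r)^l. Since e is chosen after l,
  the energy is at most (r / \<rho>)^(2 l) K with K fixed before l.\<close>

lemma (in H2_ball) energy_eq_zero: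
  fixes q :: "real^'n \<Rightarrow> real"
  assumes n: "CARD('n) \<ge> 3"
    and q: "q \<in> borel_measurable borel" "\<And>x. x \<notin> ball 0 1 \<Longrightarrow> q x = 0"
      "integrable lborel (\<lambda>x. \<bar>q x\<bar> powr CARD('n))"
    and \<kappa>: "\<kappa> > 0" and carleman: "\<And>\<phi> l. \<phi> \<in> C0_infty (ball (0::real^'n) 1 - {0}) \<Longrightarrow>
      l \<in> Lambda TYPE('n) \<Longrightarrow>
      Lp_norm (ball 0 1) (exp_p' TYPE('n)) (\<lambda>x. norm x powr (- l) * \<phi> x) \<le>
      \<kappa> * Lp_norm (ball 0 1) (exp_p TYPE('n)) (\<lambda>x. norm x powr (- l) * (laplacian \<phi> x + q x * \<phi> x))"
    and eqn: "AE x in lborel. x \<in> ball 0 1 \<longrightarrow> (\<Sum>i\<in>UNIV. h i x) + q x * u x = 0"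
    and flat: "flat_at_0 (energy u)"
    and r: "0 < r" "r < \<rho>" "\<rho> < 1"
  shows "energy u r = 0"
proof -
  have \<rho>: "0 < \<rho>" "\<rho> < (1 + \<rho>) / 2" "(1 + \<rho>) / 2 < 1" using r by auto
  obtain v :: "real^'n \<Rightarrow> real" where v: "smooth v"
    "\<And>x. norm x \<le> \<rho> \<Longrightarrow> v x = 1" "\<And>x. norm x \<ge> (1 + \<rho>) / 2 \<Longrightarrow> v x = 0"
    using smooth_cutoff[OF \<rho>(1,2)] by metis
  have vC: "v \<in> C0_infty UNIV"
    using v by (intro C0_inftyI[of _ "cball 0 ((1 + \<rho>) / 2)"]) auto
  obtain \<theta> :: "real \<Rightarrow> real^'n \<Rightarrow> real" and C where cf: "cutoff_family \<theta> C"
    using ex_cutoff_family by blast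
  note C = cutoff_familyD(1)[OF cf]
  define X where "X = commutator v"
  have X: "square_integrable X"
    unfolding X_def by (rule commutator_square_integrable[OF vC])
  \<comment> \<open>Contributions of the outer commutator and of the inner one, whose weighted
    square integral the choice of e pushes below 1, each doubled by (a - b)^2 \<le> 2 a^2 + 2
    b^2.\<close>
  define M where "M = 2 * (LINT x|lborel. (X x)\<^sup>2) + 2"
  define J where "J = 3 powr exp_p TYPE('n) * (2 * measure lborel (ball (0::real^'n) 1) + 2 +
      (LINT x|lborel. \<bar>q x\<bar> powr CARD('n)) + M)"
  define K where "K = 2 * ((\<kappa> * J powr (1 / exp_p TYPE('n)))\<^sup>2 *
      (measure lborel (ball (0::real^'n) 1) + 1)) + 1"
  have K: "K \<ge> 0" by (simp add: K_def)
  have main: "energy u r \<le> (r / \<rho>) powr (2 * l) * K" if l: "l \<in> Lambda TYPE('n)" for l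
  proof (rule field_le_epsilon)
    \<comment> \<open>The tolerance d pays for the ball of radius 3 e, in which the cutoff may
      remove u; e is chosen depending on d and l.\<close>
    fix d :: real assume d: "d > 0"
    have l0: "l > 0" using l by (simp add: Lambda_def)
    \<comment> \<open>Makes the weight at most 1 for |x| \<ge> \<rho>, where the commutator of v
      lives.\<close>
    define s where "s = \<rho> powr l"
    have s: "s > 0" using \<rho> by (simp add: s_def)
    define W where "W = (\<lambda>x::real^'n. s * norm x powr (- l))"
    have W0: "0 \<le> W x" for x using s by (simp add: W_def)
    \<comment> \<open>e^(-2 l) comes from the squared weight and e^(-4) from the squared cutoff
      derivatives; m covers both.\<close>
    obtain m where m: "2 * l + 4 \<le> real m" using real_arch_simple by blast
    define H where "H = (\<lambda>x. \<Sum>i\<in>UNIV. (g i x)\<^sup>2 + (u x)\<^sup>2)"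
    \<comment> \<open>Radius 3 e instead of 2 e: a point with |x| \<ge> 3 e has an open
      neighbourhood on which \<open>\<theta> e\<close> is 0, so the inner commutator vanishes there
      by local constancy.\<close>
    define E where "E = (\<lambda>e. \<Sum>i\<in>UNIV. energy (g i) (3 * e) + energy u (3 * e))"
    \<comment> \<open>The dimension comes from \<open>square_sum_le\<close>, 8 C^2 from squaring the
      two terms of the commutator, s^2 from the weight.\<close>
    define D where "D = real CARD('n) * (8 * C\<^sup>2) * s\<^sup>2"
    have HE: "integrable lborel (\<lambda>x. indicator (ball 0 (3 * e)) x * H x)"
      "(LINT x|lborel. indicator (ball 0 (3 * e)) x * H x) = E e" for e
      using energy_integrable[OF sq(1), of "ball 0 (3 * e)"] energy_integrable[OF sq(2), of "ball 0 (3 * e)"]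
      by (simp_all add: H_def E_def energy_def sum_distrib_left distrib_left)
    have "((\<lambda>e. \<Sum>i\<in>(UNIV::'n set). energy (g i) (3 * e) / e ^ m + energy u (3 * e) / e ^ m)
        \<longlongrightarrow> (\<Sum>i\<in>(UNIV::'n set). 0 + 0)) (at_right 0)"
      by (intro tendsto_sum tendsto_add flat_at_0_scale flat_gradient flat) auto
    then have "((\<lambda>e. E e / e ^ m) \<longlongrightarrow> 0) (at_right 0)"
      by (simp add: E_def sum_divide_distrib add_divide_distrib)
    then have "((\<lambda>e. D * (E e / e ^ m)) \<longlongrightarrow> 0) (at_right 0)"
      by (rule tendsto_mult_right_zero)
    then have "\<forall>\<^sub>F e in at_right 0. D * (E e / e ^ m) < 1"
      by (rule order_tendstoD) simp
    moreover have "((\<lambda>e. energy u (3 * e) / e ^ 0) \<longlongrightarrow> 0) (at_right 0)"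
      using flat by (rule flat_at_0_scale) simp
    then have "\<forall>\<^sub>F e in at_right 0. energy u (3 * e) / e ^ 0 < d"
      using d by (rule order_tendstoD)
    moreover have "\<forall>\<^sub>F e in at_right 0. 0 < e \<and> e < r / 3"
      using r(1) unfolding eventually_at_right_field by (intro exI[of _ "r / 3"]) auto
    ultimately have "\<forall>\<^sub>F e in at_right 0. 0 < e \<and> e < r / 3 \<and> energy u (3 * e) < d \<and> D * (E e / e ^ m) < 1"
      by eventually_elim auto
    from eventually_happens'[OF trivial_limit_at_right_real this]
    obtain e where e: "0 < e" "e < r / 3" "energy u (3 * e) < d" "D * (E e / e ^ m) < 1"
      by blast
    have e_le: "e \<le> 1" using e r by auto
    note \<theta> = cutoff_familyD(2-5)[OF cf e(1)] cutoff_familyD(6,7)[OF cf e(1) e_le]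
    have \<theta>C: "\<theta> e \<in> C0_infty UNIV"
      using \<theta>(1,4) by (intro C0_inftyI[of _ "cball 0 (2 * e)"]) auto
    define T where "T = commutator (\<theta> e)"
    have T: "square_integrable T"
      unfolding T_def by (rule commutator_square_integrable[OF \<theta>C])
    define \<zeta> where "\<zeta> = (\<lambda>x. v x - \<theta> e x)"
    have \<zeta>: "\<zeta> \<in> C0_infty (ball 0 1 - {0})"
    proof (rule C0_inftyI)
      show "smooth \<zeta>" unfolding \<zeta>_def by (intro smooth_diff v(1) \<theta>(1))
      show "compact (cball 0 ((1 + \<rho>) / 2) - ball (0::real^'n) e)"
        by (intro compact_diff) auto
      show "cball 0 ((1 + \<rho>) / 2) - ball (0::real^'n) e \<subseteq> ball 0 1 - {0}"
        using e(1) \<rho> by auto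
      show "\<zeta> x = 0" if "x \<notin> cball 0 ((1 + \<rho>) / 2) - ball (0::real^'n) e" for x
      proof (cases "norm x < e")
        case True
        then show ?thesis using e r by (simp add: \<zeta>_def v(2) \<theta>(3))
      next
        case False
        then have "norm x \<ge> (1 + \<rho>) / 2" using that by auto
        then show ?thesis using e r \<rho> by (simp add: \<zeta>_def v(3) \<theta>(4))
      qed
    qed
    have split: "commutator \<zeta> x = X x - T x" for x
      unfolding \<zeta>_def X_def T_def by (rule commutator_diff[OF v(1) \<theta>(1)])
    have WX: "(W x * X x)\<^sup>2 \<le> (X x)\<^sup>2" for x
    proof (cases "norm x < \<rho>")
      case True
      then have "X x = 0"
        unfolding X_def using v(2) by (intro commutator_locally_constant[of "ball 0 \<rho>" x v 1]) auto
      then show ?thesis by simp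
    next
      case False
      then have "norm x powr (- l) \<le> \<rho> powr (- l)"
        using \<rho> l0 by (intro powr_mono2') auto
      then have "W x \<le> s * \<rho> powr (- l)"
        unfolding W_def using s by (intro mult_left_mono) auto
      also have "\<dots> = 1" using \<rho> by (simp add: s_def powr_minus)
      finally have "(W x)\<^sup>2 \<le> 1" using W0 by (simp add: power_le_one)
      then show ?thesis by (simp add: power_mult_distrib mult_left_le_one_le)
    qed
    have Tsq: "(T x)\<^sup>2 \<le> real CARD('n) * (8 * C\<^sup>2) / e ^ 4 * H x" for x
    proof -
      have "(T x)\<^sup>2 \<le> real CARD('n) * (\<Sum>i\<in>UNIV.
          (2 * (g i x * partial i (\<theta> e) x) + u x * partial i (partial i (\<theta> e)) x)\<^sup>2)"
        unfolding T_def commutator_def by (rule square_sum_le) simp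
      also have "\<dots> \<le> real CARD('n) * (\<Sum>i\<in>UNIV. 8 * (C / e\<^sup>2)\<^sup>2 * ((g i x)\<^sup>2 + (u x)\<^sup>2))"
      proof (intro mult_left_mono sum_mono)
        fix i :: 'n
        define a b where "a = partial i (\<theta> e) x" and "b = partial i (partial i (\<theta> e)) x"
        have ab: "a\<^sup>2 \<le> (C / e\<^sup>2)\<^sup>2" "b\<^sup>2 \<le> (C / e\<^sup>2)\<^sup>2"
          using \<theta>(5,6)[of i x] C by (simp_all add: a_def b_def abs_le_square_iff[symmetric])
        have "(2 * (g i x * a) + u x * b)\<^sup>2 \<le> 8 * ((g i x)\<^sup>2 * a\<^sup>2) + 2 * ((u x)\<^sup>2 * b\<^sup>2)"
          using zero_le_power2[of "2 * (g i x * a) - u x * b"]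
          unfolding power2_diff power2_sum power_mult_distrib by (simp add: mult_ac)
        also have "\<dots> \<le> 8 * ((g i x)\<^sup>2 * (C / e\<^sup>2)\<^sup>2) + 8 * ((u x)\<^sup>2 * (C / e\<^sup>2)\<^sup>2)"
          using ab by (intro add_mono mult_mono) auto
        finally show "(2 * (g i x * a) + u x * b)\<^sup>2 \<le> 8 * (C / e\<^sup>2)\<^sup>2 * ((g i x)\<^sup>2 + (u x)\<^sup>2)"
          by (simp add: algebra_simps)
      qed simp
      also have "\<dots> = real CARD('n) * (8 * C\<^sup>2) / e ^ 4 * H x"
        by (simp add: H_def sum_distrib_left power_divide mult.assoc flip: power_mult)
      finally show ?thesis .
    qed
    have H0: "0 \<le> H x" for x by (simp add: H_def sum_nonneg)
    have D0: "0 \<le> D" by (simp add: D_def)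
    have WT: "(W x * T x)\<^sup>2 \<le> D / e ^ m * (indicator (ball 0 (3 * e)) x * H x)" for x
    proof -
      consider "norm x < e" | "norm x \<ge> 3 * e" | "e \<le> norm x" "norm x < 3 * e" by linarith
      then show ?thesis
      proof cases
        case 1
        then have "T x = 0"
          unfolding T_def using \<theta>(3) by (intro commutator_locally_constant[of "ball 0 e" x _ 1]) auto
        then show ?thesis using D0 H0[of x] e(1) by simp
      next
        case 2
        then have "T x = 0"
          unfolding T_def using \<theta>(4) e(1)
          by (intro commutator_locally_constant[of "- cball 0 (2 * e)" x _ 0]) auto
        then show ?thesis using 2 by simp
      next
        case 3
        have "norm x powr (- l) \<le> e powr (- l)"
          using 3 e(1) l0 by (intro powr_mono2') auto
        then have "W x \<le> s * e powr (- l)"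
          unfolding W_def using s by (intro mult_left_mono) auto
        then have W2: "(W x)\<^sup>2 \<le> (s * e powr (- l))\<^sup>2"
          using W0 by (intro power_mono)
        have "(W x * T x)\<^sup>2 \<le> (s * e powr (- l))\<^sup>2 * (real CARD('n) * (8 * C\<^sup>2) / e ^ 4 * H x)"
          unfolding power_mult_distrib[of "W x"] using W2 Tsq by (intro mult_mono) auto
        also have "\<dots> = D * ((e powr (- l))\<^sup>2 / e ^ 4) * H x"
          by (simp add: D_def power_mult_distrib)
        also have "(e powr (- l))\<^sup>2 / e ^ 4 = e powr (- (2 * l + 4))"
        proof -
          have "(e powr (- l))\<^sup>2 = e powr (- (2 * l))"
            using abs_powr_2[of "e powr (- l)"] by (simp add: powr_powr mult.commute)
          moreover have "e ^ 4 = e powr 4" using e(1) by (simp add: powr_numeral)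
          ultimately show ?thesis by (simp add: powr_diff[symmetric])
        qed
        also have "D * e powr (- (2 * l + 4)) * H x \<le> D * (1 / e ^ m) * H x"
        proof -
          have "e powr (- (2 * l + 4)) \<le> e powr (- real m)"
            using m e(1) e_le by (intro powr_mono') auto
          also have "\<dots> = 1 / e ^ m" using e(1) by (simp add: powr_minus powr_realpow divide_inverse)
          finally show ?thesis using D0 H0 by (intro mult_right_mono mult_left_mono)
        qed
        finally show ?thesis using 3 by simp
      qed
    qed
    have "(LINT x|lborel. (s * norm x powr (- l) * commutator \<zeta> x)\<^sup>2) \<le>
        (LINT x|lborel. 2 * (X x)\<^sup>2 + 2 * (D / e ^ m) * (indicator (ball 0 (3 * e)) x * H x))"
    proof (rule integral_mono')
      show "integrable lborel (\<lambda>x. 2 * (X x)\<^sup>2 + 2 * (D / e ^ m) * (indicator (ball 0 (3 * e)) x * H x))"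
        using X HE(1)[of e] by (simp add: square_integrable_def)
      fix x
      have "(s * norm x powr (- l) * commutator \<zeta> x)\<^sup>2 = (W x * X x - W x * T x)\<^sup>2"
        by (simp add: W_def split right_diff_distrib)
      also have "\<dots> \<le> 2 * (W x * X x)\<^sup>2 + 2 * (W x * T x)\<^sup>2"
        using zero_le_power2[of "W x * X x + W x * T x"] by (simp add: power2_diff power2_sum)
      also have "\<dots> \<le> 2 * (X x)\<^sup>2 + 2 * (D / e ^ m) * (indicator (ball 0 (3 * e)) x * H x)"
        using WX[of x] WT[of x] by simp
      finally show "(s * norm x powr (- l) * commutator \<zeta> x)\<^sup>2 \<le>
        2 * (X x)\<^sup>2 + 2 * (D / e ^ m) * (indicator (ball 0 (3 * e)) x * H x)" .
      show "0 \<le> 2 * (X x)\<^sup>2 + 2 * (D / e ^ m) * (indicator (ball 0 (3 * e)) x * H x)"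
        using D0 H0[of x] e(1) by (intro add_nonneg_nonneg mult_nonneg_nonneg) auto
    qed
    also have "\<dots> = 2 * (LINT x|lborel. (X x)\<^sup>2) + 2 * (D * (E e / e ^ m))"
      using X HE[of e] by (simp add: square_integrable_def)
    also have "\<dots> \<le> M" using e(4) by (simp add: M_def)
    finally have "(LINT x|lborel. (s * norm x powr (- l) * (u x * \<zeta> x))\<^sup>2) \<le> K"
      unfolding K_def
      by (intro carleman_commutator[OF n q \<kappa> carleman[OF _ l] eqn \<zeta> s l0 _ J_def])
    then have WK: "(LINT x|lborel. (W x * (u x * \<zeta> x))\<^sup>2) \<le> K" by (simp add: W_def)
    obtain c where c: "\<And>x. \<bar>\<zeta> x\<bar> \<le> c" using C0_infty_bounded[OF \<zeta>] by metis
    define t where "t = (r / \<rho>) powr (2 * l)"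
    have t0: "0 \<le> t" by (simp add: t_def)
    have Wi: "integrable lborel (\<lambda>x. (W x * (u x * \<zeta> x))\<^sup>2)"
    proof -
      have [measurable]: "u \<in> borel_measurable borel" "\<zeta> \<in> borel_measurable borel"
        using sq(1) C0_infty_borel[OF \<zeta>] by (auto simp: square_integrable_def)
      have "square_integrable (\<lambda>x. W x * (u x * \<zeta> x))"
      proof (rule square_integrable_le[OF sq(1)])
        show "(\<lambda>x. W x * (u x * \<zeta> x)) \<in> borel_measurable borel" by (simp add: W_def)
        show "\<bar>W x * (u x * \<zeta> x)\<bar> \<le> (s * e powr (- l) * c) * \<bar>u x\<bar>" for x
        proof (cases "norm x < e")
          case True
          then have "\<zeta> x = 0" using e r by (simp add: \<zeta>_def v(2) \<theta>(3))
          moreover have "0 \<le> c" using c[of x] by linarith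
          ultimately show ?thesis using s by simp
        next
          case False
          then have "W x \<le> s * e powr (- l)"
            unfolding W_def using s e(1) l0 by (intro mult_left_mono powr_mono2') auto
          then have "W x * \<bar>\<zeta> x\<bar> \<le> (s * e powr (- l)) * c"
            using c[of x] s by (intro mult_mono) auto
          then have "W x * \<bar>\<zeta> x\<bar> * \<bar>u x\<bar> \<le> (s * e powr (- l)) * c * \<bar>u x\<bar>"
            by (intro mult_right_mono) auto
          then show ?thesis using W0[of x] by (simp add: abs_mult mult_ac)
        qed
      qed
      then show ?thesis by (simp add: square_integrable_def)
    qed
    have "energy u r \<le> (LINT x|lborel. indicator (ball 0 (3 * e)) x * (u x)\<^sup>2 + t * (W x * (u x * \<zeta> x))\<^sup>2)"
      unfolding energy_def
    proof (rule integral_mono')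
      show "integrable lborel (\<lambda>x. indicator (ball 0 (3 * e)) x * (u x)\<^sup>2 + t * (W x * (u x * \<zeta> x))\<^sup>2)"
        using Wi energy_integrable[OF sq(1), of "ball 0 (3 * e)"] by simp
      fix x
      show "indicator (ball 0 r) x * (u x)\<^sup>2 \<le>
          indicator (ball 0 (3 * e)) x * (u x)\<^sup>2 + t * (W x * (u x * \<zeta> x))\<^sup>2"
      proof (cases "norm x < r \<and> norm x \<ge> 3 * e")
        case True
        then have x: "norm x < r" "3 * e \<le> norm x" "0 < norm x" using e(1) by auto
        then have z: "\<zeta> x = 1" using e(1) r by (simp add: \<zeta>_def v(2) \<theta>(4))
        \<comment> \<open>For |x| < r the weight is at least (\<rho> / r)^l, which is the origin of
          the decaying factor t.\<close>
        have "1 \<le> (r / norm x) powr l" using x l0 by (intro ge_one_powr_ge_zero) auto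
        also have "\<dots> = (r / \<rho>) powr l * W x"
        proof -
          have "(r / norm x) powr l = r powr l / norm x powr l"
            "(r / \<rho>) powr l = r powr l / \<rho> powr l"
            using x r by (simp_all add: powr_divide)
          moreover have "\<rho> powr l > 0" using \<rho> by simp
          ultimately show ?thesis by (simp add: W_def s_def powr_minus_divide)
        qed
        finally have "1 \<le> ((r / \<rho>) powr l * W x)\<^sup>2" by (simp add: one_le_power)
        also have "\<dots> = t * (W x)\<^sup>2"
          using abs_powr_2[of "(r / \<rho>) powr l"]
          by (simp add: t_def power_mult_distrib powr_powr mult.commute)
        finally have "1 * (u x)\<^sup>2 \<le> t * (W x)\<^sup>2 * (u x)\<^sup>2" by (intro mult_right_mono) auto
        then show ?thesis using x z by (simp add: power_mult_distrib mult.assoc)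
      next
        case False
        then show ?thesis using t0 by (auto simp: indicator_def)
      qed
    qed (use t0 in simp)
    also have "\<dots> = energy u (3 * e) + t * (LINT x|lborel. (W x * (u x * \<zeta> x))\<^sup>2)"
      using Wi energy_integrable[OF sq(1), of "ball 0 (3 * e)"] by (simp add: energy_def)
    also have "\<dots> \<le> d + t * K"
      using e(3) WK t0 by (intro add_mono mult_left_mono) auto
    finally show "energy u r \<le> (r / \<rho>) powr (2 * l) * K + d" by (simp add: t_def)
  qed
  have le: "energy u r \<le> (r / \<rho>) ^ Suc k * K" for k
  proof -
    \<comment> \<open>\<open>Lambda_shifted\<close> asks for a positive integer, hence
      \<open>Suc k\<close>; the exponent 2 l is then weakened to \<open>Suc k\<close> to obtain a
      geometric sequence.\<close>
    define l where "l = real (Suc k) + (real CARD('n) - 2) / 2 + 1 / 2"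
    have "l \<in> Lambda TYPE('n)" unfolding l_def using n by (intro Lambda_shifted) auto
    from main[OF this] have "energy u r \<le> (r / \<rho>) powr (2 * l) * K" .
    also have "(r / \<rho>) powr (2 * l) \<le> (r / \<rho>) powr real (Suc k)"
    proof (rule powr_mono')
      define c where "c = (real CARD('n) - 2) / 2"
      have "0 \<le> c" using n by (simp add: c_def)
      then have "real (Suc k) \<le> l" unfolding l_def c_def[symmetric] by simp
      moreover have "0 \<le> real (Suc k)" by simp
      ultimately show "real (Suc k) \<le> 2 * l" by linarith
    qed (use r \<rho> in auto)
    also have "(r / \<rho>) powr real (Suc k) = (r / \<rho>) ^ Suc k"
      using r \<rho> by (intro powr_realpow) auto
    finally show ?thesis using K by (simp add: mult_right_mono)
  qed
  have "(\<lambda>k. (r / \<rho>) ^ Suc k * K) \<longlonglongrightarrow> 0"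
    using r \<rho> by (intro tendsto_mult_left_zero LIMSEQ_Suc LIMSEQ_realpow_zero) auto
  then have "energy u r \<le> 0"
    using le by (intro LIMSEQ_le_const) auto
  then show ?thesis using energy_nonneg[of u r] by simp
qed

text \<open>The analysis is complete with \<open>energy_eq_zero\<close>; here u, q and the equation
  are transferred to Borel representatives, and the unit ball is exhausted by concentric
  balls.\<close>

theorem corollary1p2:
  fixes q u :: "real^'n \<Rightarrow> real" and r_star r0 \<theta> :: real
  assumes "CARD('n) \<ge> 3"
    and "carleman_radius TYPE('n) r_star"
    and "0 < r0" and "r0 < r_star"
    and "\<theta> > 0" and "2 * \<theta> * (sobolev_const TYPE('n))\<^sup>2 < 1"
    and "q \<in> potentials r0 \<theta>"
    and "u \<in> sobolev_H 2 (ball 0 1)"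
    and "AE x in lebesgue_on (ball 0 1). weak_laplacian (ball 0 1) u x + q x * u x = 0"
    and "vanishes_infinite_order u"
  shows "AE x in lebesgue_on (ball 0 1). u x = 0"
proof -
  define B where "B = ball (0::real^'n) 1"
  have B: "B \<in> sets borel" by (simp add: B_def)
  have m: "f \<in> borel_measurable (lebesgue_on B)" if "f \<in> borel_measurable borel" for f :: "real^'n \<Rightarrow> real"
    using that by (intro measurable_restrict_space1 measurable_completion) auto
  have qm: "q \<in> borel_measurable (lebesgue_on B)"
    using assms(7) by (simp add: potentials_def Lp_def B_def)
  obtain q0 where q0: "q0 \<in> borel_measurable borel" "\<And>x. x \<notin> B \<Longrightarrow> q0 x = 0"
    "AE x in lebesgue_on B. q x = q0 x"
    using borel_representative[OF B qm] by blast
  have "q0 \<in> potentials r0 \<theta>"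
  proof -
    have "integrable (lebesgue_on B) (\<lambda>x. \<bar>q0 x\<bar> powr CARD('n)) \<longleftrightarrow>
        integrable (lebesgue_on B) (\<lambda>x. \<bar>q x\<bar> powr CARD('n))"
      using qm m[OF q0(1)] q0(3) by (intro integrable_cong_AE) (auto elim: eventually_mono)
    moreover have "Lp_norm B CARD('n) q0 = Lp_norm B CARD('n) q"
    proof -
      have "(LINT x|lebesgue_on B. norm (q0 x) powr CARD('n)) =
          (LINT x|lebesgue_on B. norm (q x) powr CARD('n))"
        using qm m[OF q0(1)] q0(3) by (intro integral_cong_AE) (auto elim: eventually_mono)
      then show ?thesis by (simp add: Lp_norm_def)
    qed
    ultimately show ?thesis
      using assms(7) m[OF q0(1)] by (simp add: potentials_def Lp_def B_def)
  qed
  then have q0L: "q0 \<in> closed_ball_Ln2 r0" "integrable lborel (\<lambda>x. \<bar>q0 x\<bar> powr CARD('n))"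
    using potential_in_closed_ball_Ln2[of q0 r0 \<theta>] q0(1,2) by (simp_all add: B_def)
  obtain u0 g h where H2: "H2_ball u0 g h" and u0: "AE x in lborel. x \<in> ball 0 1 \<longrightarrow> u x = u0 x"
    and lap: "AE x in lborel. x \<in> ball 0 1 \<longrightarrow> weak_laplacian (ball 0 1) u x = (\<Sum>i\<in>UNIV. h i x)"
    using sobolev_H_2_representatives[OF assms(8)] by blast
  interpret H2_ball u0 g h by (rule H2)
  have "AE x in lborel. x \<in> ball 0 1 \<longrightarrow> weak_laplacian (ball 0 1) u x + q x * u x = 0"
    "AE x in lborel. x \<in> ball 0 1 \<longrightarrow> q x = q0 x"
    using assms(9) q0(3) unfolding B_def[symmetric] by (simp_all only: AE_lebesgue_on_iff_lborel[OF B])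
  with u0 lap have eqn: "AE x in lborel. x \<in> ball 0 1 \<longrightarrow> (\<Sum>i\<in>UNIV. h i x) + q0 x * u0 x = 0"
    by eventually_elim auto
  \<comment> \<open>\<open>carleman_radius\<close> fixes \<kappa> before the potential and the
    exponent, so one constant serves all l.\<close>
  obtain \<kappa> where \<kappa>: "\<kappa> > 0" "\<And>\<phi> l. \<phi> \<in> C0_infty (ball (0::real^'n) 1 - {0}) \<Longrightarrow> l \<in> Lambda TYPE('n) \<Longrightarrow>
      Lp_norm (ball 0 1) (exp_p' TYPE('n)) (\<lambda>x. norm x powr (- l) * \<phi> x) \<le>
      \<kappa> * Lp_norm (ball 0 1) (exp_p TYPE('n)) (\<lambda>x. norm x powr (- l) * (laplacian \<phi> x + q0 x * \<phi> x))"
    using assms(2-4) q0L(1) unfolding carleman_radius_def by meson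
  obtain \<gamma> where \<gamma>: "0 < \<gamma>" "\<gamma> < 1" "\<And>m::nat. m > 0 \<Longrightarrow> \<exists>c>0. \<forall>r. 0 < r \<and> r < \<gamma> \<longrightarrow>
      (1 / r ^ m) * (LINT x|lebesgue_on (ball 0 r). \<bar>u x\<bar>\<^sup>2) \<le> c"
    using assms(10) unfolding vanishes_infinite_order_def by blast
  have [measurable]: "u0 \<in> borel_measurable borel"
    using sq(1) by (simp add: square_integrable_def)
  have um: "u \<in> borel_measurable (lebesgue_on B)"
    using assms(8) by (simp add: sobolev_H_def Lp_def B_def)
  \<comment> \<open>Measurability of u and its agreement with u0 are known on the unit ball, hence r
    < 1 and the truncation by the indicator of B.\<close>
  have energy_u0: "(LINT x|lebesgue_on (ball 0 r). \<bar>u x\<bar>\<^sup>2) = energy u0 r" if "r < 1" for r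
  proof -
    have sub: "ball (0::real^'n) r \<subseteq> ball 0 1" using that by auto
    have "(\<lambda>x. indicator B x * u x) \<in> borel_measurable lebesgue"
      using um B by (subst (asm) borel_measurable_restrict_space_iff) (auto simp: mult.commute)
    then have m1: "(\<lambda>x. indicator (ball 0 r) x * (indicator B x * u x)\<^sup>2) \<in> borel_measurable lebesgue"
      by (rule borel_measurable_times[OF borel_measurable_indicator borel_measurable_power, rotated]) simp
    have m0: "(\<lambda>x. indicator (ball 0 r) x * (u0 x)\<^sup>2) \<in> borel_measurable lborel"
      using energy_integrable[OF sq(1), of "ball 0 r"] by (intro borel_measurable_integrable) simp
    have "(\<lambda>x. indicator (ball 0 r) x * (u0 x)\<^sup>2) \<in> borel_measurable lebesgue"
      using m0 by (rule measurable_completion)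
    moreover have "AE x in lebesgue. indicator (ball 0 r) x * (indicator B x * u x)\<^sup>2 =
        indicator (ball 0 r) x * (u0 x)\<^sup>2"
      using AE_completion[OF u0] by (rule eventually_mono) (use sub in \<open>auto simp: B_def indicator_def\<close>)
    ultimately have "(LINT x|lebesgue. indicator (ball 0 r) x * (indicator B x * u x)\<^sup>2) =
        (LINT x|lebesgue. indicator (ball 0 r) x * (u0 x)\<^sup>2)"
      by (rule integral_cong_AE[OF m1])
    moreover have "indicator (ball 0 r) x * (indicator B x * u x)\<^sup>2 =
        indicat_real (ball 0 r) x *\<^sub>R \<bar>u x\<bar>\<^sup>2" for x
      using sub by (auto simp: B_def indicator_def)
    moreover have "(LINT x|lebesgue. indicator (ball 0 r) x * (u0 x)\<^sup>2) = energy u0 r"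
      unfolding energy_def using m0 by (rule integral_completion)
    ultimately show ?thesis
      by (subst integral_restrict_space) auto
  qed
  have flat: "flat_at_0 (energy u0)"
    unfolding flat_at_0_def
  proof
    fix m :: nat
    \<comment> \<open>One spare power of r turns the bound c into c r, which tends to 0; it also
      makes the exponent positive.\<close>
    have "\<exists>c>0. \<forall>r. 0 < r \<and> r < \<gamma> \<longrightarrow>
        (1 / r ^ Suc m) * (LINT x|lebesgue_on (ball 0 r). \<bar>u x\<bar>\<^sup>2) \<le> c"
      by (rule \<gamma>(3)) simp
    then obtain c where c: "\<forall>r. 0 < r \<and> r < \<gamma> \<longrightarrow>
        (1 / r ^ Suc m) * (LINT x|lebesgue_on (ball 0 r). \<bar>u x\<bar>\<^sup>2) \<le> c"
      by (elim exE conjE)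
    have le: "energy u0 r / r ^ m \<le> c * r" if r: "0 < r" "r < \<gamma>" for r
    proof -
      have "(1 / r ^ Suc m) * energy u0 r \<le> c"
        using c[rule_format, of r] r energy_u0[of r] \<gamma>(2) by simp
      from mult_right_mono[OF this, of r] show ?thesis using r by simp
    qed
    have e2: "\<forall>\<^sub>F r in at_right 0. energy u0 r / r ^ m \<le> c * r"
      unfolding eventually_at_right_field using \<gamma>(1) le by (intro exI[of _ \<gamma>]) simp
    have e1: "\<forall>\<^sub>F r in at_right 0. 0 \<le> energy u0 r / r ^ m"
      unfolding eventually_at_right_field
      by (intro exI[of _ 1]) (auto intro!: divide_nonneg_pos energy_nonneg)
    have e3: "((\<lambda>r. c * r) \<longlongrightarrow> 0) (at_right 0)"
      by (intro tendsto_mult_right_zero tendsto_ident_at)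
    show "((\<lambda>r. energy u0 r / r ^ m) \<longlongrightarrow> 0) (at_right 0)"
      by (rule tendsto_sandwich[OF e1 e2 tendsto_const e3])
  qed
  have zero: "AE x in lborel. x \<in> ball 0 r \<longrightarrow> u0 x = 0" if r: "0 < r" "r < 1" for r
  proof -
    obtain \<rho> where \<rho>: "r < \<rho>" "\<rho> < 1" using r(2) dense by blast
    have "energy u0 r = 0"
      using q0(2) unfolding B_def
      by (intro energy_eq_zero[OF assms(1) q0(1) _ q0L(2) \<kappa> eqn flat r(1) \<rho>])
    then have "AE x in lborel. indicator (ball 0 r) x * (u0 x)\<^sup>2 = 0"
      using energy_integrable[OF sq(1), of "ball 0 r"]
        integral_nonneg_eq_0_iff_AE[of lborel "\<lambda>x. indicator (ball 0 r) x * (u0 x)\<^sup>2"]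
      by (simp add: energy_def)
    then show ?thesis by (rule eventually_mono) auto
  qed
  \<comment> \<open>Countably many radii keep the exceptional set null; k + 2 makes every radius
    positive, as \<open>zero\<close> demands.\<close>
  have "AE x in lborel. \<forall>k::nat. x \<in> ball 0 (1 - 1 / real (k + 2)) \<longrightarrow> u0 x = 0"
    unfolding AE_all_countable by (intro allI zero) auto
  with u0 have "AE x in lborel. x \<in> B \<longrightarrow> u x = 0"
  proof eventually_elim
    case (elim x)
    show ?case
    proof
      assume "x \<in> B"
      then have x: "0 < 1 - norm x" by (simp add: B_def)
      then obtain k :: nat where "1 / real (Suc k) < 1 - norm x"
        using nat_approx_posE by blast
      moreover have "1 / real (k + 2) \<le> 1 / real (Suc k)" by (intro divide_left_mono) auto
      ultimately have "x \<in> ball 0 (1 - 1 / real (k + 2))" by simp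
      then show "u x = 0" using elim \<open>x \<in> B\<close> by (auto simp: B_def)
    qed
  qed
  then show ?thesis
    unfolding B_def[symmetric] by (simp only: AE_lebesgue_on_iff_lborel[OF B])
qed

end
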